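(* Let $\phi:R\to S$ be a stably flat epimorphism of rings. Then $$\text{global dimension}(S)\;\le\;\text{global dimension}(R).$$
   Context: Rings are associative with $1$. An epimorphism of rings means an epimorphism in the category of rings. A ring homomorphism $R\to S$ is stably flat (one says $S$ is stably flat over $R$) if $\mathrm{Tor}_i^R(S,S)=0$ for all $i>0$. Global dimension (possibly infinite) is computed with left modules over both rings (or with right modules over both rings). *)

theory Defs
  imports "HOL-Algebra.Module" "HOL-Algebra.Free_Abelian_Groups" "HOL-Library.Extended_Nat"
begin

section \<open>Opposite rings and modules over arbitrary rings\<close>

definition opposite :: "('a, 'k) ring_scheme \<Rightarrow> ('a, 'k) ring_scheme" where
  "opposite R = R\<lparr>monoid.mult := (\<lambda>x y. y \<otimes>\<^bsub>R\<^esub> x)\<rparr>"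

text \<open>The library locale \<^locale>\<open>module\<close> requires the ring to be commutative; this is the same
  notion over an arbitrary ring, on the same record type (whose fields for multiplication and one
  play no role). A right \<open>R\<close>-module is a left module over \<open>opposite R\<close>, with
  \<open>r \<odot> x\<close> standing for \<open>x r\<close>.\<close>

locale left_module = R?: ring R + M?: abelian_group M
  for R :: "('a, 'k) ring_scheme" (structure) and M :: "('a, 'm, 'l) module_scheme" (structure) +
  assumes smult_closed [simp, intro]:
      "\<lbrakk>a \<in> carrier R; x \<in> carrier M\<rbrakk> \<Longrightarrow> a \<odot>\<^bsub>M\<^esub> x \<in> carrier M"
    and smult_l_distr:
      "\<lbrakk>a \<in> carrier R; b \<in> carrier R; x \<in> carrier M\<rbrakk> \<Longrightarrow>
       (a \<oplus> b) \<odot>\<^bsub>M\<^esub> x = a \<odot>\<^bsub>M\<^esub> x \<oplus>\<^bsub>M\<^esub> b \<odot>\<^bsub>M\<^esub> x"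
    and smult_r_distr:
      "\<lbrakk>a \<in> carrier R; x \<in> carrier M; y \<in> carrier M\<rbrakk> \<Longrightarrow>
       a \<odot>\<^bsub>M\<^esub> (x \<oplus>\<^bsub>M\<^esub> y) = a \<odot>\<^bsub>M\<^esub> x \<oplus>\<^bsub>M\<^esub> a \<odot>\<^bsub>M\<^esub> y"
    and smult_assoc:
      "\<lbrakk>a \<in> carrier R; b \<in> carrier R; x \<in> carrier M\<rbrakk> \<Longrightarrow>
       (a \<otimes> b) \<odot>\<^bsub>M\<^esub> x = a \<odot>\<^bsub>M\<^esub> (b \<odot>\<^bsub>M\<^esub> x)"
    and smult_one [simp]:
      "x \<in> carrier M \<Longrightarrow> \<one> \<odot>\<^bsub>M\<^esub> x = x"

definition left_module_hom ::
  "('a, 'k) ring_scheme \<Rightarrow> ('a, 'm) module \<Rightarrow> ('a, 'n) module \<Rightarrow> ('m \<Rightarrow> 'n) set" where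
  "left_module_hom R M N = {f \<in> carrier M \<rightarrow> carrier N.
     (\<forall>x\<in>carrier M. \<forall>y\<in>carrier M. f (x \<oplus>\<^bsub>M\<^esub> y) = f x \<oplus>\<^bsub>N\<^esub> f y) \<and>
     (\<forall>r\<in>carrier R. \<forall>x\<in>carrier M. f (r \<odot>\<^bsub>M\<^esub> x) = r \<odot>\<^bsub>N\<^esub> f x)}"

definition regular_module :: "('a, 'k) ring_scheme \<Rightarrow> ('a, 'a) module" where
  "regular_module R = \<lparr>carrier = carrier R, monoid.mult = monoid.mult R, one = one R,
     ring.zero = ring.zero R, ring.add = ring.add R, smult = monoid.mult R\<rparr>"

definition restrict_scalars :: "('a \<Rightarrow> 'b) \<Rightarrow> ('b, 'm) module \<Rightarrow> ('a, 'm) module" where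
  "restrict_scalars \<phi> M = \<lparr>carrier = carrier M, monoid.mult = monoid.mult M, one = one M,
     ring.zero = ring.zero M, ring.add = ring.add M, smult = (\<lambda>r x. \<phi> r \<odot>\<^bsub>M\<^esub> x)\<rparr>"

lemma ring_opposite:
  assumes "ring R" shows "ring (opposite R)"
proof -
  interpret ring R by fact
  have "abelian_group (opposite R)"
    by (rule abelian_groupI) (auto simp: opposite_def a_ac intro: l_neg)
  moreover have "monoid (opposite R)"
    by (rule monoidI) (auto simp: opposite_def m_assoc)
  ultimately show ?thesis
    by (rule ringI) (auto simp: opposite_def l_distr r_distr)
qed

lemma ring_hom_opposite: "\<phi> \<in> ring_hom R S \<Longrightarrow> \<phi> \<in> ring_hom (opposite R) (opposite S)"
  by (auto simp: opposite_def ring_hom_def)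

lemma left_module_regular:
  assumes "ring R" shows "left_module R (regular_module R)"
proof -
  interpret ring R by fact
  have "abelian_group (regular_module R)"
    by (rule abelian_groupI) (auto simp: regular_module_def a_ac intro: l_neg)
  with assms show ?thesis
    by (intro left_module.intro left_module_axioms.intro)
      (auto simp: regular_module_def l_distr r_distr m_assoc)
qed

lemma left_module_restrict_scalars:
  assumes "ring R" "\<phi> \<in> ring_hom R S" "left_module S M"
  shows "left_module R (restrict_scalars \<phi> M)"
proof -
  interpret R: ring R by fact
  interpret M: left_module S M by fact
  have "abelian_group (restrict_scalars \<phi> M)"
    by (rule abelian_groupI) (auto simp: restrict_scalars_def M.M.a_ac intro: M.M.l_neg)
  with \<open>ring R\<close> assms(2) show ?thesis
    by (intro left_module.intro left_module_axioms.intro)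
      (auto simp: restrict_scalars_def ring_hom_def Pi_iff
         M.smult_l_distr M.smult_r_distr M.smult_assoc)
qed


section \<open>Epimorphisms of rings\<close>

text \<open>HOL cannot quantify over types inside a formula, so the test rings of an epimorphism, and
  below the modules in a resolution and those entering the global dimension, have their carriers
  in a type \<open>'u\<close>, which acts as the universe. It is passed as an argument of type
  \<^typ>\<open>'u itself\<close> where it is not visible in another argument. The notions are meant
  for an infinite \<open>'u\<close> into which the carriers of the rings concerned inject: then test rings
  and free modules of the size required always exist in \<open>'u\<close>.\<close>

definition ring_epi ::
  "'u itself \<Rightarrow> ('a, 'k) ring_scheme \<Rightarrow> ('b, 'l) ring_scheme \<Rightarrow> ('a \<Rightarrow> 'b) \<Rightarrow> bool" where
  "ring_epi U R S \<phi> \<longleftrightarrow> \<phi> \<in> ring_hom R S \<and>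
     (\<forall>T :: 'u ring. ring T \<longrightarrow> (\<forall>g\<in>ring_hom S T. \<forall>h\<in>ring_hom S T.
        (\<forall>x\<in>carrier R. g (\<phi> x) = h (\<phi> x)) \<longrightarrow> (\<forall>y\<in>carrier S. g y = h y)))"


section \<open>Projective resolutions and global dimension\<close>

definition projective :: "('a, 'k) ring_scheme \<Rightarrow> ('a, 'u) module \<Rightarrow> bool" where
  "projective R P \<longleftrightarrow> left_module R P \<and>
     (\<forall>(M :: ('a, 'u) module) (N :: ('a, 'u) module).
        left_module R M \<longrightarrow> left_module R N \<longrightarrow>
        (\<forall>g\<in>left_module_hom R M N. \<forall>f\<in>left_module_hom R P N.
           g ` carrier M = carrier N \<longrightarrow>
           (\<exists>h\<in>left_module_hom R P M. \<forall>x\<in>carrier P. g (h x) = f x)))"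

text \<open>The sequence \<open>\<dots> \<rightarrow> P 2 \<rightarrow> P 1 \<rightarrow> P 0 \<rightarrow> M \<rightarrow> 0\<close> with maps
  \<open>d n : P (n + 1) \<rightarrow> P n\<close> and \<open>\<epsilon> : P 0 \<rightarrow> M\<close> is exact and all \<open>P n\<close> are projective.\<close>

definition projective_resolution ::
  "('a, 'k) ring_scheme \<Rightarrow> ('a, 'm) module \<Rightarrow>
   (nat \<Rightarrow> ('a, 'u) module) \<Rightarrow> (nat \<Rightarrow> 'u \<Rightarrow> 'u) \<Rightarrow> ('u \<Rightarrow> 'm) \<Rightarrow> bool" where
  "projective_resolution R M P d \<epsilon> \<longleftrightarrow>
     (\<forall>n. projective R (P n)) \<and>
     (\<forall>n. d n \<in> left_module_hom R (P (Suc n)) (P n)) \<and>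
     \<epsilon> \<in> left_module_hom R (P 0) M \<and>
     \<epsilon> ` carrier (P 0) = carrier M \<and>
     d 0 ` carrier (P 1) = {x \<in> carrier (P 0). \<epsilon> x = \<zero>\<^bsub>M\<^esub>} \<and>
     (\<forall>n. d (Suc n) ` carrier (P (Suc (Suc n))) = {x \<in> carrier (P (Suc n)). d n x = \<zero>\<^bsub>P n\<^esub>})"

definition projective_dimension :: "('a, 'k) ring_scheme \<Rightarrow> ('a, 'u) module \<Rightarrow> enat" where
  "projective_dimension R M = Inf {enat n | n.
     \<exists>(P :: nat \<Rightarrow> ('a, 'u) module) d \<epsilon>. projective_resolution R M P d \<epsilon> \<and>
       (\<forall>k>n. carrier (P k) = {\<zero>\<^bsub>P k\<^esub>})}"

definition left_global_dimension :: "'u itself \<Rightarrow> ('a, 'k) ring_scheme \<Rightarrow> enat" where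
  "left_global_dimension U R =
     (SUP M \<in> {M :: ('a, 'u) module. left_module R M}. projective_dimension R M)"

definition right_global_dimension :: "'u itself \<Rightarrow> ('a, 'k) ring_scheme \<Rightarrow> enat" where
  "right_global_dimension U R = left_global_dimension U (opposite R)"


section \<open>Tensor products over arbitrary rings\<close>

text \<open>\<open>A\<close> is a right module, given as a left module over \<open>opposite R\<close>, and \<open>B\<close> is a left
  module. The tensor product is an abelian group, written multiplicatively as a \<^type>\<open>monoid\<close>
  record, whose elements are cosets in the free abelian group on \<open>carrier A \<times> carrier B\<close>.\<close>

definition tensor_relators ::
  "('a, 'k) ring_scheme \<Rightarrow> ('a, 'p) module \<Rightarrow> ('a, 'q) module \<Rightarrow> ('p \<times> 'q \<Rightarrow>\<^sub>0 int) set" where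
  "tensor_relators R A B =
     {frag_of (x \<oplus>\<^bsub>A\<^esub> x', y) - frag_of (x, y) - frag_of (x', y) | x x' y.
        x \<in> carrier A \<and> x' \<in> carrier A \<and> y \<in> carrier B} \<union>
     {frag_of (x, y \<oplus>\<^bsub>B\<^esub> y') - frag_of (x, y) - frag_of (x, y') | x y y'.
        x \<in> carrier A \<and> y \<in> carrier B \<and> y' \<in> carrier B} \<union>
     {frag_of (r \<odot>\<^bsub>A\<^esub> x, y) - frag_of (x, r \<odot>\<^bsub>B\<^esub> y) | r x y.
        r \<in> carrier R \<and> x \<in> carrier A \<and> y \<in> carrier B}"

definition tensor_relations ::
  "('a, 'k) ring_scheme \<Rightarrow> ('a, 'p) module \<Rightarrow> ('a, 'q) module \<Rightarrow> ('p \<times> 'q \<Rightarrow>\<^sub>0 int) set" where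
  "tensor_relations R A B =
     generate (free_Abelian_group (carrier A \<times> carrier B)) (tensor_relators R A B)"

definition tensor ::
  "('a, 'k) ring_scheme \<Rightarrow> ('a, 'p) module \<Rightarrow> ('a, 'q) module \<Rightarrow> ('p \<times> 'q \<Rightarrow>\<^sub>0 int) set monoid" where
  "tensor R A B = free_Abelian_group (carrier A \<times> carrier B) Mod tensor_relations R A B"

text \<open>The map \<open>f \<otimes> id : A \<otimes> B \<rightarrow> A' \<otimes> B\<close>; for a homomorphism \<open>f\<close> all the cosets in
  the union coincide.\<close>

definition tensor_map ::
  "('a, 'k) ring_scheme \<Rightarrow> ('a, 'p') module \<Rightarrow> ('a, 'q) module \<Rightarrow> ('p \<Rightarrow> 'p') \<Rightarrow>
   ('p \<times> 'q \<Rightarrow>\<^sub>0 int) set \<Rightarrow> ('p' \<times> 'q \<Rightarrow>\<^sub>0 int) set" where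
  "tensor_map R A' B f X =
     (\<Union>c\<in>X. tensor_relations R A' B #>\<^bsub>free_Abelian_group (carrier A' \<times> carrier B)\<^esub>
        frag_extend (\<lambda>(x, y). frag_of (f x, y)) c)"


section \<open>Tor and stable flatness\<close>

text \<open>Homology of \<open>\<dots> \<rightarrow> C 2 \<rightarrow> C 1 \<rightarrow> C 0 \<rightarrow> 0\<close> with \<open>\<delta> n : C (n + 1) \<rightarrow> C n\<close>.\<close>

definition cycles :: "(nat \<Rightarrow> 'c monoid) \<Rightarrow> (nat \<Rightarrow> 'c \<Rightarrow> 'c) \<Rightarrow> nat \<Rightarrow> 'c set" where
  "cycles C \<delta> i = (case i of 0 \<Rightarrow> carrier (C 0) | Suc j \<Rightarrow> kernel (C (Suc j)) (C j) (\<delta> j))"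

definition homology :: "(nat \<Rightarrow> 'c monoid) \<Rightarrow> (nat \<Rightarrow> 'c \<Rightarrow> 'c) \<Rightarrow> nat \<Rightarrow> 'c set monoid" where
  "homology C \<delta> i = (C i)\<lparr>carrier := cycles C \<delta> i\<rparr> Mod (\<delta> i ` carrier (C (Suc i)))"

text \<open>The group \<open>Tor\<^sub>i(A, B)\<close>, for a right module \<open>A\<close> and a left module \<open>B\<close>, is computed
  from a chosen projective resolution of \<open>A\<close> by right modules with carriers in \<open>'u\<close>.\<close>

definition Tor ::
  "'u itself \<Rightarrow> ('a, 'k) ring_scheme \<Rightarrow> ('a, 'p) module \<Rightarrow> ('a, 'q) module \<Rightarrow> nat \<Rightarrow>
   ('u \<times> 'q \<Rightarrow>\<^sub>0 int) set set monoid" where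
  "Tor U R A B i =
     (let (P, d, \<epsilon>) = (SOME (P :: nat \<Rightarrow> ('a, 'u) module, d, \<epsilon>).
            projective_resolution (opposite R) A P d \<epsilon>)
      in homology (\<lambda>n. tensor R (P n) B) (\<lambda>n. tensor_map R (P n) B (d n)) i)"

definition stably_flat ::
  "'u itself \<Rightarrow> ('a, 'k) ring_scheme \<Rightarrow> ('b, 'l) ring_scheme \<Rightarrow> ('a \<Rightarrow> 'b) \<Rightarrow> bool" where
  "stably_flat U R S \<phi> \<longleftrightarrow>
     (\<forall>i>0. trivial_group (Tor U R (restrict_scalars \<phi> (regular_module (opposite S)))
                                   (restrict_scalars \<phi> (regular_module S)) i))"

end

theory Submission
  imports Defs
begin

text \<open>Let \<open>P\<close> be the projective resolution of the right \<open>R\<close>-module \<open>S\<close> from which \<open>Tor\<close> is computed. Stable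
  flatness says that the complex of the \<open>P n \<otimes>\<^sub>R S\<close> is exact in positive degrees, and its homology in
  degree zero is \<open>S \<otimes>\<^sub>R S = S\<close>, because \<open>\<phi>\<close> is an epimorphism. So it is a projective resolution of the
  free right \<open>S\<close>-module \<open>S\<close> and therefore contractible over \<open>S\<close>. Tensoring the contraction over \<open>S\<close> with an
  arbitrary left \<open>S\<close>-module \<open>M\<close> shows that the \<open>P n \<otimes>\<^sub>R M\<close> are exact in positive degrees, that is,
  \<open>Tor\<^sub>i(S, M) = 0\<close> for \<open>i > 0\<close> (\<open>contraction_exists\<close>, \<open>acyclic_module\<close>).

  Now let \<open>Q\<close> be a projective resolution of \<open>M\<close> over \<open>R\<close>. As \<open>Tor\<close> may be computed from either argument,
  the \<open>S \<otimes>\<^sub>R Q n\<close> are exact in positive degrees too (\<open>base_change_exact\<close>, a double complex argument),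
  and they resolve \<open>S \<otimes>\<^sub>R M = M\<close> by projective left \<open>S\<close>-modules. This resolution is no longer than \<open>Q\<close>,
  so the projective dimension of \<open>M\<close> over \<open>S\<close> is at most that over \<open>R\<close>, which is the claim for left
  modules. For \<open>M = S\<close> the same exactness shows that the hypotheses are inherited by the opposite
  rings (\<open>opposite_stably_flat_epi\<close>), which gives the claim for right modules.

  Two points need care because projective modules, resolutions and test rings are confined to the
  universe \<open>'u\<close>. Free modules, tensor products and the square-zero extension that tests
  the epimorphism are built on other types, shown to inject into \<open>'u\<close>, and transported there. And
  projective modules must be lifted against modules outside the universe; this is done with
  a dual basis (\<open>projective_dual_basis\<close>), which also gives exactness of tensoring with a projective
  module (\<open>projective_tensor_exact\<close>).\<close>


section \<open>Modules and their homomorphisms\<close>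

lemma opposite_opposite [simp]: "opposite (opposite R) = R"
  by (simp add: opposite_def)

lemma carrier_opposite [simp]: "carrier (opposite R) = carrier R"
  and zero_opposite [simp]: "\<zero>\<^bsub>opposite R\<^esub> = \<zero>\<^bsub>R\<^esub>"
  and one_opposite [simp]: "\<one>\<^bsub>opposite R\<^esub> = \<one>\<^bsub>R\<^esub>"
  and add_opposite [simp]: "x \<oplus>\<^bsub>opposite R\<^esub> y = x \<oplus>\<^bsub>R\<^esub> y"
  and mult_opposite [simp]: "x \<otimes>\<^bsub>opposite R\<^esub> y = y \<otimes>\<^bsub>R\<^esub> x"
  by (simp_all add: opposite_def)

lemma carrier_regular_module [simp]: "carrier (regular_module R) = carrier R"
  and zero_regular_module [simp]: "\<zero>\<^bsub>regular_module R\<^esub> = \<zero>\<^bsub>R\<^esub>"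
  and add_regular_module [simp]: "x \<oplus>\<^bsub>regular_module R\<^esub> y = x \<oplus>\<^bsub>R\<^esub> y"
  and smult_regular_module [simp]: "r \<odot>\<^bsub>regular_module R\<^esub> y = r \<otimes>\<^bsub>R\<^esub> y"
  by (simp_all add: regular_module_def)

lemma carrier_restrict_scalars [simp]: "carrier (restrict_scalars \<phi> M) = carrier M"
  and zero_restrict_scalars [simp]: "\<zero>\<^bsub>restrict_scalars \<phi> M\<^esub> = \<zero>\<^bsub>M\<^esub>"
  and add_restrict_scalars [simp]: "x \<oplus>\<^bsub>restrict_scalars \<phi> M\<^esub> y = x \<oplus>\<^bsub>M\<^esub> y"
  and smult_restrict_scalars [simp]: "r \<odot>\<^bsub>restrict_scalars \<phi> M\<^esub> x = \<phi> r \<odot>\<^bsub>M\<^esub> x"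
  by (simp_all add: restrict_scalars_def)

lemma lin_homI:
  assumes "\<And>x. x \<in> carrier M \<Longrightarrow> f x \<in> carrier N"
    and "\<And>x y. x \<in> carrier M \<Longrightarrow> y \<in> carrier M \<Longrightarrow> f (x \<oplus>\<^bsub>M\<^esub> y) = f x \<oplus>\<^bsub>N\<^esub> f y"
    and "\<And>r x. r \<in> carrier R \<Longrightarrow> x \<in> carrier M \<Longrightarrow> f (r \<odot>\<^bsub>M\<^esub> x) = r \<odot>\<^bsub>N\<^esub> f x"
  shows "f \<in> left_module_hom R M N"
  using assms by (auto simp: left_module_hom_def)

lemma lin_homD:
  assumes "f \<in> left_module_hom R M N"
  shows "\<And>x. x \<in> carrier M \<Longrightarrow> f x \<in> carrier N"
    and "\<And>x y. x \<in> carrier M \<Longrightarrow> y \<in> carrier M \<Longrightarrow> f (x \<oplus>\<^bsub>M\<^esub> y) = f x \<oplus>\<^bsub>N\<^esub> f y"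
    and "\<And>r x. r \<in> carrier R \<Longrightarrow> x \<in> carrier M \<Longrightarrow> f (r \<odot>\<^bsub>M\<^esub> x) = r \<odot>\<^bsub>N\<^esub> f x"
  using assms by (auto simp: left_module_hom_def)

lemma lin_hom_comp:
  assumes "f \<in> left_module_hom R M N" "g \<in> left_module_hom R N L"
  shows "(\<lambda>x. g (f x)) \<in> left_module_hom R M L"
  using assms by (auto simp: left_module_hom_def Pi_iff)

lemma lin_hom_add_monoid:
  "f \<in> left_module_hom R M N \<Longrightarrow> f \<in> hom (add_monoid M) (add_monoid N)"
  by (auto simp: left_module_hom_def hom_def)

lemma left_module_comm_group: "left_module R M \<Longrightarrow> comm_group (add_monoid M)"
  by (simp add: abelian_group.a_comm_group left_module.axioms(2))

lemma comm_group_hom_one: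
  assumes "comm_group G" "comm_group H" "h \<in> hom G H"
  shows "h \<one>\<^bsub>G\<^esub> = \<one>\<^bsub>H\<^esub>"
  using assms by (simp add: comm_group.axioms(2) hom_one)

lemma comm_group_hom_inv:
  assumes "comm_group G" "comm_group H" "h \<in> hom G H" "x \<in> carrier G"
  shows "h (inv\<^bsub>G\<^esub> x) = inv\<^bsub>H\<^esub> (h x)"
  using assms by (simp add: comm_group.axioms(2) group_hom.hom_inv group_hom.intro group_hom_axioms.intro)

lemma lin_hom_zero:
  assumes "left_module R M" "left_module R N" "f \<in> left_module_hom R M N"
  shows "f \<zero>\<^bsub>M\<^esub> = \<zero>\<^bsub>N\<^esub>"
  using comm_group_hom_one[OF left_module_comm_group left_module_comm_group lin_hom_add_monoid, OF assms]
  by simp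

lemma hom_finprod_comm_group:
  assumes "comm_group G" "comm_group H" "h \<in> hom G H" "f \<in> Y \<rightarrow> carrier G"
  shows "h (finprod G f Y) = finprod H (\<lambda>y. h (f y)) Y"
  using assms(4)
proof (induction Y rule: infinite_finite_induct)
  case (insert y Y)
  interpret G: comm_group G by fact
  interpret H: comm_group H by fact
  have "f \<in> Y \<rightarrow> carrier G" "f y \<in> carrier G" "(\<lambda>y. h (f y)) \<in> Y \<rightarrow> carrier H" "h (f y) \<in> carrier H"
    using insert.prems assms(3) by (auto simp: hom_def)
  with insert assms(3) show ?case by (simp add: hom_mult)
qed (simp_all add: comm_group_hom_one[OF assms(1-3)] comm_monoid.finprod_infinite
    comm_monoid.finprod_empty comm_group.axioms(1)[OF assms(1)] comm_group.axioms(1)[OF assms(2)])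

lemma lin_hom_finsum:
  assumes "left_module R M" "left_module R N" "h \<in> left_module_hom R M N" "f \<in> Y \<rightarrow> carrier M"
  shows "h (finsum M f Y) = finsum N (\<lambda>y. h (f y)) Y"
  using hom_finprod_comm_group[OF left_module_comm_group left_module_comm_group
    lin_hom_add_monoid, OF assms(1-3)] assms(4)
  by (simp add: finsum_def)

lemma (in left_module) smult_l_null [simp]:
  assumes "x \<in> carrier M" shows "\<zero> \<odot>\<^bsub>M\<^esub> x = \<zero>\<^bsub>M\<^esub>"
proof -
  have "\<zero> \<odot>\<^bsub>M\<^esub> x \<oplus>\<^bsub>M\<^esub> \<zero> \<odot>\<^bsub>M\<^esub> x = \<zero> \<odot>\<^bsub>M\<^esub> x"
    using smult_l_distr[of \<zero> \<zero> x] assms by simp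
  then show ?thesis using assms by (metis M.add.l_cancel_one R.zero_closed smult_closed)
qed

lemma (in left_module) smult_lin_hom_self:
  assumes "a \<in> carrier R"
  shows "(\<lambda>x. a \<odot>\<^bsub>M\<^esub> x) \<in> hom (add_monoid M) (add_monoid M)"
  using assms by (auto simp: hom_def smult_r_distr)

lemma (in left_module) smult_r_null [simp]:
  assumes "a \<in> carrier R" shows "a \<odot>\<^bsub>M\<^esub> \<zero>\<^bsub>M\<^esub> = \<zero>\<^bsub>M\<^esub>"
  using comm_group_hom_one[OF M.a_comm_group M.a_comm_group smult_lin_hom_self[OF assms]]
  by simp

lemma (in left_module) smult_finsum:
  assumes "a \<in> carrier R" "f \<in> Y \<rightarrow> carrier M"
  shows "a \<odot>\<^bsub>M\<^esub> finsum M f Y = finsum M (\<lambda>y. a \<odot>\<^bsub>M\<^esub> f y) Y"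
  using hom_finprod_comm_group[OF M.a_comm_group M.a_comm_group smult_lin_hom_self[OF assms(1)]] assms(2)
  by (simp add: finsum_def)


lemma lin_hom_id: "(\<lambda>x. x) \<in> left_module_hom R M M"
  by (auto intro: lin_homI)

lemma hom_comp: "f \<in> hom G H \<Longrightarrow> g \<in> hom H K \<Longrightarrow> (\<lambda>x. g (f x)) \<in> hom G K"
  by (auto simp: hom_def Pi_iff)

lemma hom_ident: "(\<lambda>x. x) \<in> hom G G"
  by (auto simp: hom_def)

lemma lin_hom_diff:
  assumes "left_module R N" "f \<in> left_module_hom R M N" "g \<in> left_module_hom R M N"
  shows "(\<lambda>x. f x \<oplus>\<^bsub>N\<^esub> \<ominus>\<^bsub>N\<^esub> g x) \<in> left_module_hom R M N"
proof -
  interpret N: left_module R N by fact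
  have neg: "r \<odot>\<^bsub>N\<^esub> (\<ominus>\<^bsub>N\<^esub> x) = \<ominus>\<^bsub>N\<^esub> (r \<odot>\<^bsub>N\<^esub> x)" if "r \<in> carrier R" "x \<in> carrier N" for r x
    using comm_group_hom_inv[OF N.M.a_comm_group N.M.a_comm_group N.smult_lin_hom_self[OF that(1)], of x] that(2)
    by (simp add: a_inv_def)
  show ?thesis
    using lin_homD[OF assms(2)] lin_homD[OF assms(3)]
    by (intro lin_homI) (simp_all add: N.smult_r_distr neg N.M.minus_add N.M.a_ac)
qed

lemma hom_pointwise_mult:
  assumes "comm_group H" "f \<in> hom G H" "g \<in> hom G H"
  shows "(\<lambda>x. f x \<otimes>\<^bsub>H\<^esub> g x) \<in> hom G H"
proof -
  interpret H: comm_group H by fact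
  show ?thesis using assms(2,3) by (auto simp: hom_def Pi_iff H.m_ac)
qed


section \<open>Transport of structure into the universe\<close>

definition transport_module :: "('m \<Rightarrow> 'n) \<Rightarrow> ('a, 'm) module \<Rightarrow> ('a, 'n) module" where
  "transport_module f M = (let g = inv_into (carrier M) f in
     \<lparr>carrier = f ` carrier M, monoid.mult = undefined, one = undefined, ring.zero = f \<zero>\<^bsub>M\<^esub>,
      ring.add = (\<lambda>x y. f (g x \<oplus>\<^bsub>M\<^esub> g y)), smult = (\<lambda>r x. f (r \<odot>\<^bsub>M\<^esub> g x))\<rparr>)"

lemma transport_module_simps:
  assumes "inj_on f (carrier M)"
  shows "carrier (transport_module f M) = f ` carrier M"
    and "\<zero>\<^bsub>transport_module f M\<^esub> = f \<zero>\<^bsub>M\<^esub>"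
    and "\<lbrakk>x \<in> carrier M; y \<in> carrier M\<rbrakk> \<Longrightarrow> f x \<oplus>\<^bsub>transport_module f M\<^esub> f y = f (x \<oplus>\<^bsub>M\<^esub> y)"
    and "x \<in> carrier M \<Longrightarrow> r \<odot>\<^bsub>transport_module f M\<^esub> f x = f (r \<odot>\<^bsub>M\<^esub> x)"
  using assms by (simp_all add: transport_module_def Let_def)

lemma left_module_transport:
  assumes "left_module R M" "inj_on f (carrier M)"
  shows "left_module R (transport_module f M)"
proof -
  interpret M: left_module R M by fact
  note [simp] = transport_module_simps[OF assms(2)]
  have "\<exists>y\<in>carrier M. f (y \<oplus>\<^bsub>M\<^esub> x) = f \<zero>\<^bsub>M\<^esub>" if "x \<in> carrier M" for x
    using that by (intro bexI[where x = "\<ominus>\<^bsub>M\<^esub> x"]) (auto simp: M.M.l_neg)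
  then have "abelian_group (transport_module f M)"
    by (intro abelian_groupI) (auto simp: M.M.a_assoc, metis M.M.a_comm)
  then show ?thesis
    by (intro left_module.intro left_module_axioms.intro M.R.ring_axioms)
      (auto simp: M.smult_l_distr M.smult_r_distr M.smult_assoc)
qed

lemma transport_module_hom:
  assumes "inj_on f (carrier M)"
  shows "f \<in> left_module_hom R M (transport_module f M)"
  using transport_module_simps[OF assms] by (auto intro!: lin_homI)

lemma inv_transport_module_hom:
  assumes "left_module R M" "inj_on f (carrier M)"
  shows "inv_into (carrier M) f \<in> left_module_hom R (transport_module f M) M"
proof -
  interpret M: left_module R M by fact
  show ?thesis using transport_module_simps[OF assms(2)] assms(2) by (auto intro!: lin_homI)
qed

text \<open>How free modules and extensions of scalars, whose carriers live in other types, become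
  projective modules in the universe.\<close>

lemma projective_transport:
  fixes P :: "('a, 'x) module" and f :: "'x \<Rightarrow> 'u"
  assumes P: "left_module R P" and f: "inj_on f (carrier P)"
    and lift: "\<And>(M :: ('a, 'u) module) (N :: ('a, 'u) module) g k.
      \<lbrakk>left_module R M; left_module R N; g \<in> left_module_hom R M N; k \<in> left_module_hom R P N;
       g ` carrier M = carrier N\<rbrakk> \<Longrightarrow> \<exists>h\<in>left_module_hom R P M. \<forall>x\<in>carrier P. g (h x) = k x"
  shows "projective R (transport_module f P)"
  unfolding projective_def
proof (intro conjI allI impI ballI)
  show "left_module R (transport_module f P)" using P f by (rule left_module_transport)
next
  fix M N :: "('a, 'u) module" and g k
  assume *: "left_module R M" "left_module R N" "g \<in> left_module_hom R M N"
    "k \<in> left_module_hom R (transport_module f P) N" "g ` carrier M = carrier N"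
  obtain h where h: "h \<in> left_module_hom R P M" "\<And>x. x \<in> carrier P \<Longrightarrow> g (h x) = k (f x)"
    using lift[OF *(1-3) lin_hom_comp[OF transport_module_hom[OF f] *(4)] *(5)] by blast
  show "\<exists>h\<in>left_module_hom R (transport_module f P) M.
      \<forall>x\<in>carrier (transport_module f P). g (h x) = k x"
    using lin_hom_comp[OF inv_transport_module_hom[OF P f] h(1)] h(2) f
    by (intro bexI[where x = "\<lambda>x. h (inv_into (carrier P) f x)"])
      (auto simp: transport_module_simps)
qed


lemma lepoll_ex_inj:
  assumes "A \<lesssim> (UNIV :: 'u set)" obtains f :: "'x \<Rightarrow> 'u" where "inj_on f (A :: 'x set)"
  using assms by (auto simp: lepoll_def)

lemma lepoll_times_UNIV:
  assumes "infinite (UNIV :: 'u set)" "A \<lesssim> (UNIV :: 'u set)" "B \<lesssim> (UNIV :: 'u set)"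
  shows "A \<times> B \<lesssim> (UNIV :: 'u set)"
proof -
  have "A \<times> B \<lesssim> (UNIV :: 'u set) \<times> (UNIV :: 'u set)"
    using assms by (intro times_lepoll_mono)
  also have "\<dots> \<approx> (UNIV :: 'u set)"
    unfolding eqpoll_iff_card_of_ordIso by (rule card_of_Times_same_infinite[OF assms(1)])
  finally show ?thesis .
qed

lemma Fpow_lepoll_UNIV:
  assumes "infinite (UNIV :: 'u set)" "A \<lesssim> (UNIV :: 'u set)"
  shows "Fpow A \<lesssim> (UNIV :: 'u set)"
proof -
  obtain f :: "_ \<Rightarrow> 'u" where f: "inj_on f A" using assms(2) by (rule lepoll_ex_inj)
  have "Fpow A \<lesssim> Fpow (UNIV :: 'u set)"
    using inj_on_image_Fpow[OF f] unfolding lepoll_def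
    by (intro exI[where x = "image f"]) (auto simp: Fpow_def)
  also have "\<dots> \<approx> (UNIV :: 'u set)" using assms(1) by (rule eqpoll_Fpow)
  finally show ?thesis .
qed


section \<open>Free modules and dual bases\<close>

definition free_module :: "('a, 'k) ring_scheme \<Rightarrow> 'x set \<Rightarrow> ('a, 'x \<Rightarrow> 'a) module" where
  "free_module R X =
     \<lparr>carrier = {c. range c \<subseteq> carrier R \<and> {x. c x \<noteq> \<zero>\<^bsub>R\<^esub>} \<subseteq> X \<and> finite {x. c x \<noteq> \<zero>\<^bsub>R\<^esub>}},
      monoid.mult = undefined, one = undefined, ring.zero = (\<lambda>_. \<zero>\<^bsub>R\<^esub>),
      ring.add = (\<lambda>c e x. c x \<oplus>\<^bsub>R\<^esub> e x), smult = (\<lambda>r c x. r \<otimes>\<^bsub>R\<^esub> c x)\<rparr>"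

definition basis_vector :: "('a, 'k) ring_scheme \<Rightarrow> 'x \<Rightarrow> 'x \<Rightarrow> 'a" where
  "basis_vector R x = (\<lambda>y. if y = x then \<one>\<^bsub>R\<^esub> else \<zero>\<^bsub>R\<^esub>)"

text \<open>The value at \<open>c\<close> of the homomorphism from the free module that sends each
  basis vector \<open>x\<close> to \<open>u x\<close>.\<close>

definition lin_comb ::
  "('a, 'k) ring_scheme \<Rightarrow> ('a, 'm) module \<Rightarrow> ('x \<Rightarrow> 'm) \<Rightarrow> ('x \<Rightarrow> 'a) \<Rightarrow> 'm" where
  "lin_comb R M u c = (\<Oplus>\<^bsub>M\<^esub>x\<in>{x. c x \<noteq> \<zero>\<^bsub>R\<^esub>}. c x \<odot>\<^bsub>M\<^esub> u x)"

lemma free_module_simps [simp]: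
  "\<zero>\<^bsub>free_module R X\<^esub> = (\<lambda>_. \<zero>\<^bsub>R\<^esub>)"
  "c \<oplus>\<^bsub>free_module R X\<^esub> e = (\<lambda>x. c x \<oplus>\<^bsub>R\<^esub> e x)"
  "r \<odot>\<^bsub>free_module R X\<^esub> c = (\<lambda>x. r \<otimes>\<^bsub>R\<^esub> c x)"
  by (simp_all add: free_module_def)

lemma free_module_carrier:
  "c \<in> carrier (free_module R X) \<longleftrightarrow>
     range c \<subseteq> carrier R \<and> {x. c x \<noteq> \<zero>\<^bsub>R\<^esub>} \<subseteq> X \<and> finite {x. c x \<noteq> \<zero>\<^bsub>R\<^esub>}"
  by (simp add: free_module_def)

lemma left_module_free:
  fixes R (structure)
  assumes "ring R" shows "left_module R (free_module R X)"
proof -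
  interpret ring R by fact
  let ?F = "free_module R X"
  have mem: "c x \<in> carrier R" if "c \<in> carrier ?F" for c x
    using that by (auto simp: free_module_carrier)
  have memI: "e \<in> carrier ?F"
    if "\<And>x. e x \<in> carrier R" "{x. e x \<noteq> \<zero>} \<subseteq> Y" "finite Y" "Y \<subseteq> X" for e Y
    using that finite_subset[OF that(2,3)] by (auto simp: free_module_carrier)
  have supp: "finite {x. c x \<noteq> \<zero>}" "{x. c x \<noteq> \<zero>} \<subseteq> X" if "c \<in> carrier ?F" for c
    using that by (simp_all add: free_module_carrier)
  have closed: "(\<lambda>x. c x \<oplus> e x) \<in> carrier ?F" if "c \<in> carrier ?F" "e \<in> carrier ?F" for c e
    using that[THEN mem] that[THEN supp(1)] that[THEN supp(2)]
    by (intro memI[where Y = "{x. c x \<noteq> \<zero>} \<union> {x. e x \<noteq> \<zero>}"]) auto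
  have smult: "(\<lambda>x. r \<otimes> c x) \<in> carrier ?F" if "r \<in> carrier R" "c \<in> carrier ?F" for r c
    using that(1) mem[OF that(2)] supp[OF that(2)]
    by (intro memI[where Y = "{x. c x \<noteq> \<zero>}"]) auto
  have "abelian_group ?F"
  proof (rule abelian_groupI)
    fix c assume c: "c \<in> carrier ?F"
    have "(\<lambda>x. \<ominus> c x) \<in> carrier ?F"
      using mem[OF c] supp[OF c] by (intro memI[where Y = "{x. c x \<noteq> \<zero>}"]) auto
    then show "\<exists>e\<in>carrier ?F. e \<oplus>\<^bsub>?F\<^esub> c = \<zero>\<^bsub>?F\<^esub>"
      using mem[OF c] by (intro bexI[where x = "\<lambda>x. \<ominus> c x"]) (auto simp: l_neg)
  next
    show "\<zero>\<^bsub>?F\<^esub> \<in> carrier ?F" by (auto simp: free_module_carrier)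
  qed (auto simp: closed mem a_ac)
  then show ?thesis
    by (intro left_module.intro left_module_axioms.intro assms)
      (auto simp: smult mem l_distr r_distr m_assoc)
qed

lemma basis_vector_closed:
  assumes "ring R" "x \<in> X" shows "basis_vector R x \<in> carrier (free_module R X)"
proof -
  interpret ring R by fact
  show ?thesis using assms(2) by (auto simp: basis_vector_def free_module_carrier)
qed

lemma lin_comb_superset:
  assumes "left_module R M" "c \<in> carrier (free_module R X)" "u \<in> X \<rightarrow> carrier M"
    and "finite Y" "{x. c x \<noteq> \<zero>\<^bsub>R\<^esub>} \<subseteq> Y" "Y \<subseteq> X"
  shows "lin_comb R M u c = (\<Oplus>\<^bsub>M\<^esub>x\<in>Y. c x \<odot>\<^bsub>M\<^esub> u x)"
proof -
  interpret M: left_module R M by fact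
  have "c x \<in> carrier R" for x using assms(2) by (auto simp: free_module_carrier)
  then show ?thesis unfolding lin_comb_def
    using assms by (intro M.M.add.finprod_mono_neutral_cong_left) (auto simp: Pi_iff subset_iff)
qed

lemma lin_comb_hom:
  assumes "left_module R M" "u \<in> X \<rightarrow> carrier M"
  shows "lin_comb R M u \<in> left_module_hom R (free_module R X) M"
proof -
  interpret M: left_module R M by fact
  let ?F = "free_module R X"
  interpret F: left_module R ?F by (rule left_module_free[OF M.R.ring_axioms])
  have mem: "c x \<in> carrier R" if "c \<in> carrier ?F" for c x
    using that by (auto simp: free_module_carrier)
  show ?thesis
  proof (rule lin_homI)
    fix c assume c: "c \<in> carrier ?F"
    then show "lin_comb R M u c \<in> carrier M"
      unfolding lin_comb_def using assms(2) mem[OF c]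
      by (intro M.M.finsum_closed) (auto simp: free_module_carrier Pi_iff)
  next
    fix c e assume ce: "c \<in> carrier ?F" "e \<in> carrier ?F"
    let ?Y = "{x. c x \<noteq> \<zero>\<^bsub>R\<^esub>} \<union> {x. e x \<noteq> \<zero>\<^bsub>R\<^esub>}"
    have Y: "finite ?Y" "?Y \<subseteq> X" "{x. c x \<oplus>\<^bsub>R\<^esub> e x \<noteq> \<zero>\<^bsub>R\<^esub>} \<subseteq> ?Y"
      using ce by (auto simp: free_module_carrier)
    have "c \<oplus>\<^bsub>?F\<^esub> e \<in> carrier ?F" using ce by blast
    then have "lin_comb R M u (c \<oplus>\<^bsub>?F\<^esub> e) = (\<Oplus>\<^bsub>M\<^esub>x\<in>?Y. (c \<oplus>\<^bsub>?F\<^esub> e) x \<odot>\<^bsub>M\<^esub> u x)"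
      using Y by (intro lin_comb_superset[OF assms(1) _ assms(2)]) auto
    also have "\<dots> = (\<Oplus>\<^bsub>M\<^esub>x\<in>?Y. c x \<odot>\<^bsub>M\<^esub> u x \<oplus>\<^bsub>M\<^esub> e x \<odot>\<^bsub>M\<^esub> u x)"
      using Y assms(2) mem[OF ce(1)] mem[OF ce(2)]
      by (intro M.M.finsum_cong') (auto simp: M.smult_l_distr Pi_iff subset_iff)
    also have "\<dots> = (\<Oplus>\<^bsub>M\<^esub>x\<in>?Y. c x \<odot>\<^bsub>M\<^esub> u x) \<oplus>\<^bsub>M\<^esub> (\<Oplus>\<^bsub>M\<^esub>x\<in>?Y. e x \<odot>\<^bsub>M\<^esub> u x)"
      using Y assms(2) mem[OF ce(1)] mem[OF ce(2)]
      by (intro M.M.finsum_addf) (auto simp: Pi_iff subset_iff)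
    also have "(\<Oplus>\<^bsub>M\<^esub>x\<in>?Y. c x \<odot>\<^bsub>M\<^esub> u x) = lin_comb R M u c"
      using Y by (intro lin_comb_superset[OF assms(1) ce(1) assms(2), symmetric]) auto
    also have "(\<Oplus>\<^bsub>M\<^esub>x\<in>?Y. e x \<odot>\<^bsub>M\<^esub> u x) = lin_comb R M u e"
      using Y by (intro lin_comb_superset[OF assms(1) ce(2) assms(2), symmetric]) auto
    finally show "lin_comb R M u (c \<oplus>\<^bsub>?F\<^esub> e) = lin_comb R M u c \<oplus>\<^bsub>M\<^esub> lin_comb R M u e" .
  next
    fix r c assume rc: "r \<in> carrier R" "c \<in> carrier ?F"
    let ?Y = "{x. c x \<noteq> \<zero>\<^bsub>R\<^esub>}"
    have Y: "finite ?Y" "?Y \<subseteq> X" "{x. r \<otimes>\<^bsub>R\<^esub> c x \<noteq> \<zero>\<^bsub>R\<^esub>} \<subseteq> ?Y"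
      using rc by (auto simp: free_module_carrier)
    have "r \<odot>\<^bsub>?F\<^esub> c \<in> carrier ?F" using rc by blast
    then have "lin_comb R M u (r \<odot>\<^bsub>?F\<^esub> c) = (\<Oplus>\<^bsub>M\<^esub>x\<in>?Y. (r \<odot>\<^bsub>?F\<^esub> c) x \<odot>\<^bsub>M\<^esub> u x)"
      using Y by (intro lin_comb_superset[OF assms(1) _ assms(2)]) auto
    also have "\<dots> = (\<Oplus>\<^bsub>M\<^esub>x\<in>?Y. r \<odot>\<^bsub>M\<^esub> (c x \<odot>\<^bsub>M\<^esub> u x))"
      using Y assms(2) mem[OF rc(2)] rc(1)
      by (intro M.M.finsum_cong') (auto simp: M.smult_assoc Pi_iff subset_iff)
    also have "\<dots> = r \<odot>\<^bsub>M\<^esub> lin_comb R M u c"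
      unfolding lin_comb_def using Y assms(2) mem[OF rc(2)] rc(1)
      by (intro M.smult_finsum[symmetric]) (auto simp: Pi_iff subset_iff)
    finally show "lin_comb R M u (r \<odot>\<^bsub>?F\<^esub> c) = r \<odot>\<^bsub>M\<^esub> lin_comb R M u c" .
  qed
qed

lemma lin_comb_basis_vector:
  assumes "left_module R M" "u \<in> X \<rightarrow> carrier M" "x \<in> X"
  shows "lin_comb R M u (basis_vector R x) = u x"
proof -
  interpret M: left_module R M by fact
  have ux: "u x \<in> carrier M" using assms by auto
  have "lin_comb R M u (basis_vector R x) = (\<Oplus>\<^bsub>M\<^esub>y\<in>{x}. basis_vector R x y \<odot>\<^bsub>M\<^esub> u y)"
    using assms by (intro lin_comb_superset[OF assms(1) basis_vector_closed assms(2)])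
      (auto simp: basis_vector_def M.R.ring_axioms)
  also have "\<dots> = basis_vector R x x \<odot>\<^bsub>M\<^esub> u x \<oplus>\<^bsub>M\<^esub> (\<Oplus>\<^bsub>M\<^esub>y\<in>{}. basis_vector R x y \<odot>\<^bsub>M\<^esub> u y)"
    using ux by (intro M.M.finsum_insert) (simp_all add: basis_vector_def)
  also have "\<dots> = u x" using ux by (simp add: basis_vector_def M.M.finsum_empty)
  finally show ?thesis .
qed

lemma hom_lin_comb:
  assumes "left_module R M" "left_module R N" "g \<in> left_module_hom R M N"
    and "u \<in> X \<rightarrow> carrier M" "c \<in> carrier (free_module R X)"
  shows "g (lin_comb R M u c) = lin_comb R N (\<lambda>x. g (u x)) c"
proof -
  interpret M: left_module R M by fact
  interpret N: left_module R N by fact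
  have mem: "c x \<in> carrier R" for x using assms(5) by (auto simp: free_module_carrier)
  have *: "u x \<in> carrier M" if "c x \<noteq> \<zero>\<^bsub>R\<^esub>" for x using that assms(4,5) by (auto simp: free_module_carrier)
  have "g (lin_comb R M u c) = (\<Oplus>\<^bsub>N\<^esub>x\<in>{x. c x \<noteq> \<zero>\<^bsub>R\<^esub>}. g (c x \<odot>\<^bsub>M\<^esub> u x))"
    unfolding lin_comb_def using mem * by (intro lin_hom_finsum[OF assms(1-3)]) auto
  also have "\<dots> = lin_comb R N (\<lambda>x. g (u x)) c"
    unfolding lin_comb_def using mem * lin_homD[OF assms(3)]
    by (intro N.M.finsum_cong') auto
  finally show ?thesis .
qed

lemma lin_comb_basis_vectors:
  assumes "ring R" "c \<in> carrier (free_module R X)"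
  shows "lin_comb R (free_module R X) (basis_vector R) c = c"
proof -
  let ?F = "free_module R X"
  interpret F: left_module R ?F by (rule left_module_free[OF assms(1)])
  have mem: "c x \<in> carrier R" for x using assms(2) by (auto simp: free_module_carrier)
  have "(\<Oplus>\<^bsub>?F\<^esub>x\<in>Y. c x \<odot>\<^bsub>?F\<^esub> basis_vector R x) = (\<lambda>y. if y \<in> Y then c y else \<zero>\<^bsub>R\<^esub>)"
    if "finite Y" "Y \<subseteq> X" for Y
    using that
  proof (induction Y)
    case (insert y Y)
    have *: "c x \<odot>\<^bsub>?F\<^esub> basis_vector R x \<in> carrier ?F" if "x \<in> insert y Y" for x
      using that insert.prems mem basis_vector_closed[OF assms(1), of x X]
      by (intro F.smult_closed) auto
    have "(\<Oplus>\<^bsub>?F\<^esub>x\<in>insert y Y. c x \<odot>\<^bsub>?F\<^esub> basis_vector R x) =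
      c y \<odot>\<^bsub>?F\<^esub> basis_vector R y \<oplus>\<^bsub>?F\<^esub> (\<Oplus>\<^bsub>?F\<^esub>x\<in>Y. c x \<odot>\<^bsub>?F\<^esub> basis_vector R x)"
      using insert.hyps * by (intro F.M.finsum_insert) auto
    also have "\<dots> = (\<lambda>z. if z \<in> insert y Y then c z else \<zero>\<^bsub>R\<^esub>)"
      using insert mem by (auto simp: basis_vector_def fun_eq_iff)
    finally show ?case .
  qed (simp add: F.M.finsum_empty)
  then show ?thesis
    unfolding lin_comb_def using assms(2) by (auto simp: free_module_carrier)
qed

lemma hom_free_module:
  assumes "ring R" "left_module R N" "k \<in> left_module_hom R (free_module R X) N"
    and "c \<in> carrier (free_module R X)"
  shows "k c = lin_comb R N (\<lambda>x. k (basis_vector R x)) c"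
proof -
  have "basis_vector R \<in> X \<rightarrow> carrier (free_module R X)"
    by (simp add: Pi_iff basis_vector_closed[OF assms(1)])
  from hom_lin_comb[OF left_module_free[OF assms(1)] assms(2,3) this assms(4)]
  show ?thesis by (simp only: lin_comb_basis_vectors[OF assms(1,4)])
qed

lemma free_module_lepoll:
  assumes "infinite (UNIV :: 'u set)" "carrier R \<lesssim> (UNIV :: 'u set)" "X \<lesssim> (UNIV :: 'u set)"
  shows "carrier (free_module R X) \<lesssim> (UNIV :: 'u set)"
proof -
  have "carrier (free_module R X) \<subseteq>
    {c. c ` X \<subseteq> carrier R \<and> {x. c x \<noteq> \<zero>\<^bsub>R\<^esub>} \<subseteq> X \<and> finite {x. c x \<noteq> \<zero>\<^bsub>R\<^esub>}}"
    by (auto simp: free_module_carrier image_subset_iff)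
  then have "carrier (free_module R X) \<lesssim>
    {c. c ` X \<subseteq> carrier R \<and> {x. c x \<noteq> \<zero>\<^bsub>R\<^esub>} \<subseteq> X \<and> finite {x. c x \<noteq> \<zero>\<^bsub>R\<^esub>}}"
    by (rule subset_imp_lepoll)
  also have "\<dots> \<lesssim> Fpow (X \<times> carrier R)" by (rule lepoll_restricted_funspace)
  also have "\<dots> \<lesssim> (UNIV :: 'u set)"
    using assms by (intro Fpow_lepoll_UNIV lepoll_times_UNIV)
  finally show ?thesis .
qed

text \<open>The cover is the free module on the set of all elements of \<open>M\<close>, moved into the
  universe. Its explicit form is recorded because the coordinates in this free module give
  the dual basis below.\<close>

lemma projective_cover:
  fixes R :: "('a, 'k) ring_scheme" and M :: "('a, 'u) module"
  assumes "infinite (UNIV :: 'u set)" "carrier R \<lesssim> (UNIV :: 'u set)" "left_module R M"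
  obtains f :: "('u \<Rightarrow> 'a) \<Rightarrow> 'u" and F and \<pi> where
    "inj_on f (carrier (free_module R (carrier M)))"
    and "F = transport_module f (free_module R (carrier M))"
    and "\<pi> = (\<lambda>x. lin_comb R M (\<lambda>y. y) (inv_into (carrier (free_module R (carrier M))) f x))"
    and "projective R F" "\<pi> \<in> left_module_hom R F M" "\<pi> ` carrier F = carrier M"
proof -
  interpret M: left_module R M by fact
  let ?F = "free_module R (carrier M)"
  have "carrier ?F \<lesssim> (UNIV :: 'u set)"
    using assms by (intro free_module_lepoll) (auto intro: subset_imp_lepoll)
  then obtain f :: "('u \<Rightarrow> 'a) \<Rightarrow> 'u" where f: "inj_on f (carrier ?F)" by (rule lepoll_ex_inj)
  have "projective R (transport_module f ?F)"
  proof (rule projective_transport[OF left_module_free f])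
    show "ring R" by (rule M.R.ring_axioms)
  next
    fix L N :: "('a, 'u) module" and g k
    assume L: "left_module R L" and N: "left_module R N" and g: "g \<in> left_module_hom R L N"
      and k: "k \<in> left_module_hom R ?F N" and surj: "g ` carrier L = carrier N"
    have "\<exists>m\<in>carrier L. g m = k (basis_vector R x)" if "x \<in> carrier M" for x
      using that surj lin_homD(1)[OF k basis_vector_closed[OF M.R.ring_axioms that]] by (metis imageE)
    then obtain u where u: "\<And>x. x \<in> carrier M \<Longrightarrow> u x \<in> carrier L \<and> g (u x) = k (basis_vector R x)"
      by metis
    have "g (lin_comb R L u c) = k c" if c: "c \<in> carrier ?F" for c
    proof -
      interpret N: left_module R N by fact
      have mem: "c x \<in> carrier R" for x using c by (auto simp: free_module_carrier)
      have "g (lin_comb R L u c) = lin_comb R N (\<lambda>x. g (u x)) c"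
        using u by (intro hom_lin_comb[OF L N g _ c]) auto
      also have "\<dots> = lin_comb R N (\<lambda>x. k (basis_vector R x)) c"
        unfolding lin_comb_def using c u mem lin_homD(1)[OF k basis_vector_closed[OF M.R.ring_axioms]]
        by (intro N.M.finsum_cong') (auto simp: free_module_carrier subset_iff)
      finally show ?thesis using hom_free_module[OF M.R.ring_axioms N k c] by simp
    qed
    moreover have "lin_comb R L u \<in> left_module_hom R ?F L"
      using u by (intro lin_comb_hom[OF L]) auto
    ultimately show "\<exists>h\<in>left_module_hom R ?F L. \<forall>x\<in>carrier ?F. g (h x) = k x" by blast
  qed
  moreover have inv: "inv_into (carrier ?F) f \<in> left_module_hom R (transport_module f ?F) ?F"
    by (rule inv_transport_module_hom[OF left_module_free[OF M.R.ring_axioms] f])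
  let ?\<pi> = "\<lambda>x. lin_comb R M (\<lambda>y. y) (inv_into (carrier ?F) f x)"
  have \<pi>: "?\<pi> \<in> left_module_hom R (transport_module f ?F) M"
    by (rule lin_hom_comp[OF inv lin_comb_hom[OF assms(3)]]) auto
  moreover have "?\<pi> ` carrier (transport_module f ?F) = carrier M"
  proof
    show "?\<pi> ` carrier (transport_module f ?F) \<subseteq> carrier M" using lin_homD(1)[OF \<pi>] by auto
    show "carrier M \<subseteq> ?\<pi> ` carrier (transport_module f ?F)"
    proof
      fix x assume x: "x \<in> carrier M"
      have "?\<pi> (f (basis_vector R x)) = x"
        using f basis_vector_closed[OF M.R.ring_axioms x] lin_comb_basis_vector[OF assms(3) _ x, of "\<lambda>y. y"] by auto
      with basis_vector_closed[OF M.R.ring_axioms x] show "x \<in> ?\<pi> ` carrier (transport_module f ?F)"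
        unfolding transport_module_simps(1)[OF f] by force
    qed
  qed
  ultimately show ?thesis using that f by blast
qed

text \<open>A projective module splits off its free cover. The coordinates \<open>c x y\<close> of the splitting
  form a dual basis: the sum of the \<open>c x y \<odot> y\<close> over \<open>y\<close> is \<open>x\<close>. The definition of
  projectivity tests against modules in the universe only, whereas a dual basis makes no reference
  to test modules; it therefore gives lifting against modules with carriers in any type, and
  exactness of tensor products.\<close>

lemma projective_dual_basis:
  fixes R :: "('a, 'k) ring_scheme" and P :: "('a, 'u) module"
  assumes "infinite (UNIV :: 'u set)" "carrier R \<lesssim> (UNIV :: 'u set)" "projective R P"
  obtains c where "c \<in> left_module_hom R P (free_module R (carrier P))"
    and "\<And>x. x \<in> carrier P \<Longrightarrow> lin_comb R P (\<lambda>y. y) (c x) = x"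
proof -
  have P: "left_module R P" using assms(3) by (simp add: projective_def)
  interpret P: left_module R P by fact
  let ?F = "free_module R (carrier P)"
  obtain f :: "('u \<Rightarrow> 'a) \<Rightarrow> 'u" and F and \<pi> where f: "inj_on f (carrier ?F)"
    and F: "F = transport_module f ?F" and \<pi>_eq: "\<pi> = (\<lambda>x. lin_comb R P (\<lambda>y. y) (inv_into (carrier ?F) f x))"
    and "projective R F" and \<pi>: "\<pi> \<in> left_module_hom R F P" "\<pi> ` carrier F = carrier P"
    using projective_cover[OF assms(1,2) P] .
  have inv: "inv_into (carrier ?F) f \<in> left_module_hom R F ?F"
    unfolding F by (rule inv_transport_module_hom[OF left_module_free[OF P.R.ring_axioms] f])
  note \<pi>(2)
  moreover have "(\<lambda>x. x) \<in> left_module_hom R P P" by (auto intro!: lin_homI)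
  moreover have "left_module R F" using \<open>projective R F\<close> by (simp add: projective_def)
  ultimately obtain h where h: "h \<in> left_module_hom R P F" "\<And>x. x \<in> carrier P \<Longrightarrow> \<pi> (h x) = x"
    using assms(3) P \<pi> unfolding projective_def by meson
  show ?thesis
    using that[OF lin_hom_comp[OF h(1) inv]] h(2) by (simp add: \<pi>_eq)
qed

text \<open>The modules to lift against include tensor products, which do not live in the universe.
  The lift sends \<open>x\<close> to the combination, with the dual basis coefficients of \<open>x\<close>, of chosen
  preimages of the elements \<open>k y\<close>.\<close>

lemma projective_lift:
  fixes R :: "('a, 'k) ring_scheme" and P :: "('a, 'u) module"
    and M :: "('a, 'm) module" and N :: "('a, 'n) module"
  assumes "infinite (UNIV :: 'u set)" "carrier R \<lesssim> (UNIV :: 'u set)" "projective R P"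
    and M: "left_module R M" and N: "left_module R N"
    and g: "g \<in> left_module_hom R M N" and k: "k \<in> left_module_hom R P N"
    and sub: "k ` carrier P \<subseteq> g ` carrier M"
  obtains h where "h \<in> left_module_hom R P M" "\<And>x. x \<in> carrier P \<Longrightarrow> g (h x) = k x"
proof -
  have P: "left_module R P" using assms(3) by (simp add: projective_def)
  obtain c where c: "c \<in> left_module_hom R P (free_module R (carrier P))"
    "\<And>x. x \<in> carrier P \<Longrightarrow> lin_comb R P (\<lambda>y. y) (c x) = x"
    using projective_dual_basis[OF assms(1-3)] by blast
  have "\<exists>m\<in>carrier M. g m = k y" if "y \<in> carrier P" for y
    using sub that by (metis image_subset_iff imageE)
  then obtain u where u: "\<And>x. x \<in> carrier P \<Longrightarrow> u x \<in> carrier M \<and> g (u x) = k x"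
    by metis
  have uM: "u \<in> carrier P \<rightarrow> carrier M" using u by auto
  have "g (lin_comb R M u (c x)) = k x" if x: "x \<in> carrier P" for x
  proof -
    interpret P: left_module R P by fact
    interpret N: left_module R N by fact
    have cx: "c x \<in> carrier (free_module R (carrier P))" using lin_homD(1)[OF c(1) x] .
    then have mem: "c x y \<in> carrier R" for y by (auto simp: free_module_carrier)
    have "g (lin_comb R M u (c x)) = lin_comb R N (\<lambda>x. g (u x)) (c x)"
      by (rule hom_lin_comb[OF M N g uM cx])
    also have "\<dots> = lin_comb R N k (c x)"
      unfolding lin_comb_def using cx u mem lin_homD(1)[OF k]
      by (intro N.M.finsum_cong') (auto simp: free_module_carrier subset_iff)
    also have "\<dots> = k (lin_comb R P (\<lambda>y. y) (c x))"
      using hom_lin_comb[OF P N k _ cx, of "\<lambda>y. y"] by simp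
    finally show ?thesis using c(2)[OF x] by simp
  qed
  with that[OF lin_hom_comp[OF c(1) lin_comb_hom[OF M uM]]] show ?thesis by blast
qed


section \<open>Tensor products\<close>

definition pure_tensor ::
  "('a, 'k) ring_scheme \<Rightarrow> ('a, 'p) module \<Rightarrow> ('a, 'q) module \<Rightarrow> 'p \<Rightarrow> 'q \<Rightarrow> ('p \<times> 'q \<Rightarrow>\<^sub>0 int) set"
  where "pure_tensor R A B x y =
    tensor_relations R A B #>\<^bsub>free_Abelian_group (carrier A \<times> carrier B)\<^esub> frag_of (x, y)"

definition balanced ::
  "('a, 'k) ring_scheme \<Rightarrow> ('a, 'p) module \<Rightarrow> ('a, 'q) module \<Rightarrow> ('g, 'l) monoid_scheme \<Rightarrow>
   ('p \<Rightarrow> 'q \<Rightarrow> 'g) \<Rightarrow> bool" where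
  "balanced R A B G \<beta> \<longleftrightarrow>
     (\<forall>x\<in>carrier A. \<forall>y\<in>carrier B. \<beta> x y \<in> carrier G) \<and>
     (\<forall>x\<in>carrier A. \<forall>x'\<in>carrier A. \<forall>y\<in>carrier B. \<beta> (x \<oplus>\<^bsub>A\<^esub> x') y = \<beta> x y \<otimes>\<^bsub>G\<^esub> \<beta> x' y) \<and>
     (\<forall>x\<in>carrier A. \<forall>y\<in>carrier B. \<forall>y'\<in>carrier B. \<beta> x (y \<oplus>\<^bsub>B\<^esub> y') = \<beta> x y \<otimes>\<^bsub>G\<^esub> \<beta> x y') \<and>
     (\<forall>r\<in>carrier R. \<forall>x\<in>carrier A. \<forall>y\<in>carrier B. \<beta> (r \<odot>\<^bsub>A\<^esub> x) y = \<beta> x (r \<odot>\<^bsub>B\<^esub> y))"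

lemma balancedI:
  assumes "\<And>x y. \<lbrakk>x \<in> carrier A; y \<in> carrier B\<rbrakk> \<Longrightarrow> \<beta> x y \<in> carrier G"
    and "\<And>x x' y. \<lbrakk>x \<in> carrier A; x' \<in> carrier A; y \<in> carrier B\<rbrakk> \<Longrightarrow>
      \<beta> (x \<oplus>\<^bsub>A\<^esub> x') y = \<beta> x y \<otimes>\<^bsub>G\<^esub> \<beta> x' y"
    and "\<And>x y y'. \<lbrakk>x \<in> carrier A; y \<in> carrier B; y' \<in> carrier B\<rbrakk> \<Longrightarrow>
      \<beta> x (y \<oplus>\<^bsub>B\<^esub> y') = \<beta> x y \<otimes>\<^bsub>G\<^esub> \<beta> x y'"
    and "\<And>r x y. \<lbrakk>r \<in> carrier R; x \<in> carrier A; y \<in> carrier B\<rbrakk> \<Longrightarrow>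
      \<beta> (r \<odot>\<^bsub>A\<^esub> x) y = \<beta> x (r \<odot>\<^bsub>B\<^esub> y)"
  shows "balanced R A B G \<beta>"
  using assms by (simp add: balanced_def)

definition tensor_lift ::
  "('a, 'k) ring_scheme \<Rightarrow> ('a, 'p) module \<Rightarrow> ('a, 'q) module \<Rightarrow> ('g, 'l) monoid_scheme \<Rightarrow>
   ('p \<Rightarrow> 'q \<Rightarrow> 'g) \<Rightarrow> ('p \<times> 'q \<Rightarrow>\<^sub>0 int) set \<Rightarrow> 'g" where
  "tensor_lift R A B G \<beta> = (SOME f. f \<in> hom (tensor R A B) G \<and>
     (\<forall>x\<in>carrier A. \<forall>y\<in>carrier B. f (pure_tensor R A B x y) = \<beta> x y))"

definition bimap ::
  "('a, 'k) ring_scheme \<Rightarrow> ('a, 'p) module \<Rightarrow> ('a, 'q) module \<Rightarrow>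
   ('a, 'p') module \<Rightarrow> ('a, 'q') module \<Rightarrow> ('p \<Rightarrow> 'p') \<Rightarrow> ('q \<Rightarrow> 'q') \<Rightarrow>
   ('p \<times> 'q \<Rightarrow>\<^sub>0 int) set \<Rightarrow> ('p' \<times> 'q' \<Rightarrow>\<^sub>0 int) set" where
  "bimap R A B A' B' f g =
     tensor_lift R A B (tensor R A' B') (\<lambda>x y. pure_tensor R A' B' (f x) (g y))"

locale tensor_pair =
  fixes R :: "('a, 'k) ring_scheme" and A :: "('a, 'p) module" and B :: "('a, 'q) module"
  assumes right: "left_module (opposite R) A" and left: "left_module R B"
begin

sublocale A: left_module "opposite R" A by (rule right)
sublocale B: left_module R B by (rule left)

abbreviation (input) "F \<equiv> free_Abelian_group (carrier A \<times> carrier B)"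
abbreviation (input) "T \<equiv> tensor R A B"
abbreviation (input) "rels \<equiv> tensor_relations R A B"
abbreviation tens (infixl "\<otimes>\<^sub>t" 75) where "x \<otimes>\<^sub>t y \<equiv> pure_tensor R A B x y"

lemma comm_group_F: "comm_group F"
  by (rule abelian_free_Abelian_group)

lemma relators_subset: "tensor_relators R A B \<subseteq> carrier F"
proof -
  have *: "Poly_Mapping.keys (frag_of a - frag_of b - frag_of c) \<subseteq> {a, b, c}"
    "Poly_Mapping.keys (frag_of a - frag_of b) \<subseteq> {a, b}" for a b c :: "'p \<times> 'q"
    using keys_diff[of "frag_of a - frag_of b" "frag_of c"] keys_diff[of "frag_of a" "frag_of b"]
    by auto
  show ?thesis
    unfolding tensor_relators_def by (auto dest!: *[THEN subsetD])
qed

lemma subgroup_rels: "subgroup rels F"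
  unfolding tensor_relations_def by (intro group.generate_is_subgroup relators_subset) simp

lemma normal_rels: "rels \<lhd> F"
  by (rule comm_group.subgroup_imp_normal[OF comm_group_F subgroup_rels])

lemma comm_group_T [simp, intro!]: "comm_group T"
  unfolding tensor_def by (rule comm_group.abelian_FactGroup[OF comm_group_F subgroup_rels])

sublocale T: comm_group T by (rule comm_group_T)

lemma one_T: "\<one>\<^bsub>T\<^esub> = rels" by (simp add: tensor_def)

abbreviation (input) "q c \<equiv> rels #>\<^bsub>F\<^esub> c"

lemma q_hom: "(\<lambda>c. q c) \<in> hom F T"
  unfolding tensor_def by (rule normal.r_coset_hom_Mod[OF normal_rels])

lemma q_surj: "t \<in> carrier T \<Longrightarrow> \<exists>c\<in>carrier F. t = q c"
  by (auto simp: tensor_def carrier_FactGroup)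

lemma q_one_iff: "c \<in> carrier F \<Longrightarrow> q c = \<one>\<^bsub>T\<^esub> \<longleftrightarrow> c \<in> rels"
  using group.coset_join1[OF group_free_Abelian_group _ _ subgroup_rels]
    group.coset_join2[OF group_free_Abelian_group _ subgroup_rels] by (auto simp: one_T)

lemma q_diff:
  assumes "a \<in> carrier F" "b \<in> carrier F"
  shows "q (a - b) = q a \<otimes>\<^bsub>T\<^esub> inv\<^bsub>T\<^esub> q b"
proof -
  have "q (a \<otimes>\<^bsub>F\<^esub> inv\<^bsub>F\<^esub> b) = q a \<otimes>\<^bsub>T\<^esub> inv\<^bsub>T\<^esub> q b"
    using assms hom_mult[OF q_hom, of a "inv\<^bsub>F\<^esub> b"]
      comm_group_hom_inv[OF comm_group_F comm_group_T q_hom assms(2)]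
      group.inv_closed[OF group_free_Abelian_group assms(2)] by simp
  with assms show ?thesis by simp
qed

lemma q_closed [simp]: "c \<in> carrier F \<Longrightarrow> q c \<in> carrier T"
  using q_hom by (simp add: hom_def Pi_iff)

lemma pure_tensor_closed [simp, intro]:
  "\<lbrakk>x \<in> carrier A; y \<in> carrier B\<rbrakk> \<Longrightarrow> x \<otimes>\<^sub>t y \<in> carrier T"
  unfolding pure_tensor_def by (rule q_closed) simp

lemma pure_tensor_rel3:
  assumes "frag_of a - frag_of b - frag_of c \<in> tensor_relators R A B"
    and "{a, b, c} \<subseteq> carrier A \<times> carrier B"
  shows "q (frag_of a) = q (frag_of b) \<otimes>\<^bsub>T\<^esub> q (frag_of c)"
proof -
  have mem: "frag_of x \<in> carrier F" if "x \<in> {a, b, c}" for x using assms(2) that by auto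
  have ab: "frag_of a - frag_of b \<in> carrier F"
    using mem keys_diff[of "frag_of a" "frag_of b"] by auto
  have rel: "frag_of a - frag_of b - frag_of c \<in> rels"
    unfolding tensor_relations_def using assms(1) by (rule generate.incl)
  then have "q (frag_of a - frag_of b - frag_of c) = \<one>\<^bsub>T\<^esub>"
    using q_one_iff relators_subset assms(1) by blast
  then have "q (frag_of a) \<otimes>\<^bsub>T\<^esub> inv\<^bsub>T\<^esub> q (frag_of b) \<otimes>\<^bsub>T\<^esub> inv\<^bsub>T\<^esub> q (frag_of c) = \<one>\<^bsub>T\<^esub>"
    using q_diff[OF ab mem, of c] q_diff[OF mem mem, of a b] by simp
  then have "q (frag_of a) \<otimes>\<^bsub>T\<^esub> inv\<^bsub>T\<^esub> q (frag_of b) = q (frag_of c)"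
    using mem[THEN q_closed] by (metis T.inv_closed T.inv_inv T.inv_equality T.m_closed insertCI)
  then show ?thesis
    using mem[THEN q_closed] by (metis T.inv_solve_right T.m_comm insertCI)
qed

lemma pure_tensor_rel2:
  assumes "frag_of a - frag_of b \<in> tensor_relators R A B"
    and "{a, b} \<subseteq> carrier A \<times> carrier B"
  shows "q (frag_of a) = q (frag_of b)"
proof -
  have mem: "frag_of x \<in> carrier F" if "x \<in> {a, b}" for x using assms(2) that by auto
  have "frag_of a - frag_of b \<in> rels"
    unfolding tensor_relations_def using assms(1) by (rule generate.incl)
  then have "q (frag_of a - frag_of b) = \<one>\<^bsub>T\<^esub>"
    using q_one_iff relators_subset assms(1) by blast
  then have "q (frag_of a) \<otimes>\<^bsub>T\<^esub> inv\<^bsub>T\<^esub> q (frag_of b) = \<one>\<^bsub>T\<^esub>"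
    using q_diff[OF mem mem, of a b] by simp
  then show ?thesis
    using mem[THEN q_closed] by (metis T.inv_closed T.inv_inv T.inv_equality insertCI)
qed

lemma balanced_pure_tensor: "balanced R A B T (\<lambda>x y. x \<otimes>\<^sub>t y)"
proof (rule balancedI)
  fix x x' y assume "x \<in> carrier A" "x' \<in> carrier A" "y \<in> carrier B"
  then show "(x \<oplus>\<^bsub>A\<^esub> x') \<otimes>\<^sub>t y = (x \<otimes>\<^sub>t y) \<otimes>\<^bsub>T\<^esub> (x' \<otimes>\<^sub>t y)"
    unfolding pure_tensor_def by (intro pure_tensor_rel3) (auto simp: tensor_relators_def)
next
  fix x y y' assume "x \<in> carrier A" "y \<in> carrier B" "y' \<in> carrier B"
  then show "x \<otimes>\<^sub>t (y \<oplus>\<^bsub>B\<^esub> y') = (x \<otimes>\<^sub>t y) \<otimes>\<^bsub>T\<^esub> (x \<otimes>\<^sub>t y')"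
    unfolding pure_tensor_def by (intro pure_tensor_rel3) (auto simp: tensor_relators_def)
next
  fix r x y assume *: "r \<in> carrier R" "x \<in> carrier A" "y \<in> carrier B"
  then have "r \<odot>\<^bsub>A\<^esub> x \<in> carrier A" using A.smult_closed[of r x] by simp
  with * show "(r \<odot>\<^bsub>A\<^esub> x) \<otimes>\<^sub>t y = x \<otimes>\<^sub>t (r \<odot>\<^bsub>B\<^esub> y)"
    unfolding pure_tensor_def by (intro pure_tensor_rel2) (auto simp: tensor_relators_def)
qed auto

lemmas pure_tensor_add_left = balanced_pure_tensor[unfolded balanced_def, THEN conjunct2, THEN conjunct1, rule_format]
lemmas pure_tensor_add_right = balanced_pure_tensor[unfolded balanced_def, THEN conjunct2, THEN conjunct2, THEN conjunct1, rule_format]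
lemmas pure_tensor_balance = balanced_pure_tensor[unfolded balanced_def, THEN conjunct2, THEN conjunct2, THEN conjunct2, rule_format]

lemma pure_tensor_hom_left: "y \<in> carrier B \<Longrightarrow> (\<lambda>x. x \<otimes>\<^sub>t y) \<in> hom (add_monoid A) T"
  by (auto simp: hom_def pure_tensor_add_left)

lemma pure_tensor_hom_right: "x \<in> carrier A \<Longrightarrow> (\<lambda>y. x \<otimes>\<^sub>t y) \<in> hom (add_monoid B) T"
  by (auto simp: hom_def pure_tensor_add_right)

lemma pure_tensor_zero_left [simp]: "y \<in> carrier B \<Longrightarrow> \<zero>\<^bsub>A\<^esub> \<otimes>\<^sub>t y = \<one>\<^bsub>T\<^esub>"
  using comm_group_hom_one[OF A.M.a_comm_group comm_group_T pure_tensor_hom_left] by simp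

lemma pure_tensor_zero_right [simp]: "x \<in> carrier A \<Longrightarrow> x \<otimes>\<^sub>t \<zero>\<^bsub>B\<^esub> = \<one>\<^bsub>T\<^esub>"
  using comm_group_hom_one[OF B.M.a_comm_group comm_group_T pure_tensor_hom_right] by simp

lemma pure_tensor_minus_left:
  "\<lbrakk>x \<in> carrier A; y \<in> carrier B\<rbrakk> \<Longrightarrow> (\<ominus>\<^bsub>A\<^esub> x) \<otimes>\<^sub>t y = inv\<^bsub>T\<^esub> (x \<otimes>\<^sub>t y)"
  using comm_group_hom_inv[OF A.M.a_comm_group comm_group_T pure_tensor_hom_left, of y x]
  by (simp add: a_inv_def)

lemma pure_tensor_finsum_left:
  "\<lbrakk>f \<in> Y \<rightarrow> carrier A; y \<in> carrier B\<rbrakk> \<Longrightarrow>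
     finsum A f Y \<otimes>\<^sub>t y = finprod T (\<lambda>x. f x \<otimes>\<^sub>t y) Y"
  using hom_finprod_comm_group[OF A.M.a_comm_group comm_group_T pure_tensor_hom_left, of y f Y]
  by (simp add: finsum_def)

text \<open>Inverses need no case of their own, because \<open>-(x \<otimes> y) = (-x) \<otimes> y\<close>.\<close>

lemma tensor_induct [consumes 1, case_names pure mult]:
  assumes t: "t \<in> carrier T"
    and pure: "\<And>x y. \<lbrakk>x \<in> carrier A; y \<in> carrier B\<rbrakk> \<Longrightarrow> P (x \<otimes>\<^sub>t y)"
    and mult: "\<And>s t. \<lbrakk>s \<in> carrier T; t \<in> carrier T; P s; P t\<rbrakk> \<Longrightarrow> P (s \<otimes>\<^bsub>T\<^esub> t)"
  shows "P t"
proof -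
  obtain c where c: "c \<in> carrier F" "t = q c" using q_surj[OF t] by blast
  have "P (q c) \<and> P (inv\<^bsub>T\<^esub> q c)"
  proof (rule free_Abelian_group_induct[of c "carrier A \<times> carrier B"])
    show "Poly_Mapping.keys c \<subseteq> carrier A \<times> carrier B" using c(1) by simp
  next
    have "q 0 = \<one>\<^bsub>T\<^esub>" using q_one_iff[of 0] subgroup.one_closed[OF subgroup_rels] by simp
    moreover have "P \<one>\<^bsub>T\<^esub>" using pure[OF A.M.zero_closed B.M.zero_closed] by simp
    ultimately show "P (q 0) \<and> P (inv\<^bsub>T\<^esub> q 0)" by simp
  next
    fix x y assume xy: "Poly_Mapping.keys x \<subseteq> carrier A \<times> carrier B"
      "Poly_Mapping.keys y \<subseteq> carrier A \<times> carrier B"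
      and IH: "P (q x) \<and> P (inv\<^bsub>T\<^esub> q x)" "P (q y) \<and> P (inv\<^bsub>T\<^esub> q y)"
    have cl: "q x \<in> carrier T" "q y \<in> carrier T" using xy by (auto intro!: q_closed)
    have "q (x - y) = q x \<otimes>\<^bsub>T\<^esub> inv\<^bsub>T\<^esub> q y" using xy by (intro q_diff) auto
    moreover from this have "inv\<^bsub>T\<^esub> q (x - y) = q y \<otimes>\<^bsub>T\<^esub> inv\<^bsub>T\<^esub> q x"
      using cl by (simp add: T.inv_mult_group)
    ultimately show "P (q (x - y)) \<and> P (inv\<^bsub>T\<^esub> q (x - y))"
      using IH cl by (simp add: mult)
  next
    fix a assume "a \<in> carrier A \<times> carrier B"
    then obtain x y where a: "a = (x, y)" "x \<in> carrier A" "y \<in> carrier B" by auto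
    from pure[of x y] pure[of "\<ominus>\<^bsub>A\<^esub> x" y] a
    show "P (q (frag_of a)) \<and> P (inv\<^bsub>T\<^esub> q (frag_of a))"
      by (simp add: pure_tensor_minus_left) (simp add: pure_tensor_def)
  qed
  with c show ?thesis by simp
qed

lemma tensor_hom_eqI:
  assumes "f \<in> hom T G" "g \<in> hom T G" "t \<in> carrier T"
    and "\<And>x y. \<lbrakk>x \<in> carrier A; y \<in> carrier B\<rbrakk> \<Longrightarrow> f (x \<otimes>\<^sub>t y) = g (x \<otimes>\<^sub>t y)"
  shows "f t = g t"
  using assms(3)
  by (induction rule: tensor_induct) (simp_all add: assms(4) hom_mult[OF assms(1)] hom_mult[OF assms(2)])

text \<open>The homomorphism from the free abelian group that extends a balanced map kills the relators,
  so it factors through the quotient.\<close>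

lemma tensor_universal:
  assumes G: "comm_group G" and \<beta>: "balanced R A B G \<beta>"
  obtains f where "f \<in> hom T G"
    and "\<And>x y. \<lbrakk>x \<in> carrier A; y \<in> carrier B\<rbrakk> \<Longrightarrow> f (x \<otimes>\<^sub>t y) = \<beta> x y"
proof -
  interpret G: comm_group G by fact
  have \<beta>': "\<And>x y. \<lbrakk>x \<in> carrier A; y \<in> carrier B\<rbrakk> \<Longrightarrow> \<beta> x y \<in> carrier G"
    using \<beta> by (auto simp: balanced_def)
  then have "(\<lambda>(x, y). \<beta> x y) ` (carrier A \<times> carrier B) \<subseteq> carrier G" by auto
  then obtain h where h: "h \<in> hom F G"
    and h_of: "\<And>a. a \<in> carrier A \<times> carrier B \<Longrightarrow> h (frag_of a) = (\<lambda>(x, y). \<beta> x y) a"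
    using G.free_Abelian_group_universal[of "\<lambda>(x, y). \<beta> x y" "carrier A \<times> carrier B"] by metis
  interpret h: group_hom F G h
    using h by (simp add: group_hom.intro group_hom_axioms.intro)
  have of: "frag_of (x, y) \<in> carrier F" if "x \<in> carrier A" "y \<in> carrier B" for x y
    using that by simp
  have minus: "h (a - b) = h a \<otimes>\<^bsub>G\<^esub> inv\<^bsub>G\<^esub> h b" "a - b \<in> carrier F"
    if "a \<in> carrier F" "b \<in> carrier F" for a b
    using that h.hom_mult[of a "inv\<^bsub>F\<^esub> b"] h.hom_inv[of b] group.inv_closed[OF group_free_Abelian_group that(2)]
      keys_diff[of a b] by auto
  have smA: "r \<odot>\<^bsub>A\<^esub> x \<in> carrier A" if "r \<in> carrier R" "x \<in> carrier A" for r x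
    using A.smult_closed[of r x] that by simp
  have "tensor_relators R A B \<subseteq> kernel F G h"
  proof
    fix c assume c: "c \<in> tensor_relators R A B"
    then have "c \<in> carrier F" using relators_subset by blast
    moreover have "h c = \<one>\<^bsub>G\<^esub>"
      using c unfolding tensor_relators_def
    proof (elim UnE CollectE exE conjE)
      fix x x' y assume *: "c = frag_of (x \<oplus>\<^bsub>A\<^esub> x', y) - frag_of (x, y) - frag_of (x', y)"
        "x \<in> carrier A" "x' \<in> carrier A" "y \<in> carrier B"
      have "\<beta> (x \<oplus>\<^bsub>A\<^esub> x') y = \<beta> x y \<otimes>\<^bsub>G\<^esub> \<beta> x' y" using \<beta> * by (auto simp: balanced_def)
      with * \<beta>' show ?thesis
        by (simp add: minus of h_of del: carrier_free_Abelian_group_iff mult_free_Abelian_group)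
          (metis G.inv_closed G.inv_solve_right G.m_closed G.m_comm G.r_inv)
    next
      fix x y y' assume *: "c = frag_of (x, y \<oplus>\<^bsub>B\<^esub> y') - frag_of (x, y) - frag_of (x, y')"
        "x \<in> carrier A" "y \<in> carrier B" "y' \<in> carrier B"
      have "\<beta> x (y \<oplus>\<^bsub>B\<^esub> y') = \<beta> x y \<otimes>\<^bsub>G\<^esub> \<beta> x y'" using \<beta> * by (auto simp: balanced_def)
      with * \<beta>' show ?thesis
        by (simp add: minus of h_of del: carrier_free_Abelian_group_iff mult_free_Abelian_group)
          (metis G.inv_closed G.inv_solve_right G.m_closed G.m_comm G.r_inv)
    next
      fix r x y assume *: "c = frag_of (r \<odot>\<^bsub>A\<^esub> x, y) - frag_of (x, r \<odot>\<^bsub>B\<^esub> y)"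
        "r \<in> carrier R" "x \<in> carrier A" "y \<in> carrier B"
      have "\<beta> (r \<odot>\<^bsub>A\<^esub> x) y = \<beta> x (r \<odot>\<^bsub>B\<^esub> y)" using \<beta> * by (auto simp: balanced_def)
      with * \<beta>' show ?thesis
        by (simp add: minus of h_of smA del: carrier_free_Abelian_group_iff mult_free_Abelian_group)
    qed
    ultimately show "c \<in> kernel F G h" by (simp add: kernel_def)
  qed
  then have "rels \<subseteq> kernel F G h"
    unfolding tensor_relations_def
    by (intro group.generate_subgroup_incl[OF group_free_Abelian_group] h.subgroup_kernel)
  from h.FactGroup_universal_kernel[OF normal_rels this]
  obtain g where g: "g \<in> hom (F Mod rels) G" "\<And>c. c \<in> carrier F \<Longrightarrow> g (q c) = h c" by metis
  show ?thesis
  proof (rule that)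
    show "g \<in> hom T G" using g(1) by (simp add: tensor_def)
    show "g (x \<otimes>\<^sub>t y) = \<beta> x y" if "x \<in> carrier A" "y \<in> carrier B" for x y
      using that g(2)[OF of[OF that]] by (simp add: pure_tensor_def h_of)
  qed
qed

lemma
  assumes "comm_group G" "balanced R A B G \<beta>"
  shows tensor_lift_hom: "tensor_lift R A B G \<beta> \<in> hom T G"
    and tensor_lift_pure: "\<And>x y. \<lbrakk>x \<in> carrier A; y \<in> carrier B\<rbrakk> \<Longrightarrow>
      tensor_lift R A B G \<beta> (x \<otimes>\<^sub>t y) = \<beta> x y"
proof -
  have "\<exists>f. f \<in> hom T G \<and> (\<forall>x\<in>carrier A. \<forall>y\<in>carrier B. f (x \<otimes>\<^sub>t y) = \<beta> x y)"
    using tensor_universal[OF assms] by metis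
  from someI_ex[OF this]
  show "tensor_lift R A B G \<beta> \<in> hom T G"
    and "\<And>x y. \<lbrakk>x \<in> carrier A; y \<in> carrier B\<rbrakk> \<Longrightarrow> tensor_lift R A B G \<beta> (x \<otimes>\<^sub>t y) = \<beta> x y"
    unfolding tensor_lift_def by auto
qed

end

lemma
  assumes "tensor_pair R A B" "tensor_pair R A' B'"
    and f: "f \<in> left_module_hom (opposite R) A A'" and g: "g \<in> left_module_hom R B B'"
  shows bimap_hom: "bimap R A B A' B' f g \<in> hom (tensor R A B) (tensor R A' B')"
    and bimap_pure: "\<And>x y. \<lbrakk>x \<in> carrier A; y \<in> carrier B\<rbrakk> \<Longrightarrow>
      bimap R A B A' B' f g (pure_tensor R A B x y) = pure_tensor R A' B' (f x) (g y)"
proof -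
  interpret AB: tensor_pair R A B by fact
  interpret AB': tensor_pair R A' B' by fact
  note [simp] = lin_homD[OF f, simplified] lin_homD[OF g]
  have "balanced R A B (tensor R A' B') (\<lambda>x y. pure_tensor R A' B' (f x) (g y))"
    by (rule balancedI)
      (auto simp: AB'.pure_tensor_add_left AB'.pure_tensor_add_right AB'.pure_tensor_balance)
  from AB.tensor_lift_hom[OF AB'.comm_group_T this] AB.tensor_lift_pure[OF AB'.comm_group_T this]
  show "bimap R A B A' B' f g \<in> hom (tensor R A B) (tensor R A' B')"
    and "\<And>x y. \<lbrakk>x \<in> carrier A; y \<in> carrier B\<rbrakk> \<Longrightarrow>
      bimap R A B A' B' f g (pure_tensor R A B x y) = pure_tensor R A' B' (f x) (g y)"
    by (simp_all add: bimap_def)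
qed

text \<open>The map on the free groups induced by \<open>f\<close> respects the relations, so the cosets in the union
  that defines \<^const>\<open>tensor_map\<close> coincide and equal the value of \<open>f \<otimes> id\<close>.\<close>

lemma
  assumes "tensor_pair R A B" "tensor_pair R A' B"
    and f: "f \<in> left_module_hom (opposite R) A A'"
  shows tensor_map_hom: "tensor_map R A' B f \<in> hom (tensor R A B) (tensor R A' B)"
    and tensor_map_pure: "\<And>x y. \<lbrakk>x \<in> carrier A; y \<in> carrier B\<rbrakk> \<Longrightarrow>
      tensor_map R A' B f (pure_tensor R A B x y) = pure_tensor R A' B (f x) y"
proof -
  interpret AB: tensor_pair R A B by fact
  interpret AB': tensor_pair R A' B by fact
  let ?F = "free_Abelian_group (carrier A \<times> carrier B)"
  let ?F' = "free_Abelian_group (carrier A' \<times> carrier B)"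
  let ?T = "tensor R A B" and ?T' = "tensor R A' B"
  let ?e = "frag_extend (\<lambda>(x, y). frag_of (f x, y))"
  let ?q = "\<lambda>c. tensor_relations R A B #>\<^bsub>?F\<^esub> c"
  let ?q' = "\<lambda>c. tensor_relations R A' B #>\<^bsub>?F'\<^esub> c"
  let ?b = "bimap R A B A' B f (\<lambda>y. y)"
  have id: "(\<lambda>y. y) \<in> left_module_hom R B B" by (auto intro!: lin_homI)
  note b = bimap_hom[OF assms(1,2) f id] bimap_pure[OF assms(1,2) f id]
  have e: "?e c \<in> carrier ?F'" if "c \<in> carrier ?F" for c
  proof -
    have "Poly_Mapping.keys (case a of (x, y) \<Rightarrow> frag_of (f x, y)) \<subseteq> carrier A' \<times> carrier B"
      if "a \<in> carrier A \<times> carrier B" for a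
      using that lin_homD(1)[OF f] by auto
    with that have "(\<Union>a\<in>Poly_Mapping.keys c. Poly_Mapping.keys (case a of (x, y) \<Rightarrow> frag_of (f x, y)))
        \<subseteq> carrier A' \<times> carrier B"
      by (intro UN_least) auto
    then show ?thesis
      using keys_frag_extend[of "\<lambda>(x, y). frag_of (f x, y)" c] by simp
  qed
  have key: "?q' (?e c) = ?b (?q c)" if "c \<in> carrier ?F" for c
  proof (rule free_Abelian_group_induct[of c "carrier A \<times> carrier B"])
    show "Poly_Mapping.keys c \<subseteq> carrier A \<times> carrier B" using that by simp
  next
    have "?q 0 = \<one>\<^bsub>?T\<^esub>" "?q' 0 = \<one>\<^bsub>?T'\<^esub>"
      using comm_group_hom_one[OF AB.comm_group_F AB.comm_group_T AB.q_hom]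
        comm_group_hom_one[OF AB'.comm_group_F AB'.comm_group_T AB'.q_hom] by simp_all
    then show "?q' (?e 0) = ?b (?q 0)"
      using comm_group_hom_one[OF AB.comm_group_T AB'.comm_group_T b(1)] by simp
  next
    fix x y assume xy: "Poly_Mapping.keys x \<subseteq> carrier A \<times> carrier B"
      "Poly_Mapping.keys y \<subseteq> carrier A \<times> carrier B"
      and IH: "?q' (?e x) = ?b (?q x)" "?q' (?e y) = ?b (?q y)"
    have cl: "x \<in> carrier ?F" "y \<in> carrier ?F" using xy by auto
    have "?q' (?e (x - y)) = ?q' (?e x) \<otimes>\<^bsub>?T'\<^esub> inv\<^bsub>?T'\<^esub> ?q' (?e y)"
      using AB'.q_diff[OF e e, OF cl] by (simp add: frag_extend_diff)
    also have "\<dots> = ?b (?q x) \<otimes>\<^bsub>?T'\<^esub> ?b (inv\<^bsub>?T\<^esub> ?q y)"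
      using IH comm_group_hom_inv[OF AB.comm_group_T AB'.comm_group_T b(1) AB.q_closed[OF cl(2)]] by simp
    also have "\<dots> = ?b (?q x \<otimes>\<^bsub>?T\<^esub> inv\<^bsub>?T\<^esub> ?q y)"
      using hom_mult[OF b(1) AB.q_closed[OF cl(1)] AB.T.inv_closed[OF AB.q_closed[OF cl(2)]]] by simp
    finally show "?q' (?e (x - y)) = ?b (?q (x - y))"
      using AB.q_diff[OF cl] by simp
  next
    fix a assume "a \<in> carrier A \<times> carrier B"
    then show "?q' (?e (frag_of a)) = ?b (?q (frag_of a))"
      using b(2) by (auto simp: pure_tensor_def)
  qed
  have eq: "tensor_map R A' B f t = ?b t" if t: "t \<in> carrier ?T" for t
  proof -
    have "c \<in> carrier ?F \<and> t = ?q c" if "c \<in> t" for c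
    proof -
      obtain c0 where c0: "c0 \<in> carrier ?F" "t = ?q c0" using AB.q_surj[OF t] by blast
      have "c \<in> carrier ?F"
        using subgroup.elemrcos_carrier[OF AB.subgroup_rels group_free_Abelian_group c0(1)] that c0(2) by blast
      moreover have "?q c0 = ?q c"
        by (rule group.repr_independence[OF group_free_Abelian_group _ c0(1) AB.subgroup_rels])
          (use that c0 in simp)
      ultimately show ?thesis using c0(2) by simp
    qed
    moreover have "t \<noteq> {}"
    proof -
      obtain c0 where c0: "c0 \<in> carrier ?F" "t = ?q c0" using AB.q_surj[OF t] by blast
      show ?thesis using group.rcos_self[OF group_free_Abelian_group c0(1) AB.subgroup_rels] c0(2) by blast
    qed
    ultimately show ?thesis
      unfolding tensor_map_def using key by auto
  qed
  show "tensor_map R A' B f \<in> hom ?T ?T'"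
    using b(1) eq by (auto simp: hom_def Pi_iff)
  show "tensor_map R A' B f (pure_tensor R A B x y) = pure_tensor R A' B (f x) y"
    if "x \<in> carrier A" "y \<in> carrier B" for x y
    using that eq b(2) by simp
qed


lemma tensor_pairI: "left_module (opposite R) A \<Longrightarrow> left_module R B \<Longrightarrow> tensor_pair R A B"
  by (rule tensor_pair.intro)

subsection \<open>Symmetry\<close>

definition flip ::
  "('a, 'k) ring_scheme \<Rightarrow> ('a, 'p) module \<Rightarrow> ('a, 'q) module \<Rightarrow>
   ('p \<times> 'q \<Rightarrow>\<^sub>0 int) set \<Rightarrow> ('q \<times> 'p \<Rightarrow>\<^sub>0 int) set" where
  "flip R A B = tensor_lift R A B (tensor (opposite R) B A) (\<lambda>x y. pure_tensor (opposite R) B A y x)"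

lemma tensor_pair_opposite: "tensor_pair R A B \<Longrightarrow> tensor_pair (opposite R) B A"
  by (simp add: tensor_pair_def)

lemma
  assumes "tensor_pair R A B"
  shows flip_hom: "flip R A B \<in> hom (tensor R A B) (tensor (opposite R) B A)"
    and flip_pure: "\<And>x y. \<lbrakk>x \<in> carrier A; y \<in> carrier B\<rbrakk> \<Longrightarrow>
      flip R A B (pure_tensor R A B x y) = pure_tensor (opposite R) B A y x"
proof -
  interpret AB: tensor_pair R A B by fact
  interpret BA: tensor_pair "opposite R" B A by (rule tensor_pair_opposite[OF assms])
  have "balanced R A B (tensor (opposite R) B A) (\<lambda>x y. pure_tensor (opposite R) B A y x)"
    by (rule balancedI)
      (simp_all add: BA.pure_tensor_add_left BA.pure_tensor_add_right BA.pure_tensor_balance)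
  from AB.tensor_lift_hom[OF BA.comm_group_T this] AB.tensor_lift_pure[OF BA.comm_group_T this]
  show "flip R A B \<in> hom (tensor R A B) (tensor (opposite R) B A)"
    and "\<And>x y. \<lbrakk>x \<in> carrier A; y \<in> carrier B\<rbrakk> \<Longrightarrow>
      flip R A B (pure_tensor R A B x y) = pure_tensor (opposite R) B A y x"
    by (simp_all add: flip_def)
qed

lemma flip_flip:
  assumes "tensor_pair R A B" "t \<in> carrier (tensor R A B)"
  shows "flip (opposite R) B A (flip R A B t) = t"
proof -
  interpret AB: tensor_pair R A B by fact
  have BA: "tensor_pair (opposite R) B A" by (rule tensor_pair_opposite[OF assms(1)])
  have "(\<lambda>t. flip (opposite R) B A (flip R A B t)) \<in> hom (tensor R A B) (tensor R A B)"
    using hom_comp[OF flip_hom[OF assms(1)] flip_hom[OF BA]] by simp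
  then show ?thesis
  proof (rule AB.tensor_hom_eqI[OF _ hom_ident assms(2)])
    fix x y assume "x \<in> carrier A" "y \<in> carrier B"
    then show "flip (opposite R) B A (flip R A B (pure_tensor R A B x y)) = pure_tensor R A B x y"
      using flip_pure[OF assms(1)] flip_pure[OF BA] by simp
  qed
qed

lemma flip_bimap:
  assumes "tensor_pair R A B" "tensor_pair R A' B'"
    and f: "f \<in> left_module_hom (opposite R) A A'" and g: "g \<in> left_module_hom R B B'"
    and t: "t \<in> carrier (tensor R A B)"
  shows "flip R A' B' (bimap R A B A' B' f g t) = bimap (opposite R) B A B' A' g f (flip R A B t)"
proof -
  interpret AB: tensor_pair R A B by fact
  note BA = tensor_pair_opposite[OF assms(1)] and BA' = tensor_pair_opposite[OF assms(2)]
  have g': "g \<in> left_module_hom (opposite (opposite R)) B B'" using g by simp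
  note b = bimap_hom[OF assms(1,2) f g] bimap_pure[OF assms(1,2) f g]
  note b' = bimap_hom[OF BA BA' g' f] bimap_pure[OF BA BA' g' f]
  show ?thesis
  proof (rule AB.tensor_hom_eqI[OF hom_comp[OF b(1) flip_hom[OF assms(2)]] hom_comp[OF flip_hom[OF assms(1)] b'(1)] t])
    fix x y assume *: "x \<in> carrier A" "y \<in> carrier B"
    show "flip R A' B' (bimap R A B A' B' f g (pure_tensor R A B x y)) =
        bimap (opposite R) B A B' A' g f (flip R A B (pure_tensor R A B x y))"
      unfolding b(2)[OF *] flip_pure[OF assms(1) *] b'(2)[OF *(2,1)]
      by (rule flip_pure[OF assms(2) lin_homD(1)[OF f *(1)] lin_homD(1)[OF g *(2)]])
  qed
qed

lemma flip_closed: "tensor_pair R A B \<Longrightarrow> t \<in> carrier (tensor R A B) \<Longrightarrow>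
    flip R A B t \<in> carrier (tensor (opposite R) B A)"
  using flip_hom by (rule hom_in_carrier)

lemma flip_one: "tensor_pair R A B \<Longrightarrow> flip R A B \<one>\<^bsub>tensor R A B\<^esub> = \<one>\<^bsub>tensor (opposite R) B A\<^esub>"
  by (intro comm_group_hom_one flip_hom tensor_pair.comm_group_T tensor_pair_opposite)

subsection \<open>Exactness\<close>

text \<open>Tensoring with a projective right module \<open>P\<close> is exact. A dual basis \<open>c\<close> of \<open>P\<close> gives coordinate
  maps \<open>p \<otimes> b \<mapsto> c p y \<odot> b\<close> from \<open>P \<otimes> B\<close> to \<open>B\<close>, natural in \<open>B\<close>, and every \<open>t\<close> is the finite sum
  of the \<open>y \<otimes> F y t\<close>, where \<open>F y\<close> is the coordinate map at \<open>y\<close>. If \<open>t\<close> maps to zero, all its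
  coordinates lie in the kernel of \<open>g1\<close>; they are lifted one by one along \<open>g2\<close>.\<close>

lemma projective_tensor_exact:
  fixes R :: "('a, 'k) ring_scheme" and P :: "('a, 'u) module"
  assumes inf: "infinite (UNIV :: 'u set)" and cR: "carrier R \<lesssim> (UNIV :: 'u set)"
    and P: "projective (opposite R) P"
    and B: "left_module R B2" "left_module R B1" "left_module R B0"
    and g2: "g2 \<in> left_module_hom R B2 B1" and g1: "g1 \<in> left_module_hom R B1 B0"
    and exact: "\<And>y. \<lbrakk>y \<in> carrier B1; g1 y = \<zero>\<^bsub>B0\<^esub>\<rbrakk> \<Longrightarrow> y \<in> g2 ` carrier B2"
    and t: "t \<in> carrier (tensor R P B1)"
    and t0: "bimap R P B1 P B0 (\<lambda>x. x) g1 t = \<one>\<^bsub>tensor R P B0\<^esub>"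
  shows "\<exists>u\<in>carrier (tensor R P B2). bimap R P B2 P B1 (\<lambda>x. x) g2 u = t"
proof -
  have mP: "left_module (opposite R) P" using P by (simp add: projective_def)
  interpret P2: tensor_pair R P B2 using mP B by (intro tensor_pairI)
  interpret P1: tensor_pair R P B1 using mP B by (intro tensor_pairI)
  interpret P0: tensor_pair R P B0 using mP B by (intro tensor_pairI)
  have pair: "tensor_pair R P B2" "tensor_pair R P B1" "tensor_pair R P B0" by unfold_locales
  let ?T = "tensor R P B1" and ?p = "pure_tensor R P B1"
  note id = lin_hom_id[of "opposite R" P]
  obtain c where c: "c \<in> left_module_hom (opposite R) P (free_module (opposite R) (carrier P))"
    and c_eq: "\<And>x. x \<in> carrier P \<Longrightarrow> lin_comb (opposite R) P (\<lambda>y. y) (c x) = x"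
    using projective_dual_basis[of "opposite R" P] inf cR P by auto
  have c_mem: "c x \<in> carrier (free_module (opposite R) (carrier P))" if "x \<in> carrier P" for x
    using lin_homD(1)[OF c that] .
  have c_closed: "c x y \<in> carrier R" if "x \<in> carrier P" for x y
    using c_mem[OF that] by (auto simp: free_module_carrier)
  have c_add: "c (x \<oplus>\<^bsub>P\<^esub> x') y = c x y \<oplus>\<^bsub>R\<^esub> c x' y" if "x \<in> carrier P" "x' \<in> carrier P" for x x' y
    using lin_homD(2)[OF c that] by simp
  have c_smult: "c (r \<odot>\<^bsub>P\<^esub> x) y = c x y \<otimes>\<^bsub>R\<^esub> r" if "x \<in> carrier P" "r \<in> carrier R" for x r y
    using lin_homD(3)[OF c, of r x] that by simp
  have bal: "balanced R P B (add_monoid B) (\<lambda>p b. c p y \<odot>\<^bsub>B\<^esub> b)" if "left_module R B" for B :: "('a, 'z) module" and y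
  proof -
    interpret B: left_module R B by fact
    show ?thesis
      by (rule balancedI)
        (simp_all add: c_closed c_add c_smult B.smult_l_distr B.smult_r_distr B.smult_assoc)
  qed
  define F1 where "F1 y = tensor_lift R P B1 (add_monoid B1) (\<lambda>p b. c p y \<odot>\<^bsub>B1\<^esub> b)" for y
  define F0 where "F0 y = tensor_lift R P B0 (add_monoid B0) (\<lambda>p b. c p y \<odot>\<^bsub>B0\<^esub> b)" for y
  note F1_hom = P1.tensor_lift_hom[OF left_module_comm_group[OF B(2)] bal[OF B(2)], folded F1_def]
    and F1_pure = P1.tensor_lift_pure[OF left_module_comm_group[OF B(2)] bal[OF B(2)], folded F1_def]
    and F0_hom = P0.tensor_lift_hom[OF left_module_comm_group[OF B(3)] bal[OF B(3)], folded F0_def]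
    and F0_pure = P0.tensor_lift_pure[OF left_module_comm_group[OF B(3)] bal[OF B(3)], folded F0_def]
  have F1_closed: "F1 y s \<in> carrier B1" if "s \<in> carrier (?T)" for y s
    using hom_in_carrier[OF F1_hom that] by simp
  \<comment> \<open>\<open>Y\<close> may be enlarged at will, so that the expansions of two summands can be added.\<close>
  define expands where "expands s Y \<longleftrightarrow> (\<forall>Z. finite Z \<longrightarrow> Y \<subseteq> Z \<longrightarrow> Z \<subseteq> carrier P \<longrightarrow>
      s = finprod (?T) (\<lambda>y. ?p y (F1 y s)) Z)" for s Y
  have decomp: "\<exists>Y. finite Y \<and> Y \<subseteq> carrier P \<and> expands s Y"
    if "s \<in> carrier (?T)" for s
    using that
  proof (induction rule: P1.tensor_induct)
    case (pure p b)
    let ?Y = "{y. c p y \<noteq> \<zero>\<^bsub>opposite R\<^esub>}"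
    have "finite ?Y" "?Y \<subseteq> carrier P" using c_mem[OF pure(1)] by (auto simp: free_module_carrier)
    moreover have "?p p b =
        finprod (?T) (\<lambda>y. ?p y (F1 y (?p p b))) Z"
      if Z: "finite Z" "?Y \<subseteq> Z" "Z \<subseteq> carrier P" for Z
    proof -
      have cl: "c p y \<odot>\<^bsub>P\<^esub> y \<in> carrier P" if "y \<in> Z" for y
        using P2.A.smult_closed[of "c p y" y] c_closed[OF pure(1)] that Z(3) by auto
      have "p = finsum P (\<lambda>y. c p y \<odot>\<^bsub>P\<^esub> y) Z"
        using lin_comb_superset[OF mP c_mem[OF pure(1)], of "\<lambda>y. y" Z] Z c_eq[OF pure(1)] by simp
      then have "?p p b = ?p (finsum P (\<lambda>y. c p y \<odot>\<^bsub>P\<^esub> y) Z) b"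
        by simp
      also have "\<dots> = finprod (?T) (\<lambda>y. ?p (c p y \<odot>\<^bsub>P\<^esub> y) b) Z"
        using cl by (intro P1.pure_tensor_finsum_left pure(2)) auto
      also have "\<dots> = finprod (?T) (\<lambda>y. ?p y (F1 y (?p p b))) Z"
        using Z(3) c_closed[OF pure(1)] pure
        by (intro P1.T.finprod_cong') (auto simp: F1_pure P1.pure_tensor_balance Pi_iff subset_iff)
      finally show ?thesis .
    qed
    ultimately show ?case unfolding expands_def by blast
  next
    case (mult s u)
    obtain Y Y' where Y: "finite Y" "Y \<subseteq> carrier P" "expands s Y"
      and Y': "finite Y'" "Y' \<subseteq> carrier P" "expands u Y'"
      using mult.IH by blast
    have "s \<otimes>\<^bsub>?T\<^esub> u =
        finprod (?T) (\<lambda>y. ?p y (F1 y (s \<otimes>\<^bsub>?T\<^esub> u))) Z"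
      if Z: "finite Z" "Y \<union> Y' \<subseteq> Z" "Z \<subseteq> carrier P" for Z
    proof -
      let ?f = "\<lambda>s. finprod (?T) (\<lambda>y. ?p y (F1 y s)) Z"
      have "s \<otimes>\<^bsub>?T\<^esub> u = ?f s \<otimes>\<^bsub>?T\<^esub> ?f u"
        using Y(3)[unfolded expands_def, rule_format, of Z] Y'(3)[unfolded expands_def, rule_format, of Z] Z
        by (intro arg_cong2[where f = "\<lambda>a b. a \<otimes>\<^bsub>?T\<^esub> b"]) auto
      also have "\<dots> = finprod (?T) (\<lambda>y. ?p y (F1 y s) \<otimes>\<^bsub>?T\<^esub> ?p y (F1 y u)) Z"
        using Z(3) mult.hyps F1_closed by (intro P1.T.finprod_multf[symmetric]) (auto simp: Pi_iff subset_iff)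
      also have "\<dots> = ?f (s \<otimes>\<^bsub>?T\<^esub> u)"
        using Z(3) mult.hyps F1_closed
        by (intro P1.T.finprod_cong')
          (auto simp: Pi_iff subset_iff hom_mult[OF F1_hom] P1.pure_tensor_add_right)
      finally show ?thesis .
    qed
    moreover have "finite (Y \<union> Y')" "Y \<union> Y' \<subseteq> carrier P" using Y(1,2) Y'(1,2) by auto
    ultimately show ?case unfolding expands_def by blast
  qed
  obtain Y where Y: "finite Y" "Y \<subseteq> carrier P" and "expands t Y"
    using decomp[OF t] by blast
  have t_eq: "t = finprod (?T) (\<lambda>y. ?p y (F1 y t)) Y"
    by (rule \<open>expands t Y\<close>[unfolded expands_def, rule_format, OF Y(1) order_refl Y(2)])
  note b1 = bimap_hom[OF pair(2,3) id g1] bimap_pure[OF pair(2,3) id g1]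
  note b2 = bimap_hom[OF pair(1,2) id g2] bimap_pure[OF pair(1,2) id g2]
  have "F0 y (bimap R P B1 P B0 (\<lambda>x. x) g1 t) = g1 (F1 y t)" for y
  proof (rule P1.tensor_hom_eqI[OF hom_comp[OF b1(1) F0_hom] hom_comp[OF F1_hom lin_hom_add_monoid[OF g1]] t])
    fix p b assume "p \<in> carrier P" "b \<in> carrier B1"
    then show "F0 y (bimap R P B1 P B0 (\<lambda>x. x) g1 (?p p b)) = g1 (F1 y (?p p b))"
      by (simp add: b1(2) F0_pure F1_pure lin_homD[OF g1] c_closed)
  qed
  moreover have "F0 y \<one>\<^bsub>tensor R P B0\<^esub> = \<zero>\<^bsub>B0\<^esub>" for y
    using comm_group_hom_one[OF P0.comm_group_T left_module_comm_group[OF B(3)] F0_hom] by simp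
  ultimately have "g1 (F1 y t) = \<zero>\<^bsub>B0\<^esub>" for y using t0 by metis
  then have "\<exists>w\<in>carrier B2. g2 w = F1 y t" for y using exact F1_closed[OF t] by (metis imageE)
  then obtain w where w: "\<And>y. w y \<in> carrier B2" "\<And>y. g2 (w y) = F1 y t" by metis
  let ?u = "finprod (tensor R P B2) (\<lambda>y. pure_tensor R P B2 y (w y)) Y"
  have cl: "(\<lambda>y. pure_tensor R P B2 y (w y)) \<in> Y \<rightarrow> carrier (tensor R P B2)"
    using Y(2) w(1) by auto
  have "bimap R P B2 P B1 (\<lambda>x. x) g2 ?u =
      finprod (?T) (\<lambda>y. bimap R P B2 P B1 (\<lambda>x. x) g2 (pure_tensor R P B2 y (w y))) Y"
    by (rule hom_finprod_comm_group[OF P2.comm_group_T P1.comm_group_T b2(1) cl])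
  also have "\<dots> = finprod (?T) (\<lambda>y. ?p y (F1 y t)) Y"
    using Y(2) w F1_closed[OF t] by (intro P1.T.finprod_cong') (auto simp: b2(2) subset_iff)
  finally have "bimap R P B2 P B1 (\<lambda>x. x) g2 ?u = t" using t_eq by simp
  moreover have "?u \<in> carrier (tensor R P B2)" using cl by (rule P2.T.finprod_closed)
  ultimately show ?thesis by blast
qed

text \<open>The mirror image, obtained by exchanging the two factors.\<close>

lemma projective_tensor_exact_right:
  fixes R :: "('a, 'k) ring_scheme" and Q :: "('a, 'u) module"
  assumes inf: "infinite (UNIV :: 'u set)" and cR: "carrier R \<lesssim> (UNIV :: 'u set)"
    and Q: "projective R Q"
    and A: "left_module (opposite R) A2" "left_module (opposite R) A1" "left_module (opposite R) A0"
    and f2: "f2 \<in> left_module_hom (opposite R) A2 A1" and f1: "f1 \<in> left_module_hom (opposite R) A1 A0"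
    and exact: "\<And>x. \<lbrakk>x \<in> carrier A1; f1 x = \<zero>\<^bsub>A0\<^esub>\<rbrakk> \<Longrightarrow> x \<in> f2 ` carrier A2"
    and t: "t \<in> carrier (tensor R A1 Q)"
    and t0: "bimap R A1 Q A0 Q f1 (\<lambda>y. y) t = \<one>\<^bsub>tensor R A0 Q\<^esub>"
  shows "\<exists>u\<in>carrier (tensor R A2 Q). bimap R A2 Q A1 Q f2 (\<lambda>y. y) u = t"
proof -
  have mQ: "left_module R Q" using Q by (simp add: projective_def)
  have pair: "tensor_pair R A2 Q" "tensor_pair R A1 Q" "tensor_pair R A0 Q"
    using mQ A by (auto intro: tensor_pairI)
  note id = lin_hom_id[of R Q]
  have "bimap (opposite R) Q A1 Q A0 (\<lambda>y. y) f1 (flip R A1 Q t) = flip R A0 Q (bimap R A1 Q A0 Q f1 (\<lambda>y. y) t)"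
    using flip_bimap[OF pair(2,3) f1 id t] by simp
  also have "\<dots> = \<one>\<^bsub>tensor (opposite R) Q A0\<^esub>" using t0 flip_one[OF pair(3)] by simp
  finally have 1: "bimap (opposite R) Q A1 Q A0 (\<lambda>y. y) f1 (flip R A1 Q t) = \<one>\<^bsub>tensor (opposite R) Q A0\<^esub>" .
  have cR': "carrier (opposite R) \<lesssim> (UNIV :: 'u set)" using cR by simp
  have Q': "projective (opposite (opposite R)) Q" using Q by simp
  obtain u where u: "u \<in> carrier (tensor (opposite R) Q A2)"
    "bimap (opposite R) Q A2 Q A1 (\<lambda>y. y) f2 u = flip R A1 Q t"
    using projective_tensor_exact[OF inf cR' Q' A f2 f1 exact flip_closed[OF pair(2) t] 1] by blast
  note qair = pair[THEN tensor_pair_opposite]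
  have id': "(\<lambda>y. y) \<in> left_module_hom (opposite (opposite R)) Q Q" by (simp add: lin_hom_id)
  have "bimap R A2 Q A1 Q f2 (\<lambda>y. y) (flip (opposite R) Q A2 u) = t"
    using flip_bimap[OF qair(1,2) id' f2 u(1)] u(2) flip_flip[OF pair(2) t] by simp
  moreover have "flip (opposite R) Q A2 u \<in> carrier (tensor R A2 Q)"
    using flip_closed[OF qair(1) u(1)] by simp
  ultimately show ?thesis by blast
qed

text \<open>With a section \<open>s\<close> of \<open>f1\<close>, the map \<open>(a, y) \<mapsto> s a \<otimes> y\<close> is balanced modulo the image of
  \<open>A2 \<otimes> B\<close>: two choices of \<open>s a\<close> differ by an element of \<open>f2 ` A2\<close>. The homomorphism it
  induces recovers the class of \<open>t\<close> from the image of \<open>t\<close> in \<open>A0 \<otimes> B\<close>.\<close>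

lemma tensor_right_exact:
  assumes A: "left_module (opposite R) A2" "left_module (opposite R) A1" "left_module (opposite R) A0"
    and B: "left_module R B"
    and f2: "f2 \<in> left_module_hom (opposite R) A2 A1" and f1: "f1 \<in> left_module_hom (opposite R) A1 A0"
    and surj: "f1 ` carrier A1 = carrier A0"
    and exact: "\<And>x. \<lbrakk>x \<in> carrier A1; f1 x = \<zero>\<^bsub>A0\<^esub>\<rbrakk> \<Longrightarrow> x \<in> f2 ` carrier A2"
    and t: "t \<in> carrier (tensor R A1 B)"
    and t0: "bimap R A1 B A0 B f1 (\<lambda>y. y) t = \<one>\<^bsub>tensor R A0 B\<^esub>"
  shows "t \<in> bimap R A2 B A1 B f2 (\<lambda>y. y) ` carrier (tensor R A2 B)"
proof -
  interpret T2: tensor_pair R A2 B using A B by (intro tensor_pairI)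
  interpret T1: tensor_pair R A1 B using A B by (intro tensor_pairI)
  interpret T0: tensor_pair R A0 B using A B by (intro tensor_pairI)
  have pair: "tensor_pair R A2 B" "tensor_pair R A1 B" "tensor_pair R A0 B" by unfold_locales
  note id = lin_hom_id[of R B]
  note b1 = bimap_hom[OF pair(2,3) f1 id] bimap_pure[OF pair(2,3) f1 id]
  note b2 = bimap_hom[OF pair(1,2) f2 id] bimap_pure[OF pair(1,2) f2 id]
  let ?T1 = "tensor R A1 B"
  let ?p = "pure_tensor R A1 B"
  define H where "H = bimap R A2 B A1 B f2 (\<lambda>y. y) ` carrier (tensor R A2 B)"
  have H: "subgroup H ?T1"
    unfolding H_def
    by (rule group_hom.img_is_subgroup)
      (intro group_hom.intro group_hom_axioms.intro b2(1) T2.T.is_group T1.T.is_group)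
  define G where "G = ?T1 Mod H"
  have G: "comm_group G" unfolding G_def by (rule T1.T.abelian_FactGroup[OF H])
  interpret G: comm_group G by fact
  let ?q = "\<lambda>s. H #>\<^bsub>?T1\<^esub> s"
  have q: "?q \<in> hom ?T1 G"
    unfolding G_def by (rule normal.r_coset_hom_Mod[OF T1.T.subgroup_imp_normal[OF H]])
  have q_H: "?q s = \<one>\<^bsub>G\<^esub> \<longleftrightarrow> s \<in> H" if "s \<in> carrier ?T1" for s
    using T1.T.coset_join1[OF _ that H] T1.T.coset_join2[OF that H] by (auto simp: G_def)
  note q_closed = hom_in_carrier[OF q] and q_mult = hom_mult[OF q]
  have indep: "?q (?p x y) = ?q (?p x' y)"
    if x: "x \<in> carrier A1" "x' \<in> carrier A1" and eq: "f1 x = f1 x'" and y: "y \<in> carrier B" for x x' y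
  proof -
    have "f1 (x \<ominus>\<^bsub>A1\<^esub> x') = \<zero>\<^bsub>A0\<^esub>"
      using x eq lin_homD(1,2)[OF f1]
        comm_group_hom_inv[OF left_module_comm_group[OF A(2)] left_module_comm_group[OF A(3)]
          lin_hom_add_monoid[OF f1], of x']
      by (simp add: a_minus_def flip: a_inv_def) (simp add: T0.A.M.r_neg)
    then obtain w where w: "w \<in> carrier A2" "x \<ominus>\<^bsub>A1\<^esub> x' = f2 w"
      using exact[of "x \<ominus>\<^bsub>A1\<^esub> x'"] x by auto
    have "x = f2 w \<oplus>\<^bsub>A1\<^esub> x'" using x w(2)[symmetric] by (simp add: a_minus_def T1.A.M.a_assoc T1.A.M.l_neg)
    then have "?p x y = ?p (f2 w) y \<otimes>\<^bsub>?T1\<^esub> ?p x' y"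
      using T1.pure_tensor_add_left[of "f2 w" x' y] lin_homD(1)[OF f2 w(1)] x y by simp
    moreover have "?p (f2 w) y \<in> H"
      unfolding H_def using b2(2)[OF w(1) y] w(1) y by (metis T2.pure_tensor_closed image_eqI)
    ultimately show ?thesis
      using q_mult[of "?p (f2 w) y" "?p x' y"] q_H
        lin_homD(1)[OF f2 w(1)] x y q_closed by simp
  qed
  have "\<exists>x\<in>carrier A1. f1 x = a" if "a \<in> carrier A0" for a using surj that by (metis imageE)
  then obtain s where s: "\<And>a. a \<in> carrier A0 \<Longrightarrow> s a \<in> carrier A1" "\<And>a. a \<in> carrier A0 \<Longrightarrow> f1 (s a) = a"
    by metis
  have smA: "r \<odot>\<^bsub>A1\<^esub> x \<in> carrier A1" if "r \<in> carrier R" "x \<in> carrier A1" for r x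
    using T1.A.smult_closed[of r x] that by simp
  have smA0: "r \<odot>\<^bsub>A0\<^esub> x \<in> carrier A0" if "r \<in> carrier R" "x \<in> carrier A0" for r x
    using T0.A.smult_closed[of r x] that by simp
  note f1' = lin_homD[OF f1, simplified]
  have bal: "balanced R A0 B G (\<lambda>a y. ?q (?p (s a) y))"
  proof (rule balancedI)
    fix x x' y assume *: "x \<in> carrier A0" "x' \<in> carrier A0" "y \<in> carrier B"
    have "?q (?p (s (x \<oplus>\<^bsub>A0\<^esub> x')) y) = ?q (?p (s x \<oplus>\<^bsub>A1\<^esub> s x') y)"
      using * s f1' by (intro indep) auto
    then show "?q (?p (s (x \<oplus>\<^bsub>A0\<^esub> x')) y) =
        ?q (?p (s x) y) \<otimes>\<^bsub>G\<^esub> ?q (?p (s x') y)"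
      using * s by (simp add: T1.pure_tensor_add_left q_mult)
  next
    fix r x y assume *: "r \<in> carrier R" "x \<in> carrier A0" "y \<in> carrier B"
    have "?q (?p (s (r \<odot>\<^bsub>A0\<^esub> x)) y) = ?q (?p (r \<odot>\<^bsub>A1\<^esub> s x) y)"
      using * s f1' by (intro indep) (auto simp: smA smA0)
    then show "?q (?p (s (r \<odot>\<^bsub>A0\<^esub> x)) y) = ?q (?p (s x) (r \<odot>\<^bsub>B\<^esub> y))"
      using * s by (simp add: T1.pure_tensor_balance)
  qed (use s in \<open>simp_all add: T1.pure_tensor_add_right q_mult q_closed\<close>)
  define \<psi> where "\<psi> = tensor_lift R A0 B G (\<lambda>a y. ?q (?p (s a) y))"
  note \<psi> = T0.tensor_lift_hom[OF G bal, folded \<psi>_def] T0.tensor_lift_pure[OF G bal, folded \<psi>_def]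
  have "\<psi> (bimap R A1 B A0 B f1 (\<lambda>y. y) t) = ?q t"
  proof (rule T1.tensor_hom_eqI[OF hom_comp[OF b1(1) \<psi>(1)] q t])
    fix x y assume *: "x \<in> carrier A1" "y \<in> carrier B"
    then have "\<psi> (bimap R A1 B A0 B f1 (\<lambda>y. y) (?p x y)) = ?q (?p (s (f1 x)) y)"
      by (simp add: b1(2) \<psi>(2) f1')
    also have "\<dots> = ?q (?p x y)"
      using * s f1' by (intro indep) auto
    finally show "\<psi> (bimap R A1 B A0 B f1 (\<lambda>y. y) (?p x y)) = ?q (?p x y)" .
  qed
  then have "?q t = \<one>\<^bsub>G\<^esub>"
    using t0 comm_group_hom_one[OF T0.comm_group_T G \<psi>(1)] by simp
  then show ?thesis using q_H[OF t] by (simp add: H_def)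
qed


lemma bimap_comp:
  assumes AB: "tensor_pair R A B" "tensor_pair R A' B'" "tensor_pair R A'' B''"
    and f: "f \<in> left_module_hom (opposite R) A A'" "f' \<in> left_module_hom (opposite R) A' A''"
    and g: "g \<in> left_module_hom R B B'" "g' \<in> left_module_hom R B' B''"
    and t: "t \<in> carrier (tensor R A B)"
  shows "bimap R A' B' A'' B'' f' g' (bimap R A B A' B' f g t) =
    bimap R A B A'' B'' (\<lambda>x. f' (f x)) (\<lambda>y. g' (g y)) t"
proof -
  interpret AB: tensor_pair R A B by fact
  note ff = lin_hom_comp[OF f] and gg = lin_hom_comp[OF g]
  show ?thesis
  proof (rule AB.tensor_hom_eqI[OF hom_comp[OF bimap_hom[OF AB(1,2) f(1) g(1)] bimap_hom[OF AB(2,3) f(2) g(2)]]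
        bimap_hom[OF AB(1,3) ff gg] t])
    fix x y assume *: "x \<in> carrier A" "y \<in> carrier B"
    show "bimap R A' B' A'' B'' f' g' (bimap R A B A' B' f g (pure_tensor R A B x y)) =
      bimap R A B A'' B'' (\<lambda>x. f' (f x)) (\<lambda>y. g' (g y)) (pure_tensor R A B x y)"
      unfolding bimap_pure[OF AB(1,2) f(1) g(1) *] bimap_pure[OF AB(1,3) ff gg *]
      by (intro bimap_pure[OF AB(2,3) f(2) g(2)] lin_homD(1)[OF f(1)] lin_homD(1)[OF g(1)] *)
  qed
qed

lemma bimap_zero:
  assumes AB: "tensor_pair R A B" "tensor_pair R A' B'"
    and f: "f \<in> left_module_hom (opposite R) A A'" and g: "g \<in> left_module_hom R B B'"
    and zero: "(\<forall>x\<in>carrier A. f x = \<zero>\<^bsub>A'\<^esub>) \<or> (\<forall>y\<in>carrier B. g y = \<zero>\<^bsub>B'\<^esub>)"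
    and t: "t \<in> carrier (tensor R A B)"
  shows "bimap R A B A' B' f g t = \<one>\<^bsub>tensor R A' B'\<^esub>"
proof -
  interpret AB: tensor_pair R A B by fact
  interpret AB': tensor_pair R A' B' by fact
  have "(\<lambda>_. \<one>\<^bsub>tensor R A' B'\<^esub>) \<in> hom (tensor R A B) (tensor R A' B')"
    by (auto simp: hom_def)
  then show ?thesis
    using zero lin_homD(1)[OF f] lin_homD(1)[OF g]
    by (intro AB.tensor_hom_eqI[OF bimap_hom[OF AB f g] _ t]) (auto simp: bimap_pure[OF AB f g])
qed

lemma bimap_surj:
  assumes AB: "tensor_pair R A B" "tensor_pair R A' B'"
    and f: "f \<in> left_module_hom (opposite R) A A'" and g: "g \<in> left_module_hom R B B'"
    and surj: "carrier A' \<subseteq> f ` carrier A" "carrier B' \<subseteq> g ` carrier B"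
    and t: "t \<in> carrier (tensor R A' B')"
  shows "t \<in> bimap R A B A' B' f g ` carrier (tensor R A B)"
proof -
  interpret AB: tensor_pair R A B by fact
  interpret AB': tensor_pair R A' B' by fact
  show ?thesis using t
  proof (induction rule: AB'.tensor_induct)
    case (pure x y)
    then obtain x' y' where "x' \<in> carrier A" "f x' = x" "y' \<in> carrier B" "g y' = y"
      using surj by blast
    then have "pure_tensor R A' B' x y = bimap R A B A' B' f g (pure_tensor R A B x' y')"
      using bimap_pure[OF AB f g, of x' y'] by simp
    moreover have "pure_tensor R A B x' y' \<in> carrier (tensor R A B)"
      using \<open>x' \<in> carrier A\<close> \<open>y' \<in> carrier B\<close> by simp
    ultimately show ?case by blast
  next
    case (mult s t)
    then obtain s' t' where *: "s' \<in> carrier (tensor R A B)" "s = bimap R A B A' B' f g s'"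
      "t' \<in> carrier (tensor R A B)" "t = bimap R A B A' B' f g t'" by blast
    have "s \<otimes>\<^bsub>tensor R A' B'\<^esub> t = bimap R A B A' B' f g (s' \<otimes>\<^bsub>tensor R A B\<^esub> t')"
      using hom_mult[OF bimap_hom[OF AB f g] *(1,3)] *(2,4) by simp
    then show ?case using AB.T.m_closed[OF *(1,3)] by blast
  qed
qed

lemma tensor_map_eq_bimap:
  assumes AB: "tensor_pair R A B" "tensor_pair R A' B"
    and f: "f \<in> left_module_hom (opposite R) A A'" and t: "t \<in> carrier (tensor R A B)"
  shows "tensor_map R A' B f t = bimap R A B A' B f (\<lambda>y. y) t"
proof -
  interpret AB: tensor_pair R A B by fact
  note id = lin_hom_id[of R B]
  show ?thesis
    by (rule AB.tensor_hom_eqI[OF tensor_map_hom[OF AB f] bimap_hom[OF AB f id] t])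
      (simp add: tensor_map_pure[OF AB f] bimap_pure[OF AB f id])
qed

lemma tensor_lepoll:
  assumes "tensor_pair R A B" and inf: "infinite (UNIV :: 'u set)"
    and "carrier A \<lesssim> (UNIV :: 'u set)" "carrier B \<lesssim> (UNIV :: 'u set)"
  shows "carrier (tensor R A B) \<lesssim> (UNIV :: 'u set)"
proof -
  interpret AB: tensor_pair R A B by fact
  let ?X = "carrier A \<times> carrier B"
  have "(UNIV :: int set) \<lesssim> (UNIV :: nat set)"
    using countableI_type[where 'a = int] by (auto simp: countable_def lepoll_def)
  also have "\<dots> \<lesssim> (UNIV :: 'u set)" using inf by (simp add: infinite_le_lepoll)
  finally have int: "(UNIV :: int set) \<lesssim> (UNIV :: 'u set)" .
  have "carrier (tensor R A B) \<lesssim> carrier (free_Abelian_group ?X)"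
    unfolding tensor_def carrier_FactGroup by (rule image_lepoll)
  also have "\<dots> \<lesssim> {f :: _ \<Rightarrow> int. f ` ?X \<subseteq> UNIV \<and> {x. f x \<noteq> 0} \<subseteq> ?X \<and> finite {x. f x \<noteq> 0}}"
    unfolding lepoll_def
    by (rule exI[of _ Poly_Mapping.lookup])
      (auto simp: poly_mapping_eqI lookup_not_eq_zero_eq_in_keys intro!: inj_onI)
  also have "\<dots> \<lesssim> Fpow (?X \<times> (UNIV :: int set))" by (rule lepoll_restricted_funspace)
  also have "\<dots> \<lesssim> (UNIV :: 'u set)"
    by (intro Fpow_lepoll_UNIV lepoll_times_UNIV inf assms int)
  finally show ?thesis .
qed


subsection \<open>Scalars\<close>

text \<open>The tensor product as a module, for scalars that act through one of the factors.\<close>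

definition tensor_module ::
  "('a, 'k) ring_scheme \<Rightarrow> ('a, 'p) module \<Rightarrow> ('a, 'q) module \<Rightarrow>
   ('s \<Rightarrow> ('p \<times> 'q \<Rightarrow>\<^sub>0 int) set \<Rightarrow> ('p \<times> 'q \<Rightarrow>\<^sub>0 int) set) \<Rightarrow>
   ('s, ('p \<times> 'q \<Rightarrow>\<^sub>0 int) set) module" where
  "tensor_module R A B act = \<lparr>carrier = carrier (tensor R A B), monoid.mult = undefined, one = undefined,
     ring.zero = \<one>\<^bsub>tensor R A B\<^esub>, ring.add = monoid.mult (tensor R A B), smult = act\<rparr>"

lemma tensor_module_simps [simp]:
  "carrier (tensor_module R A B act) = carrier (tensor R A B)"
  "\<zero>\<^bsub>tensor_module R A B act\<^esub> = \<one>\<^bsub>tensor R A B\<^esub>"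
  "x \<oplus>\<^bsub>tensor_module R A B act\<^esub> y = x \<otimes>\<^bsub>tensor R A B\<^esub> y"
  "s \<odot>\<^bsub>tensor_module R A B act\<^esub> x = act s x"
  by (simp_all add: tensor_module_def)

lemma a_inv_tensor_module [simp]: "\<ominus>\<^bsub>tensor_module R A B act\<^esub> x = inv\<^bsub>tensor R A B\<^esub> x"
  by (simp add: a_inv_def m_inv_def)

lemma abelian_group_tensor_module:
  assumes "tensor_pair R A B" shows "abelian_group (tensor_module R A B act)"
proof -
  interpret AB: tensor_pair R A B by fact
  show ?thesis
    by (rule abelian_groupI) (auto simp: AB.T.m_ac intro: AB.T.l_inv_ex)
qed

lemma left_module_tensor:
  fixes K (structure)
  assumes AB: "tensor_pair R A B" and K: "ring K"
    and act: "\<And>s. s \<in> carrier K \<Longrightarrow> act s \<in> hom (tensor R A B) (tensor R A B)"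
    and add: "\<And>s t x y. \<lbrakk>s \<in> carrier K; t \<in> carrier K; x \<in> carrier A; y \<in> carrier B\<rbrakk> \<Longrightarrow>
      act (s \<oplus> t) (pure_tensor R A B x y) =
        act s (pure_tensor R A B x y) \<otimes>\<^bsub>tensor R A B\<^esub> act t (pure_tensor R A B x y)"
    and mult: "\<And>s t x y. \<lbrakk>s \<in> carrier K; t \<in> carrier K; x \<in> carrier A; y \<in> carrier B\<rbrakk> \<Longrightarrow>
      act (s \<otimes> t) (pure_tensor R A B x y) = act s (act t (pure_tensor R A B x y))"
    and one: "\<And>x y. \<lbrakk>x \<in> carrier A; y \<in> carrier B\<rbrakk> \<Longrightarrow>
      act \<one> (pure_tensor R A B x y) = pure_tensor R A B x y"
  shows "left_module K (tensor_module R A B act)"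
proof -
  interpret AB: tensor_pair R A B by fact
  interpret K: ring K by fact
  let ?T = "tensor R A B" and ?M = "tensor_module R A B act"
  note cl = hom_in_carrier[OF act] and mu = hom_mult[OF act]
  have "abelian_group ?M" by (rule abelian_group_tensor_module[OF AB])
  moreover have "act (s \<oplus> t) x = act s x \<otimes>\<^bsub>?T\<^esub> act t x"
    if "x \<in> carrier ?T" "s \<in> carrier K" "t \<in> carrier K" for s t x
    using that
  proof (induction rule: AB.tensor_induct)
    case (mult x y)
    then have "act s x \<otimes>\<^bsub>?T\<^esub> act t x \<otimes>\<^bsub>?T\<^esub> (act s y \<otimes>\<^bsub>?T\<^esub> act t y) =
      act s x \<otimes>\<^bsub>?T\<^esub> act s y \<otimes>\<^bsub>?T\<^esub> (act t x \<otimes>\<^bsub>?T\<^esub> act t y)"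
      by (simp add: cl AB.T.m_ac)
    with mult show ?case by (simp add: mu)
  qed (rule add)
  moreover have "act (s \<otimes> t) x = act s (act t x)"
    if "x \<in> carrier ?T" "s \<in> carrier K" "t \<in> carrier K" for s t x
    using that by (induction rule: AB.tensor_induct) (simp_all add: mult mu cl)
  moreover have "act \<one> x = x" if "x \<in> carrier ?T" for x
    using that by (induction rule: AB.tensor_induct) (simp_all add: one mu)
  ultimately show ?thesis
    by (intro left_module.intro left_module_axioms.intro K) (simp_all add: cl mu)
qed

lemma left_module_tensor_left:
  fixes K (structure)
  assumes AB: "tensor_pair R A B" and K: "ring K"
    and l: "\<And>s. s \<in> carrier K \<Longrightarrow> l s \<in> left_module_hom (opposite R) A A"
    and add: "\<And>s t x. \<lbrakk>s \<in> carrier K; t \<in> carrier K; x \<in> carrier A\<rbrakk> \<Longrightarrow> l (s \<oplus> t) x = l s x \<oplus>\<^bsub>A\<^esub> l t x"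
    and mult: "\<And>s t x. \<lbrakk>s \<in> carrier K; t \<in> carrier K; x \<in> carrier A\<rbrakk> \<Longrightarrow> l (s \<otimes> t) x = l s (l t x)"
    and one: "\<And>x. x \<in> carrier A \<Longrightarrow> l \<one> x = x"
  shows "left_module K (tensor_module R A B (\<lambda>s. bimap R A B A B (l s) (\<lambda>y. y)))"
proof -
  interpret AB: tensor_pair R A B by fact
  interpret K: ring K by fact
  note id = lin_hom_id[of R B]
  note b = bimap_hom[OF AB AB l id] bimap_pure[OF AB AB l id]
  note cl = lin_homD(1)[OF l]
  show ?thesis
    by (rule left_module_tensor[OF AB K])
      (simp_all add: b cl add mult one AB.pure_tensor_add_left)
qed

lemma left_module_tensor_right:
  fixes K (structure)
  assumes AB: "tensor_pair R A B" and K: "ring K"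
    and l: "\<And>s. s \<in> carrier K \<Longrightarrow> l s \<in> left_module_hom R B B"
    and add: "\<And>s t x. \<lbrakk>s \<in> carrier K; t \<in> carrier K; x \<in> carrier B\<rbrakk> \<Longrightarrow> l (s \<oplus> t) x = l s x \<oplus>\<^bsub>B\<^esub> l t x"
    and mult: "\<And>s t x. \<lbrakk>s \<in> carrier K; t \<in> carrier K; x \<in> carrier B\<rbrakk> \<Longrightarrow> l (s \<otimes> t) x = l s (l t x)"
    and one: "\<And>x. x \<in> carrier B \<Longrightarrow> l \<one> x = x"
  shows "left_module K (tensor_module R A B (\<lambda>s. bimap R A B A B (\<lambda>x. x) (l s)))"
proof -
  interpret AB: tensor_pair R A B by fact
  interpret K: ring K by fact
  note id = lin_hom_id[of "opposite R" A]
  note b = bimap_hom[OF AB AB id l] bimap_pure[OF AB AB id l]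
  note cl = lin_homD(1)[OF l]
  show ?thesis
    by (rule left_module_tensor[OF AB K])
      (simp_all add: b cl add mult one AB.pure_tensor_add_right)
qed


section \<open>Epimorphisms\<close>

definition transport_ring :: "('m \<Rightarrow> 'n) \<Rightarrow> ('m, 'k) ring_scheme \<Rightarrow> 'n ring" where
  "transport_ring f R = (let g = inv_into (carrier R) f in
     \<lparr>carrier = f ` carrier R, monoid.mult = (\<lambda>x y. f (g x \<otimes>\<^bsub>R\<^esub> g y)), one = f \<one>\<^bsub>R\<^esub>,
      ring.zero = f \<zero>\<^bsub>R\<^esub>, ring.add = (\<lambda>x y. f (g x \<oplus>\<^bsub>R\<^esub> g y))\<rparr>)"

lemma transport_ring_simps:
  assumes "inj_on f (carrier R)"
  shows "carrier (transport_ring f R) = f ` carrier R"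
    and "\<zero>\<^bsub>transport_ring f R\<^esub> = f \<zero>\<^bsub>R\<^esub>" and "\<one>\<^bsub>transport_ring f R\<^esub> = f \<one>\<^bsub>R\<^esub>"
    and "\<lbrakk>x \<in> carrier R; y \<in> carrier R\<rbrakk> \<Longrightarrow> f x \<oplus>\<^bsub>transport_ring f R\<^esub> f y = f (x \<oplus>\<^bsub>R\<^esub> y)"
    and "\<lbrakk>x \<in> carrier R; y \<in> carrier R\<rbrakk> \<Longrightarrow> f x \<otimes>\<^bsub>transport_ring f R\<^esub> f y = f (x \<otimes>\<^bsub>R\<^esub> y)"
  using assms by (simp_all add: transport_ring_def Let_def)

lemma ring_transport:
  assumes "ring R" "inj_on f (carrier R)"
  shows "ring (transport_ring f R)"
proof -
  interpret ring R by fact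
  note [simp] = transport_ring_simps[OF assms(2)]
  have "\<exists>y\<in>carrier R. f (y \<oplus>\<^bsub>R\<^esub> x) = f \<zero>\<^bsub>R\<^esub>" if "x \<in> carrier R" for x
    using that by (intro bexI[where x = "\<ominus>\<^bsub>R\<^esub> x"]) (auto simp: l_neg)
  then have "abelian_group (transport_ring f R)"
    by (intro abelian_groupI) (auto simp: a_assoc, metis a_comm)
  moreover have "monoid (transport_ring f R)"
    by (rule monoidI) (auto simp: m_assoc)
  ultimately show ?thesis
    by (rule ringI) (auto simp: l_distr r_distr)
qed

lemma transport_ring_hom: "inj_on f (carrier R) \<Longrightarrow> f \<in> ring_hom R (transport_ring f R)"
  by (auto simp: ring_hom_def transport_ring_simps)

text \<open>The square-zero extension of \<open>S\<close> by a bimodule, which is given as a left module \<open>L\<close> and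
  a right module \<open>N\<close> on the same abelian group.\<close>

definition trivial_extension ::
  "('b, 'l) ring_scheme \<Rightarrow> ('b, 'x) module \<Rightarrow> ('b, 'x) module \<Rightarrow> ('b \<times> 'x) ring" where
  "trivial_extension S L N = \<lparr>carrier = carrier S \<times> carrier L,
     monoid.mult = (\<lambda>(s, x) (t, y). (s \<otimes>\<^bsub>S\<^esub> t, s \<odot>\<^bsub>L\<^esub> y \<oplus>\<^bsub>L\<^esub> t \<odot>\<^bsub>N\<^esub> x)), one = (\<one>\<^bsub>S\<^esub>, \<zero>\<^bsub>L\<^esub>),
     ring.zero = (\<zero>\<^bsub>S\<^esub>, \<zero>\<^bsub>L\<^esub>), ring.add = (\<lambda>(s, x) (t, y). (s \<oplus>\<^bsub>S\<^esub> t, x \<oplus>\<^bsub>L\<^esub> y))\<rparr>"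

lemma ring_trivial_extension:
  fixes S :: "('b, 'l) ring_scheme" and L N :: "('b, 'x) module"
  assumes L: "left_module S L" and N: "left_module (opposite S) N"
    and same: "carrier N = carrier L" "\<zero>\<^bsub>N\<^esub> = \<zero>\<^bsub>L\<^esub>" "\<And>x y. x \<oplus>\<^bsub>N\<^esub> y = x \<oplus>\<^bsub>L\<^esub> y"
    and comm: "\<And>s t x. \<lbrakk>s \<in> carrier S; t \<in> carrier S; x \<in> carrier L\<rbrakk> \<Longrightarrow>
      t \<odot>\<^bsub>N\<^esub> (s \<odot>\<^bsub>L\<^esub> x) = s \<odot>\<^bsub>L\<^esub> (t \<odot>\<^bsub>N\<^esub> x)"
  shows "ring (trivial_extension S L N)"
proof -
  interpret L: left_module S L by fact
  interpret N: left_module "opposite S" N by fact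
  let ?E = "trivial_extension S L N"
  note N' = N.smult_closed[simplified same carrier_opposite] N.smult_l_distr[simplified same, simplified]
    N.smult_r_distr[simplified same, simplified] N.smult_assoc[simplified same, simplified]
    N.smult_one[simplified same, simplified] N.smult_l_null[simplified same, simplified]
    N.smult_r_null[simplified same, simplified]
  have "abelian_group ?E"
  proof (rule abelian_groupI)
    fix z assume "z \<in> carrier ?E"
    then show "\<exists>y\<in>carrier ?E. y \<oplus>\<^bsub>?E\<^esub> z = \<zero>\<^bsub>?E\<^esub>"
      by (intro bexI[where x = "(\<ominus>\<^bsub>S\<^esub> fst z, \<ominus>\<^bsub>L\<^esub> snd z)"])
        (auto simp: trivial_extension_def L.R.l_neg L.M.l_neg)
  qed (auto simp: trivial_extension_def L.R.a_ac L.M.a_ac)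
  moreover have "monoid ?E"
    by (rule monoidI)
      (auto simp: trivial_extension_def N' L.R.m_assoc L.smult_r_distr L.smult_assoc L.M.a_assoc comm)
  moreover have distr: "a \<oplus>\<^bsub>L\<^esub> b \<oplus>\<^bsub>L\<^esub> (c \<oplus>\<^bsub>L\<^esub> d) = a \<oplus>\<^bsub>L\<^esub> c \<oplus>\<^bsub>L\<^esub> (b \<oplus>\<^bsub>L\<^esub> d)"
    if "a \<in> carrier L" "b \<in> carrier L" "c \<in> carrier L" "d \<in> carrier L" for a b c d
    using that by (simp add: L.M.a_ac)
  ultimately show ?thesis
    by (intro ringI)
      (auto simp: trivial_extension_def N' L.R.l_distr L.R.r_distr L.smult_l_distr L.smult_r_distr distr)
qed

text \<open>A derivation \<open>D\<close> from \<open>S\<close> to a bimodule gives the homomorphism \<open>s \<mapsto> (s, D s)\<close> into the trivial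
  extension. If \<open>D\<close> vanishes on the image of \<open>\<phi>\<close>, then this agrees on that image with \<open>s \<mapsto> (s, 0)\<close>,
  so the two are equal.\<close>

lemma ring_epi_derivation:
  fixes R :: "('a, 'k) ring_scheme" and S :: "('b, 'l) ring_scheme" and L N :: "('b, 'x) module"
  assumes epi: "ring_epi TYPE('u) R S \<phi>"
    and inf: "infinite (UNIV :: 'u set)" and "carrier S \<lesssim> (UNIV :: 'u set)" "carrier L \<lesssim> (UNIV :: 'u set)"
    and L: "left_module S L" and N: "left_module (opposite S) N"
    and same: "carrier N = carrier L" "\<zero>\<^bsub>N\<^esub> = \<zero>\<^bsub>L\<^esub>" "\<And>x y. x \<oplus>\<^bsub>N\<^esub> y = x \<oplus>\<^bsub>L\<^esub> y"
    and comm: "\<And>s t x. \<lbrakk>s \<in> carrier S; t \<in> carrier S; x \<in> carrier L\<rbrakk> \<Longrightarrow>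
      t \<odot>\<^bsub>N\<^esub> (s \<odot>\<^bsub>L\<^esub> x) = s \<odot>\<^bsub>L\<^esub> (t \<odot>\<^bsub>N\<^esub> x)"
    and D_closed: "\<And>s. s \<in> carrier S \<Longrightarrow> D s \<in> carrier L"
    and D_add: "\<And>s t. \<lbrakk>s \<in> carrier S; t \<in> carrier S\<rbrakk> \<Longrightarrow> D (s \<oplus>\<^bsub>S\<^esub> t) = D s \<oplus>\<^bsub>L\<^esub> D t"
    and D_mult: "\<And>s t. \<lbrakk>s \<in> carrier S; t \<in> carrier S\<rbrakk> \<Longrightarrow>
      D (s \<otimes>\<^bsub>S\<^esub> t) = s \<odot>\<^bsub>L\<^esub> D t \<oplus>\<^bsub>L\<^esub> t \<odot>\<^bsub>N\<^esub> D s"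
    and D_one: "D \<one>\<^bsub>S\<^esub> = \<zero>\<^bsub>L\<^esub>"
    and D_\<phi>: "\<And>r. r \<in> carrier R \<Longrightarrow> D (\<phi> r) = \<zero>\<^bsub>L\<^esub>"
    and s: "s \<in> carrier S"
  shows "D s = \<zero>\<^bsub>L\<^esub>"
proof -
  interpret L: left_module S L by fact
  interpret N: left_module "opposite S" N by fact
  let ?E = "trivial_extension S L N"
  have E: "ring ?E" using L N same comm by (rule ring_trivial_extension)
  have "carrier ?E \<lesssim> (UNIV :: 'u set)"
    using assms by (simp add: trivial_extension_def lepoll_times_UNIV)
  then obtain f :: "_ \<Rightarrow> 'u" where f: "inj_on f (carrier ?E)" by (rule lepoll_ex_inj)
  have N_zero: "t \<odot>\<^bsub>N\<^esub> \<zero>\<^bsub>L\<^esub> = \<zero>\<^bsub>L\<^esub>" if "t \<in> carrier S" for t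
    using N.smult_r_null[of t] that same by simp
  have g: "(\<lambda>s. (s, \<zero>\<^bsub>L\<^esub>)) \<in> ring_hom S ?E"
    by (auto simp: ring_hom_def trivial_extension_def N_zero)
  have h: "(\<lambda>s. (s, D s)) \<in> ring_hom S ?E"
    by (auto simp: ring_hom_def trivial_extension_def D_closed D_add D_mult D_one)
  have comp: "(\<lambda>s. f (k s)) \<in> ring_hom S (transport_ring f ?E)" if "k \<in> ring_hom S ?E" for k
    using ring_hom_trans[OF that transport_ring_hom[OF f]] by (simp add: comp_def)
  have \<phi>: "\<phi> r \<in> carrier S" if "r \<in> carrier R" for r
    using epi that by (auto simp: ring_epi_def ring_hom_def)
  have "\<forall>g\<in>ring_hom S (transport_ring f ?E). \<forall>h\<in>ring_hom S (transport_ring f ?E).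
      (\<forall>x\<in>carrier R. g (\<phi> x) = h (\<phi> x)) \<longrightarrow> (\<forall>y\<in>carrier S. g y = h y)"
    using epi ring_transport[OF E f] unfolding ring_epi_def by blast
  from bspec[OF bspec[OF this comp[OF g]] comp[OF h]]
  have "f (s, \<zero>\<^bsub>L\<^esub>) = f (s, D s)" using s by (simp add: D_\<phi>)
  then have "(s, \<zero>\<^bsub>L\<^esub>) = (s, D s)"
    using f s D_closed by (auto simp: inj_on_def trivial_extension_def)
  then show ?thesis by simp
qed


section \<open>Stably flat epimorphisms\<close>

locale ring_map =
  fixes R :: "('a, 'k) ring_scheme" and S :: "('b, 'l) ring_scheme" and \<phi> :: "'a \<Rightarrow> 'b"
  assumes R: "ring R" and S: "ring S" and \<phi>: "\<phi> \<in> ring_hom R S"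
begin

sublocale R: ring R by (rule R)
sublocale S: ring S by (rule S)

abbreviation res :: "('b, 'm) module \<Rightarrow> ('a, 'm) module" where "res M \<equiv> restrict_scalars \<phi> M"
abbreviation SR :: "('a, 'b) module" where "SR \<equiv> res (regular_module (opposite S))"
abbreviation SL :: "('a, 'b) module" where "SL \<equiv> res (regular_module S)"

lemma \<phi>_closed [simp, intro]: "r \<in> carrier R \<Longrightarrow> \<phi> r \<in> carrier S"
  and \<phi>_add: "\<lbrakk>r \<in> carrier R; r' \<in> carrier R\<rbrakk> \<Longrightarrow> \<phi> (r \<oplus>\<^bsub>R\<^esub> r') = \<phi> r \<oplus>\<^bsub>S\<^esub> \<phi> r'"
  and \<phi>_mult: "\<lbrakk>r \<in> carrier R; r' \<in> carrier R\<rbrakk> \<Longrightarrow> \<phi> (r \<otimes>\<^bsub>R\<^esub> r') = \<phi> r \<otimes>\<^bsub>S\<^esub> \<phi> r'"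
  and \<phi>_one [simp]: "\<phi> \<one>\<^bsub>R\<^esub> = \<one>\<^bsub>S\<^esub>"
  using \<phi> by (auto simp: ring_hom_def)

lemma left_module_SR: "left_module (opposite R) SR"
  by (intro left_module_restrict_scalars[where S = "opposite S"] ring_opposite left_module_regular
      ring_hom_opposite R S \<phi>)

lemma left_module_SL: "left_module R SL"
  by (intro left_module_restrict_scalars[where S = S] left_module_regular R S \<phi>)

lemma left_module_restrict: "left_module S M \<Longrightarrow> left_module R (res M)"
  by (rule left_module_restrict_scalars[OF R \<phi>])

lemma SL_smult_hom: "t \<in> carrier S \<Longrightarrow> (\<lambda>y. y \<otimes>\<^bsub>S\<^esub> t) \<in> left_module_hom R SL SL"
  by (rule lin_homI) (auto simp: S.l_distr S.m_assoc)

lemma SR_smult_hom: "s \<in> carrier S \<Longrightarrow> (\<lambda>x. s \<otimes>\<^bsub>S\<^esub> x) \<in> left_module_hom (opposite R) SR SR"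
  by (rule lin_homI) (auto simp: S.r_distr S.m_assoc)

lemma orbit_hom:
  assumes "left_module S M" "m \<in> carrier M"
  shows "(\<lambda>s. s \<odot>\<^bsub>M\<^esub> m) \<in> left_module_hom R SL (res M)"
proof -
  interpret M: left_module S M by fact
  show ?thesis using assms(2)
    by (intro lin_homI) (auto simp: M.smult_l_distr M.smult_assoc)
qed

text \<open>The derivation \<open>s \<mapsto> s \<otimes> 1 - 1 \<otimes> s\<close> into the bimodule \<open>S \<otimes>\<^sub>R S\<close> vanishes on the image of \<open>R\<close>.\<close>

lemma ring_epi_tensor_swap:
  assumes epi: "ring_epi TYPE('u) R S \<phi>" and inf: "infinite (UNIV :: 'u set)"
    and cS: "carrier S \<lesssim> (UNIV :: 'u set)" and s: "s \<in> carrier S"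
  shows "pure_tensor R SR SL s \<one>\<^bsub>S\<^esub> = pure_tensor R SR SL \<one>\<^bsub>S\<^esub> s"
proof -
  have pair: "tensor_pair R SR SL" by (rule tensor_pairI[OF left_module_SR left_module_SL])
  interpret T: tensor_pair R SR SL by (rule pair)
  let ?T = "tensor R SR SL"
  let ?p = "pure_tensor R SR SL"
  let ?l = "\<lambda>s. bimap R SR SL SR SL (\<lambda>x. s \<otimes>\<^bsub>S\<^esub> x) (\<lambda>y. y)"
  let ?r = "\<lambda>t. bimap R SR SL SR SL (\<lambda>x. x) (\<lambda>y. y \<otimes>\<^bsub>S\<^esub> t)"
  note idR = lin_hom_id[of "opposite R" SR] and idL = lin_hom_id[of R SL]
  note l = bimap_hom[OF pair pair SR_smult_hom idL] bimap_pure[OF pair pair SR_smult_hom idL]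
  note r = bimap_hom[OF pair pair idR SL_smult_hom] bimap_pure[OF pair pair idR SL_smult_hom]
  let ?L = "tensor_module R SR SL ?l" and ?N = "tensor_module R SR SL ?r"
  have L: "left_module S ?L"
    by (rule left_module_tensor_left[OF pair S SR_smult_hom]) (auto simp: S.l_distr S.m_assoc)
  have N: "left_module (opposite S) ?N"
    by (rule left_module_tensor_right[OF pair ring_opposite[OF S]])
      (auto simp: S.r_distr S.m_assoc intro: SL_smult_hom)
  have comm: "?r t (?l s x) = ?l s (?r t x)"
    if "s \<in> carrier S" "t \<in> carrier S" "x \<in> carrier ?T" for s t x
    by (rule T.tensor_hom_eqI[OF hom_comp[OF l(1) r(1)] hom_comp[OF r(1) l(1)]])
      (simp_all add: l(2) r(2) that)
  define D where "D s = ?p s \<one>\<^bsub>S\<^esub> \<otimes>\<^bsub>?T\<^esub> inv\<^bsub>?T\<^esub> ?p \<one>\<^bsub>S\<^esub> s" for s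
  have pc [simp]: "?p a b \<in> carrier ?T" if "a \<in> carrier S" "b \<in> carrier S" for a b
    using that by simp
  have "D s = \<zero>\<^bsub>?L\<^esub>"
  proof (rule ring_epi_derivation[OF epi inf cS _ L N _ _ _ _ _ _ _ _ _ s])
    show "carrier ?L \<lesssim> (UNIV :: 'u set)"
      using tensor_lepoll[OF pair inf] cS by simp
  next
    fix s t assume st: "s \<in> carrier S" "t \<in> carrier S"
    have "?p (s \<oplus>\<^bsub>S\<^esub> t) \<one>\<^bsub>S\<^esub> = ?p s \<one>\<^bsub>S\<^esub> \<otimes>\<^bsub>?T\<^esub> ?p t \<one>\<^bsub>S\<^esub>"
      "?p \<one>\<^bsub>S\<^esub> (s \<oplus>\<^bsub>S\<^esub> t) = ?p \<one>\<^bsub>S\<^esub> s \<otimes>\<^bsub>?T\<^esub> ?p \<one>\<^bsub>S\<^esub> t"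
      using st T.pure_tensor_add_left[of s t "\<one>\<^bsub>S\<^esub>"] T.pure_tensor_add_right[of "\<one>\<^bsub>S\<^esub>" s t] by simp_all
    then show "D (s \<oplus>\<^bsub>S\<^esub> t) = D s \<oplus>\<^bsub>?L\<^esub> D t"
      using st by (simp add: D_def T.T.inv_mult T.T.m_ac)
    have "?l s (D t) = ?p (s \<otimes>\<^bsub>S\<^esub> t) \<one>\<^bsub>S\<^esub> \<otimes>\<^bsub>?T\<^esub> inv\<^bsub>?T\<^esub> ?p s t"
      using st unfolding D_def
      by (simp add: hom_mult[OF l(1)] comm_group_hom_inv[OF T.comm_group_T T.comm_group_T l(1)] l(2))
    moreover have "?r t (D s) = ?p s t \<otimes>\<^bsub>?T\<^esub> inv\<^bsub>?T\<^esub> ?p \<one>\<^bsub>S\<^esub> (s \<otimes>\<^bsub>S\<^esub> t)"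
      using st unfolding D_def
      by (simp add: hom_mult[OF r(1)] comm_group_hom_inv[OF T.comm_group_T T.comm_group_T r(1)] r(2))
    moreover have "a \<otimes>\<^bsub>?T\<^esub> inv\<^bsub>?T\<^esub> b \<otimes>\<^bsub>?T\<^esub> (b \<otimes>\<^bsub>?T\<^esub> inv\<^bsub>?T\<^esub> c) = a \<otimes>\<^bsub>?T\<^esub> inv\<^bsub>?T\<^esub> c"
      if "a \<in> carrier ?T" "b \<in> carrier ?T" "c \<in> carrier ?T" for a b c
      using that by (metis T.T.inv_closed T.T.l_inv T.T.l_one T.T.m_assoc T.T.m_closed)
    ultimately show "D (s \<otimes>\<^bsub>S\<^esub> t) = s \<odot>\<^bsub>?L\<^esub> D t \<oplus>\<^bsub>?L\<^esub> t \<odot>\<^bsub>?N\<^esub> D s"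
      using st by (simp add: D_def[of "s \<otimes>\<^bsub>S\<^esub> t"])
  next
    fix r assume "r \<in> carrier R"
    then have "?p (\<phi> r) \<one>\<^bsub>S\<^esub> = ?p \<one>\<^bsub>S\<^esub> (\<phi> r)"
      using T.pure_tensor_balance[of r "\<one>\<^bsub>S\<^esub>" "\<one>\<^bsub>S\<^esub>"] by simp
    then show "D (\<phi> r) = \<zero>\<^bsub>?L\<^esub>"
      using \<open>r \<in> carrier R\<close> by (simp add: D_def)
  qed (simp_all add: comm D_def)
  then show ?thesis
    using s unfolding D_def
    by simp (metis T.T.inv_closed T.T.inv_equality T.T.inv_inv pc S.one_closed)
qed

end

text \<open>The form in which the hypotheses enter: \<open>swap\<close> expresses that \<open>\<phi>\<close> is an epimorphism, and \<open>acyclic\<close>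
  that \<open>Tor\<^sub>i(S, S) = 0\<close> for \<open>i > 0\<close>, computed from the resolution \<open>P\<close> of the right module \<open>S\<close>.
  Both turn out to be inherited by the opposite rings, with a resolution of the left module \<open>S\<close>.\<close>

locale stably_flat_epi = ring_map R S \<phi>
  for R :: "('a, 'k) ring_scheme" and S :: "('b, 'l) ring_scheme" and \<phi> :: "'a \<Rightarrow> 'b" +
  fixes P :: "nat \<Rightarrow> ('a, 'u) module" and d :: "nat \<Rightarrow> 'u \<Rightarrow> 'u" and \<epsilon> :: "'u \<Rightarrow> 'b"
  assumes inf: "infinite (UNIV :: 'u set)"
    and cR: "carrier R \<lesssim> (UNIV :: 'u set)" and cS: "carrier S \<lesssim> (UNIV :: 'u set)"
    and swap: "\<And>s. s \<in> carrier S \<Longrightarrow> pure_tensor R SR SL s \<one>\<^bsub>S\<^esub> = pure_tensor R SR SL \<one>\<^bsub>S\<^esub> s"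
    and res: "projective_resolution (opposite R) SR P d \<epsilon>"
    and acyclic: "\<And>n t. \<lbrakk>t \<in> carrier (tensor R (P (Suc n)) SL);
        bimap R (P (Suc n)) SL (P n) SL (d n) (\<lambda>y. y) t = \<one>\<^bsub>tensor R (P n) SL\<^esub>\<rbrakk> \<Longrightarrow>
      t \<in> bimap R (P (Suc (Suc n))) SL (P (Suc n)) SL (d (Suc n)) (\<lambda>y. y) `
            carrier (tensor R (P (Suc (Suc n))) SL)"
begin

lemma proj_P: "projective (opposite R) (P n)"
  and d_hom: "d n \<in> left_module_hom (opposite R) (P (Suc n)) (P n)"
  and \<epsilon>_hom: "\<epsilon> \<in> left_module_hom (opposite R) (P 0) SR"
  and \<epsilon>_surj: "\<epsilon> ` carrier (P 0) = carrier S"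
  and d_0: "d 0 ` carrier (P 1) = {x \<in> carrier (P 0). \<epsilon> x = \<zero>\<^bsub>S\<^esub>}"
  and d_Suc: "d (Suc n) ` carrier (P (Suc (Suc n))) = {x \<in> carrier (P (Suc n)). d n x = \<zero>\<^bsub>P n\<^esub>}"
  using res by (auto simp: projective_resolution_def)

lemma \<epsilon>_d: "p \<in> carrier (P (Suc 0)) \<Longrightarrow> \<epsilon> (d 0 p) = \<zero>\<^bsub>S\<^esub>"
  using d_0 by auto

lemma d_d: "p \<in> carrier (P (Suc (Suc n))) \<Longrightarrow> d n (d (Suc n) p) = \<zero>\<^bsub>P n\<^esub>"
  using d_Suc by auto

lemma left_module_P: "left_module (opposite R) (P n)"
  using proj_P by (simp add: projective_def)

lemma pair: "left_module R B \<Longrightarrow> tensor_pair R (P n) B"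
  by (rule tensor_pairI[OF left_module_P])

lemma pairS: "left_module R B \<Longrightarrow> tensor_pair R SR B"
  by (rule tensor_pairI[OF left_module_SR])

abbreviation "PT n \<equiv> tensor R (P n) SL"
abbreviation "pureS n \<equiv> pure_tensor R (P n) SL"

text \<open>The right \<open>R\<close>-module \<open>P n \<otimes>\<^sub>R S\<close>, where \<open>R\<close> acts on the factor \<open>S\<close>.\<close>

definition PS :: "nat \<Rightarrow> ('a, ('u \<times> 'b \<Rightarrow>\<^sub>0 int) set) module" where
  "PS n = tensor_module R (P n) SL (\<lambda>r. bimap R (P n) SL (P n) SL (\<lambda>x. x) (\<lambda>s. s \<otimes>\<^bsub>S\<^esub> \<phi> r))"

abbreviation "dS n \<equiv> bimap R (P (Suc n)) SL (P n) SL (d n) (\<lambda>y. y)"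

lemma left_module_PS: "left_module (opposite R) (PS n)"
  unfolding PS_def
  by (rule left_module_tensor_right[OF pair[OF left_module_SL] ring_opposite[OF R]])
    (auto simp: \<phi>_add \<phi>_mult S.r_distr S.m_assoc intro: SL_smult_hom)

lemma PS_carrier [simp]: "carrier (PS n) = carrier (PT n)"
  and PS_zero [simp]: "\<zero>\<^bsub>PS n\<^esub> = \<one>\<^bsub>PT n\<^esub>"
  and PS_add [simp]: "x \<oplus>\<^bsub>PS n\<^esub> y = x \<otimes>\<^bsub>PT n\<^esub> y"
  and PS_minus [simp]: "\<ominus>\<^bsub>PS n\<^esub> x = inv\<^bsub>PT n\<^esub> x"
  by (simp_all add: PS_def)

lemma
  assumes "r \<in> carrier R"
  shows PS_smult_hom: "(\<lambda>t. r \<odot>\<^bsub>PS n\<^esub> t) \<in> hom (PT n) (PT n)"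
    and PS_smult_pure: "\<lbrakk>p \<in> carrier (P n); s \<in> carrier S\<rbrakk> \<Longrightarrow>
      r \<odot>\<^bsub>PS n\<^esub> pureS n p s = pureS n p (s \<otimes>\<^bsub>S\<^esub> \<phi> r)"
  using bimap_hom[OF pair[OF left_module_SL] pair[OF left_module_SL] lin_hom_id SL_smult_hom]
    bimap_pure[OF pair[OF left_module_SL] pair[OF left_module_SL] lin_hom_id SL_smult_hom] assms
  by (simp_all add: PS_def)

lemmas dS_hom = bimap_hom[OF pair[OF left_module_SL] pair[OF left_module_SL] d_hom lin_hom_id]
lemmas dS_pure = bimap_pure[OF pair[OF left_module_SL] pair[OF left_module_SL] d_hom lin_hom_id]

lemma dS_linear: "dS n \<in> left_module_hom (opposite R) (PS (Suc n)) (PS n)"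
proof (rule lin_homI)
  fix t r assume t: "t \<in> carrier (PS (Suc n))" and r: "r \<in> carrier (opposite R)"
  interpret T: tensor_pair R "P (Suc n)" SL by (rule pair[OF left_module_SL])
  have r': "r \<in> carrier R" and t': "t \<in> carrier (PT (Suc n))" using r t by simp_all
  show "dS n (r \<odot>\<^bsub>PS (Suc n)\<^esub> t) = r \<odot>\<^bsub>PS n\<^esub> dS n t"
  proof (rule T.tensor_hom_eqI[OF hom_comp[OF PS_smult_hom[OF r'] dS_hom] hom_comp[OF dS_hom PS_smult_hom[OF r']] t'])
    fix p s assume "p \<in> carrier (P (Suc n))" "s \<in> carrier SL"
    then show "dS n (r \<odot>\<^bsub>PS (Suc n)\<^esub> pureS (Suc n) p s) =
        r \<odot>\<^bsub>PS n\<^esub> dS n (pureS (Suc n) p s)"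
      using r' lin_homD(1)[OF d_hom] by (simp add: PS_smult_pure dS_pure)
  qed
qed (simp_all add: hom_in_carrier[OF dS_hom] hom_mult[OF dS_hom])

lemma pure_one_linear: "(\<lambda>p. pureS n p \<one>\<^bsub>S\<^esub>) \<in> left_module_hom (opposite R) (P n) (PS n)"
proof -
  interpret T: tensor_pair R "P n" SL by (rule pair[OF left_module_SL])
  show ?thesis
    by (rule lin_homI)
      (simp_all add: T.pure_tensor_add_left T.pure_tensor_balance PS_smult_pure)
qed

text \<open>The complex of the \<open>P n \<otimes>\<^sub>R S\<close>, augmented by \<open>S \<otimes>\<^sub>R S = S\<close>, is exact and consists of projective
  right \<open>S\<close>-modules, so it is contractible. A map of right \<open>S\<close>-modules from \<open>P n \<otimes>\<^sub>R S\<close> is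
  the same as a map of right \<open>R\<close>-modules from \<open>P n\<close>, and \<open>h\<close> is the contracting homotopy in the
  latter form. It is built recursively by lifting \<open>p \<mapsto> p \<otimes> 1 - h n (d n p)\<close>, whose values are
  cycles and hence boundaries.\<close>

lemma contraction_exists:
  obtains h where "\<And>n. h n \<in> left_module_hom (opposite R) (P n) (PS (Suc n))"
    and "\<And>n p. p \<in> carrier (P (Suc n)) \<Longrightarrow> dS (Suc n) (h (Suc n) p) \<otimes>\<^bsub>PT (Suc n)\<^esub> h n (d n p) =
      pureS (Suc n) p \<one>\<^bsub>S\<^esub>"
proof -
  have cR': "carrier (opposite R) \<lesssim> (UNIV :: 'u set)" using cR by simp
  \<comment> \<open>\<open>cyc n\<close> describes the cycles of \<open>P\<close> in degree \<open>n\<close>. On them the second term of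
    the homotopy equation vanishes; what remains of it is the invariant of the recursion.\<close>
  define cyc where "cyc n p \<longleftrightarrow> (case n of 0 \<Rightarrow> \<epsilon> p = \<zero>\<^bsub>S\<^esub> | Suc m \<Rightarrow> d m p = \<zero>\<^bsub>P m\<^esub>)" for n p
  have cyc_d: "cyc n (d n p)" if "p \<in> carrier (P (Suc n))" for n p
    using that by (cases n) (simp_all add: cyc_def \<epsilon>_d d_d)
  define good where "good n h \<longleftrightarrow> h \<in> left_module_hom (opposite R) (P n) (PS (Suc n)) \<and>
    (\<forall>p\<in>carrier (P n). cyc n p \<longrightarrow> dS n (h p) = pureS n p \<one>\<^bsub>S\<^esub>)" for n h
  have "\<exists>h. \<forall>n. good n (h n) \<and> (\<forall>p\<in>carrier (P (Suc n)).
      dS (Suc n) (h (Suc n) p) =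
        pureS (Suc n) p \<one>\<^bsub>S\<^esub> \<otimes>\<^bsub>PT (Suc n)\<^esub> inv\<^bsub>PT (Suc n)\<^esub> h n (d n p))"
  proof (rule dependent_nat_choice)
    interpret T: tensor_pair R "P 0" SL by (rule pair[OF left_module_SL])
    interpret TS: tensor_pair R SR SL by (rule pairS[OF left_module_SL])
    let ?T = "PT 0"
    obtain e where e: "e \<in> carrier (P 0)" "\<epsilon> e = \<one>\<^bsub>S\<^esub>" using \<epsilon>_surj S.one_closed by (metis imageE)
    note \<epsilon>' = lin_homD[OF \<epsilon>_hom, simplified]
    have "(\<lambda>p. pureS 0 e (\<epsilon> p)) \<in> left_module_hom (opposite R) (P 0) (PS 0)"
      by (rule lin_homI) (simp_all add: e \<epsilon>' T.pure_tensor_add_right[simplified] PS_smult_pure)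
    \<comment> \<open>In degree \<open>0\<close> the homotopy on the augmentation is \<open>s \<mapsto> e \<otimes> s\<close>. The difference
      \<open>p \<otimes> 1 - e \<otimes> \<epsilon> p\<close> becomes \<open>\<epsilon> p \<otimes> 1 - 1 \<otimes> \<epsilon> p = 0\<close> in \<open>S \<otimes>\<^sub>R S\<close>.\<close>
    from lin_hom_diff[OF left_module_PS pure_one_linear this]
    have k: "(\<lambda>p. pureS 0 p \<one>\<^bsub>S\<^esub> \<otimes>\<^bsub>?T\<^esub> inv\<^bsub>?T\<^esub> pureS 0 e (\<epsilon> p))
        \<in> left_module_hom (opposite R) (P 0) (PS 0)" (is "?k \<in> _")
      by simp
    note idL = lin_hom_id[of R SL]
    note b = bimap_hom[OF pair[OF left_module_SL] pairS[OF left_module_SL] \<epsilon>_hom idL]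
      bimap_pure[OF pair[OF left_module_SL] pairS[OF left_module_SL] \<epsilon>_hom idL]
    have "?k p \<in> dS 0 ` carrier (PS 1)" if p: "p \<in> carrier (P 0)" for p
      unfolding PS_carrier One_nat_def
    proof (rule tensor_right_exact[OF left_module_P left_module_P left_module_SR left_module_SL d_hom \<epsilon>_hom])
      show "\<epsilon> ` carrier (P 0) = carrier SR" using \<epsilon>_surj by simp
      show "x \<in> d 0 ` carrier (P (Suc 0))" if "x \<in> carrier (P 0)" "\<epsilon> x = \<zero>\<^bsub>SR\<^esub>" for x
        using that d_0 by auto
      show "?k p \<in> carrier ?T" using lin_homD(1)[OF k p] by simp
      have "bimap R (P 0) SL SR SL \<epsilon> (\<lambda>y. y) (?k p) =
          pure_tensor R SR SL (\<epsilon> p) \<one>\<^bsub>S\<^esub> \<otimes>\<^bsub>tensor R SR SL\<^esub> inv\<^bsub>tensor R SR SL\<^esub> pure_tensor R SR SL \<one>\<^bsub>S\<^esub> (\<epsilon> p)"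
        using p e \<epsilon>'(1)[OF p]
        by (simp add: hom_mult[OF b(1)] comm_group_hom_inv[OF T.comm_group_T TS.comm_group_T b(1)] b(2))
      also have "\<dots> = \<one>\<^bsub>tensor R SR SL\<^esub>" using \<epsilon>'(1)[OF p] by (simp add: swap)
      finally show "bimap R (P 0) SL SR SL \<epsilon> (\<lambda>y. y) (?k p) = \<one>\<^bsub>tensor R SR SL\<^esub>" .
    qed
    then have "?k ` carrier (P 0) \<subseteq> dS 0 ` carrier (PS (Suc 0))" by auto
    from projective_lift[OF inf cR' proj_P left_module_PS left_module_PS dS_linear k this]
    obtain h where h: "h \<in> left_module_hom (opposite R) (P 0) (PS (Suc 0))"
      "\<And>p. p \<in> carrier (P 0) \<Longrightarrow> dS 0 (h p) = ?k p" by blast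
    have "good 0 h"
      using h e T.pure_tensor_zero_right[OF e(1)] by (simp add: good_def cyc_def)
    then show "\<exists>h. good 0 h" by (rule exI[where x = h])
  next
    fix h n assume good: "good n h"
    let ?T = "PT (Suc n)"
    interpret T: tensor_pair R "P (Suc n)" SL by (rule pair[OF left_module_SL])
    interpret T': tensor_pair R "P n" SL by (rule pair[OF left_module_SL])
    have h: "h \<in> left_module_hom (opposite R) (P n) (PS (Suc n))" using good by (simp add: good_def)
    have k: "(\<lambda>p. pureS (Suc n) p \<one>\<^bsub>S\<^esub> \<otimes>\<^bsub>?T\<^esub> inv\<^bsub>?T\<^esub> h (d n p))
        \<in> left_module_hom (opposite R) (P (Suc n)) (PS (Suc n))" (is "?k \<in> _")
      using lin_hom_diff[OF left_module_PS pure_one_linear lin_hom_comp[OF d_hom h]] by simp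
    have h_cl: "h (d n p) \<in> carrier ?T" if "p \<in> carrier (P (Suc n))" for p
      using lin_homD(1)[OF h lin_homD(1)[OF d_hom that]] by simp
    have "?k p \<in> dS (Suc n) ` carrier (PS (Suc (Suc n)))" if p: "p \<in> carrier (P (Suc n))" for p
      unfolding PS_carrier
    proof (rule acyclic)
      show "?k p \<in> carrier ?T" using lin_homD(1)[OF k p] by simp
      have "dS n (h (d n p)) = pureS n (d n p) \<one>\<^bsub>S\<^esub>"
        using good cyc_d[OF p] lin_homD(1)[OF d_hom p] by (simp add: good_def)
      then show "dS n (?k p) = \<one>\<^bsub>PT n\<^esub>"
        using p h_cl[OF p] lin_homD(1)[OF d_hom p]
        by (simp add: hom_mult[OF dS_hom] comm_group_hom_inv[OF T.comm_group_T T'.comm_group_T dS_hom] dS_pure)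
    qed
    then have "?k ` carrier (P (Suc n)) \<subseteq> dS (Suc n) ` carrier (PS (Suc (Suc n)))" by auto
    from projective_lift[OF inf cR' proj_P left_module_PS left_module_PS dS_linear k this]
    obtain h' where h': "h' \<in> left_module_hom (opposite R) (P (Suc n)) (PS (Suc (Suc n)))"
      "\<And>p. p \<in> carrier (P (Suc n)) \<Longrightarrow> dS (Suc n) (h' p) = ?k p" by blast
    have "h \<zero>\<^bsub>P n\<^esub> = \<one>\<^bsub>?T\<^esub>"
      using lin_hom_zero[OF left_module_P left_module_PS h] by simp
    then have "good (Suc n) h'"
      using h' by (simp add: good_def cyc_def)
    with h'(2) show "\<exists>h'. good (Suc n) h' \<and> (\<forall>p\<in>carrier (P (Suc n)). dS (Suc n) (h' p) = ?k p)"
      by blast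
  qed
  then obtain h where good: "\<And>n. good n (h n)" and h: "\<And>n p. p \<in> carrier (P (Suc n)) \<Longrightarrow>
      dS (Suc n) (h (Suc n) p) =
        pureS (Suc n) p \<one>\<^bsub>S\<^esub> \<otimes>\<^bsub>PT (Suc n)\<^esub> inv\<^bsub>PT (Suc n)\<^esub> h n (d n p)"
    by blast
  show ?thesis
  proof (rule that)
    show h_lin: "h n \<in> left_module_hom (opposite R) (P n) (PS (Suc n))" for n
      using good by (simp add: good_def)
    fix n p assume p: "p \<in> carrier (P (Suc n))"
    interpret T: tensor_pair R "P (Suc n)" SL by (rule pair[OF left_module_SL])
    have "h n (d n p) \<in> carrier (PT (Suc n))"
      using lin_homD(1)[OF h_lin lin_homD(1)[OF d_hom p]] by simp
    then show "dS (Suc n) (h (Suc n) p) \<otimes>\<^bsub>PT (Suc n)\<^esub> h n (d n p) =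
        pureS (Suc n) p \<one>\<^bsub>S\<^esub>"
      using p by (simp add: h T.T.m_assoc)
  qed
qed

text \<open>This is \<open>Tor\<^sub>i(S, M) = 0\<close> for every left \<open>S\<close>-module \<open>M\<close> and \<open>i > 0\<close>. The complex of the
  \<open>P n \<otimes>\<^sub>R M\<close> arises from that of the \<open>P n \<otimes>\<^sub>R S\<close> by tensoring with \<open>M\<close> over \<open>S\<close>, so the contraction
  carries over, as \<open>p \<otimes> m \<mapsto> h n p \<cdot> m\<close> with \<open>(q \<otimes> s) \<cdot> m = q \<otimes> s m\<close>.\<close>

lemma acyclic_module:
  fixes M :: "('b, 'm) module"
  assumes M: "left_module S M"
    and t: "t \<in> carrier (tensor R (P (Suc n)) (res M))"
    and t0: "bimap R (P (Suc n)) (res M) (P n) (res M) (d n) (\<lambda>y. y) t =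
      \<one>\<^bsub>tensor R (P n) (res M)\<^esub>"
  shows "t \<in> bimap R (P (Suc (Suc n))) (res M) (P (Suc n)) (res M) (d (Suc n)) (\<lambda>y. y) `
    carrier (tensor R (P (Suc (Suc n))) (res M))"
proof -
  obtain h where h: "\<And>n. h n \<in> left_module_hom (opposite R) (P n) (PS (Suc n))"
    and h_d: "\<And>n p. p \<in> carrier (P (Suc n)) \<Longrightarrow> dS (Suc n) (h (Suc n) p) \<otimes>\<^bsub>PT (Suc n)\<^esub> h n (d n p) =
      pureS (Suc n) p \<one>\<^bsub>S\<^esub>"
    using contraction_exists by blast
  interpret M: left_module S M by fact
  let ?M = "res M"
  have resM: "left_module R ?M" by (rule left_module_restrict[OF M])
  have T: "tensor_pair R (P k) SL" "tensor_pair R (P k) ?M" for k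
    by (rule pair[OF left_module_SL], rule pair[OF resM])
  \<comment> \<open>\<open>\<mu> k m\<close> is the map \<open>q \<otimes> s \<mapsto> q \<otimes> s m\<close>; \<open>H\<close> and \<open>dM\<close> below are the contraction and the
    differential of the complex for \<open>M\<close>.\<close>
  define \<mu> where "\<mu> k m = bimap R (P k) SL (P k) ?M (\<lambda>x. x) (\<lambda>s. s \<odot>\<^bsub>M\<^esub> m)" for k m
  note \<mu> = bimap_hom[OF T(1) T(2) lin_hom_id orbit_hom[OF M], folded \<mu>_def]
    bimap_pure[OF T(1) T(2) lin_hom_id orbit_hom[OF M], folded \<mu>_def]
  note \<mu>_cl = hom_in_carrier[OF \<mu>(1)]
  have cg: "comm_group (tensor R (P k) ?M)" "comm_group (PT k)" for k
    using tensor_pair.comm_group_T[OF T(2)] tensor_pair.comm_group_T[OF T(1)] by blast+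
  have \<mu>_add: "\<mu> k (m \<oplus>\<^bsub>M\<^esub> m') u = \<mu> k m u \<otimes>\<^bsub>tensor R (P k) ?M\<^esub> \<mu> k m' u"
    if "m \<in> carrier M" "m' \<in> carrier M" "u \<in> carrier (PT k)" for k m m' u
  proof (rule tensor_pair.tensor_hom_eqI[OF T(1) \<mu>(1) hom_pointwise_mult[OF cg(1) \<mu>(1) \<mu>(1)] that(3)])
    interpret TM: tensor_pair R "P k" ?M by (rule T(2))
    fix p s assume "p \<in> carrier (P k)" "s \<in> carrier SL"
    then show "\<mu> k (m \<oplus>\<^bsub>M\<^esub> m') (pureS k p s) =
      \<mu> k m (pureS k p s) \<otimes>\<^bsub>tensor R (P k) ?M\<^esub> \<mu> k m' (pureS k p s)"
      using that TM.pure_tensor_add_right[of p "s \<odot>\<^bsub>M\<^esub> m" "s \<odot>\<^bsub>M\<^esub> m'"]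
      by (simp add: \<mu>(2) M.smult_r_distr)
  qed (use that in auto)
  have \<mu>_smult: "\<mu> k m (r \<odot>\<^bsub>PS k\<^esub> u) = \<mu> k (\<phi> r \<odot>\<^bsub>M\<^esub> m) u"
    if "m \<in> carrier M" "r \<in> carrier R" "u \<in> carrier (PT k)" for k m r u
  proof (rule tensor_pair.tensor_hom_eqI[OF T(1) hom_comp[OF PS_smult_hom \<mu>(1)] \<mu>(1) that(3)])
    fix p s assume "p \<in> carrier (P k)" "s \<in> carrier SL"
    then show "\<mu> k m (r \<odot>\<^bsub>PS k\<^esub> pureS k p s) = \<mu> k (\<phi> r \<odot>\<^bsub>M\<^esub> m) (pureS k p s)"
      using that by (simp add: \<mu>(2) PS_smult_pure M.smult_assoc)
  qed (use that in auto)
  have h_cl: "h k p \<in> carrier (PT (Suc k))" if "p \<in> carrier (P k)" for k p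
    using lin_homD(1)[OF h that] by simp
  have bal: "balanced R (P k) ?M (tensor R (P (Suc k)) ?M) (\<lambda>p m. \<mu> (Suc k) m (h k p))" for k
    using lin_homD[OF h[of k], simplified]
    by (intro balancedI) (simp_all add: \<mu>_cl hom_mult[OF \<mu>(1)] \<mu>_add \<mu>_smult)
  define H where "H k = tensor_lift R (P k) ?M (tensor R (P (Suc k)) ?M) (\<lambda>p m. \<mu> (Suc k) m (h k p))" for k
  note H = tensor_pair.tensor_lift_hom[OF T(2) cg(1) bal, folded H_def]
    tensor_pair.tensor_lift_pure[OF T(2) cg(1) bal, folded H_def]
  define dM where "dM k = bimap R (P (Suc k)) ?M (P k) ?M (d k) (\<lambda>y. y)" for k
  note dM = bimap_hom[OF T(2) T(2) d_hom lin_hom_id, folded dM_def]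
    bimap_pure[OF T(2) T(2) d_hom lin_hom_id, folded dM_def]
  have dM_\<mu>: "dM k (\<mu> (Suc k) m u) = \<mu> k m (dS k u)"
    if "m \<in> carrier M" "u \<in> carrier (PT (Suc k))" for k m u
  proof (rule tensor_pair.tensor_hom_eqI[OF T(1) hom_comp[OF \<mu>(1) dM(1)] hom_comp[OF dS_hom \<mu>(1)] that(2)])
    fix p s assume "p \<in> carrier (P (Suc k))" "s \<in> carrier SL"
    then show "dM k (\<mu> (Suc k) m (pureS (Suc k) p s)) = \<mu> k m (dS k (pureS (Suc k) p s))"
      using that lin_homD(1)[OF d_hom] by (simp add: \<mu>(2) dM(2) dS_pure)
  qed (use that in auto)
  have "dM (Suc n) (H (Suc n) t) \<otimes>\<^bsub>tensor R (P (Suc n)) ?M\<^esub> H n (dM n t) = t"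
  proof (rule tensor_pair.tensor_hom_eqI[OF T(2) hom_pointwise_mult[OF cg(1) hom_comp[OF H(1) dM(1)] hom_comp[OF dM(1) H(1)]] hom_ident t])
    fix p m assume p: "p \<in> carrier (P (Suc n))" and "m \<in> carrier ?M"
    then have m: "m \<in> carrier M" by simp
    have dp: "d n p \<in> carrier (P n)" by (rule lin_homD(1)[OF d_hom p])
    have "dM (Suc n) (H (Suc n) (pure_tensor R (P (Suc n)) ?M p m)) = \<mu> (Suc n) m (dS (Suc n) (h (Suc n) p))"
      using p m by (simp add: H(2) dM_\<mu> h_cl)
    moreover have "H n (dM n (pure_tensor R (P (Suc n)) ?M p m)) = \<mu> (Suc n) m (h n (d n p))"
      using p m dp by (simp add: dM(2) H(2))
    moreover have "\<mu> (Suc n) m (dS (Suc n) (h (Suc n) p)) \<otimes>\<^bsub>tensor R (P (Suc n)) ?M\<^esub> \<mu> (Suc n) m (h n (d n p)) =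
        \<mu> (Suc n) m (pureS (Suc n) p \<one>\<^bsub>S\<^esub>)"
      using hom_mult[OF \<mu>(1)[OF m] hom_in_carrier[OF dS_hom h_cl[OF p]] h_cl[OF dp]] h_d[OF p] by simp
    ultimately show "dM (Suc n) (H (Suc n) (pure_tensor R (P (Suc n)) ?M p m)) \<otimes>\<^bsub>tensor R (P (Suc n)) ?M\<^esub>
        H n (dM n (pure_tensor R (P (Suc n)) ?M p m)) = pure_tensor R (P (Suc n)) ?M p m"
      using p m by (simp add: \<mu>(2))
  qed
  moreover have "H n (dM n t) = \<one>\<^bsub>tensor R (P (Suc n)) ?M\<^esub>"
    using t0 comm_group_hom_one[OF cg(1) cg(1) H(1)] by (simp add: dM_def)
  moreover have "dM (Suc n) (H (Suc n) t) \<in> carrier (tensor R (P (Suc n)) ?M)"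
    by (rule hom_in_carrier[OF dM(1) hom_in_carrier[OF H(1) t]])
  ultimately have "dM (Suc n) (H (Suc n) t) = t"
    using monoid.r_one[OF group.is_monoid[OF comm_group.axioms(2)[OF cg(1)]]] by metis
  then show ?thesis
    using hom_in_carrier[OF H(1) t] unfolding dM_def by (metis image_eqI)
qed

end


section \<open>Double complexes\<close>

text \<open>Exactness at place \<open>j\<close> of the subcomplex \<open>K\<close> of \<open>\<dots> \<rightarrow> C 2 \<rightarrow> C 1 \<rightarrow> C 0 \<rightarrow> 0\<close>.\<close>

definition acyclic_at ::
  "(nat \<Rightarrow> 'c monoid) \<Rightarrow> (nat \<Rightarrow> 'c \<Rightarrow> 'c) \<Rightarrow> (nat \<Rightarrow> 'c set) \<Rightarrow> nat \<Rightarrow> bool" where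
  "acyclic_at C h K j = (case j of
     0 \<Rightarrow> (\<forall>x\<in>K 0. \<exists>y\<in>K (Suc 0). h 0 y = x)
   | Suc i \<Rightarrow> (\<forall>x\<in>K (Suc i). h i x = \<one>\<^bsub>C i\<^esub> \<longrightarrow> (\<exists>y\<in>K (Suc (Suc i)). h (Suc i) y = x)))"

text \<open>The long exact sequence of \<open>0 \<rightarrow> K \<rightarrow> C \<rightarrow> v ` C \<rightarrow> 0\<close>: if \<open>C\<close> is acyclic, the homology of the image
  at place \<open>i + 1\<close> is that of the kernel \<open>K\<close> at place \<open>i\<close>.\<close>

lemma acyclic_at_image:
  fixes C :: "nat \<Rightarrow> 'c monoid" and D :: "nat \<Rightarrow> 'd monoid"
  assumes C: "\<And>j. comm_group (C j)" and D: "\<And>j. comm_group (D j)"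
    and hC: "\<And>j. hC j \<in> hom (C (Suc j)) (C j)" and hD: "\<And>j. hD j \<in> hom (D (Suc j)) (D j)"
    and v: "\<And>j. v j \<in> hom (C j) (D j)"
    and commute: "\<And>j x. x \<in> carrier (C (Suc j)) \<Longrightarrow> v j (hC j x) = hD j (v (Suc j) x)"
    and K: "\<And>j x. x \<in> K j \<longleftrightarrow> x \<in> carrier (C j) \<and> v j x = \<one>\<^bsub>D j\<^esub>"
    and complex: "\<And>j x. x \<in> carrier (C (Suc (Suc j))) \<Longrightarrow> hC j (hC (Suc j) x) = \<one>\<^bsub>C j\<^esub>"
    and row: "\<And>j. acyclic_at C hC (\<lambda>j. carrier (C j)) j"
    and IH: "\<And>i. j = Suc i \<Longrightarrow> acyclic_at C hC K i"
  shows "acyclic_at D hD (\<lambda>j. v j ` carrier (C j)) j"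
proof (cases j)
  case 0
  have "\<exists>z\<in>v (Suc 0) ` carrier (C (Suc 0)). hD 0 z = v 0 x" if x: "x \<in> carrier (C 0)" for x
  proof -
    obtain y where "y \<in> carrier (C (Suc 0))" "hC 0 y = x"
      using row[of 0] x by (auto simp: acyclic_at_def)
    then show ?thesis using commute[of y 0] by auto
  qed
  with 0 show ?thesis by (auto simp: acyclic_at_def)
next
  case (Suc i)
  have "\<exists>z\<in>v (Suc (Suc i)) ` carrier (C (Suc (Suc i))). hD (Suc i) z = v (Suc i) x"
    if x: "x \<in> carrier (C (Suc i))" and zero: "hD i (v (Suc i) x) = \<one>\<^bsub>D i\<^esub>" for x
  proof -
    interpret Ci: comm_group "C i" by (rule C)
    interpret CSi: comm_group "C (Suc i)" by (rule C)
    interpret DSi: comm_group "D (Suc i)" by (rule D)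
    have hx: "hC i x \<in> K i"
      using zero commute[OF x] hom_in_carrier[OF hC x] by (simp add: K)
    obtain w where w: "w \<in> K (Suc i)" "hC i w = hC i x"
    proof (cases i)
      case 0
      then show ?thesis using IH[OF Suc] hx that by (simp add: acyclic_at_def) blast
    next
      case (Suc k)
      then have "hC k (hC i x) = \<one>\<^bsub>C k\<^esub>" using complex[of x k] x by simp
      then show ?thesis using IH[OF \<open>j = Suc i\<close>] hx that Suc by (simp add: acyclic_at_def) blast
    qed
    have wC: "w \<in> carrier (C (Suc i))" and vw: "v (Suc i) w = \<one>\<^bsub>D (Suc i)\<^esub>"
      using w(1) by (simp_all add: K)
    \<comment> \<open>\<open>hC i x\<close> bounds inside \<open>K\<close>; subtracting the bounding element makes \<open>x\<close> a cycle of \<open>C\<close> and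
      does not change its image under \<open>v\<close>.\<close>
    let ?z = "x \<otimes>\<^bsub>C (Suc i)\<^esub> inv\<^bsub>C (Suc i)\<^esub> w"
    have "hC i ?z = hC i x \<otimes>\<^bsub>C i\<^esub> inv\<^bsub>C i\<^esub> hC i w"
      using x wC by (simp add: hom_mult[OF hC] comm_group_hom_inv[OF C C hC])
    then have "hC i ?z = \<one>\<^bsub>C i\<^esub>" using w(2) hom_in_carrier[OF hC x] by simp
    moreover have "?z \<in> carrier (C (Suc i))" using x wC by simp
    ultimately obtain y where y: "y \<in> carrier (C (Suc (Suc i)))" "hC (Suc i) y = ?z"
      using row[of "Suc i"] unfolding acyclic_at_def by fastforce
    have "hD (Suc i) (v (Suc (Suc i)) y) = v (Suc i) ?z" using commute[OF y(1)] y(2) by simp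
    also have "\<dots> = v (Suc i) x"
      using x wC vw hom_in_carrier[OF v x]
      by (simp add: hom_mult[OF v] comm_group_hom_inv[OF C D v])
    finally show ?thesis using y(1) by blast
  qed
  with Suc show ?thesis by (auto simp: acyclic_at_def)
qed

text \<open>The row \<open>D\<close> is resolved by the acyclic rows \<open>G 0, G 1, \<dots>\<close>, so it is acyclic. The images of
  consecutive rows in each other are handled simultaneously, since exactness at place \<open>j\<close> in one of
  them depends on exactness at place \<open>j - 1\<close> in the next.\<close>

lemma double_complex:
  fixes G :: "nat \<Rightarrow> nat \<Rightarrow> 'c monoid" and D :: "nat \<Rightarrow> 'd monoid"
  assumes G: "\<And>i j. comm_group (G i j)" and D: "\<And>j. comm_group (D j)"
    and h: "\<And>i j. h i j \<in> hom (G i (Suc j)) (G i j)" and hD: "\<And>j. hD j \<in> hom (D (Suc j)) (D j)"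
    and v: "\<And>i j. v i j \<in> hom (G (Suc i) j) (G i j)" and vD: "\<And>j. vD j \<in> hom (G 0 j) (D j)"
    and commute: "\<And>i j x. x \<in> carrier (G (Suc i) (Suc j)) \<Longrightarrow> v i j (h (Suc i) j x) = h i j (v i (Suc j) x)"
    and commuteD: "\<And>j x. x \<in> carrier (G 0 (Suc j)) \<Longrightarrow> vD j (h 0 j x) = hD j (vD (Suc j) x)"
    and column: "\<And>i j. v (Suc i) j ` carrier (G (Suc (Suc i)) j) = {x \<in> carrier (G (Suc i) j). v i j x = \<one>\<^bsub>G i j\<^esub>}"
    and column0: "\<And>j. v 0 j ` carrier (G (Suc 0) j) = {x \<in> carrier (G 0 j). vD j x = \<one>\<^bsub>D j\<^esub>}"
    and surj: "\<And>j. vD j ` carrier (G 0 j) = carrier (D j)"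
    and complex: "\<And>i j x. x \<in> carrier (G i (Suc (Suc j))) \<Longrightarrow> h i j (h i (Suc j) x) = \<one>\<^bsub>G i j\<^esub>"
    and row: "\<And>i j. acyclic_at (G i) (h i) (\<lambda>j. carrier (G i j)) j"
  shows "acyclic_at D hD (\<lambda>j. carrier (D j)) j"
proof -
  have *: "acyclic_at (G i) (h i) (\<lambda>j. v i j ` carrier (G (Suc i) j)) j" for i j
  proof (induction j arbitrary: i rule: less_induct)
    case (less j)
    show ?case
    proof (rule acyclic_at_image[of "G (Suc i)" "G i" "h (Suc i)" "h i" "v i"
          "\<lambda>j. v (Suc i) j ` carrier (G (Suc (Suc i)) j)"])
      show "acyclic_at (G (Suc i)) (h (Suc i)) (\<lambda>j. v (Suc i) j ` carrier (G (Suc (Suc i)) j)) k"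
        if "j = Suc k" for k using that by (intro less.IH) simp
    qed (simp_all add: G h v commute column complex row)
  qed
  have "acyclic_at D hD (\<lambda>j. vD j ` carrier (G 0 j)) j"
  proof (rule acyclic_at_image[of "G 0" D "h 0" hD vD "\<lambda>j. v 0 j ` carrier (G (Suc 0) j)"])
    show "acyclic_at (G 0) (h 0) (\<lambda>j. v 0 j ` carrier (G (Suc 0) j)) k" if "j = Suc k" for k
      by (rule *)
  qed (simp_all add: G D h hD vD commuteD column0 complex row)
  then show ?thesis by (simp add: surj)
qed


section \<open>Projective resolutions\<close>

lemma projective_resolution_iso_target:
  assumes res: "projective_resolution K M P d \<epsilon>" and M: "left_module K M" and N: "left_module K N"
    and k: "k \<in> left_module_hom K M N" "bij_betw k (carrier M) (carrier N)"
  shows "projective_resolution K N P d (\<lambda>x. k (\<epsilon> x))"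
proof -
  interpret M: left_module K M by fact
  have \<epsilon>: "\<epsilon> \<in> left_module_hom K (P 0) M" using res by (simp add: projective_resolution_def)
  have "k (\<epsilon> x) = \<zero>\<^bsub>N\<^esub> \<longleftrightarrow> \<epsilon> x = \<zero>\<^bsub>M\<^esub>" if "x \<in> carrier (P 0)" for x
    using k(2) lin_homD(1)[OF \<epsilon> that] lin_hom_zero[OF M N k(1)]
    by (metis M.M.zero_closed bij_betw_imp_inj_on inj_onD)
  moreover have "(\<lambda>x. k (\<epsilon> x)) ` carrier (P 0) = k ` \<epsilon> ` carrier (P 0)" by (simp add: image_image)
  ultimately show ?thesis
    using res lin_hom_comp[OF \<epsilon> k(1)] bij_betw_imp_surj_on[OF k(2)]
    by (auto simp: projective_resolution_def)
qed

lemma transport_projective_resolution: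
  fixes K :: "('a, 'k) ring_scheme" and X :: "nat \<Rightarrow> ('a, 'x) module" and N :: "('a, 'm) module"
  assumes X: "\<And>n. left_module K (X n)"
    and lift: "\<And>n (L :: ('a, 'u) module) (M :: ('a, 'u) module) g k.
      \<lbrakk>left_module K L; left_module K M; g \<in> left_module_hom K L M; k \<in> left_module_hom K (X n) M;
       g ` carrier L = carrier M\<rbrakk> \<Longrightarrow> \<exists>h\<in>left_module_hom K (X n) L. \<forall>x\<in>carrier (X n). g (h x) = k x"
    and size: "\<And>n. carrier (X n) \<lesssim> (UNIV :: 'u set)"
    and e: "\<And>n. e n \<in> left_module_hom K (X (Suc n)) (X n)"
    and \<eta>: "\<eta> \<in> left_module_hom K (X 0) N"
    and surj: "\<eta> ` carrier (X 0) = carrier N"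
    and exact0: "e 0 ` carrier (X (Suc 0)) = {x \<in> carrier (X 0). \<eta> x = \<zero>\<^bsub>N\<^esub>}"
    and exact: "\<And>n. e (Suc n) ` carrier (X (Suc (Suc n))) = {x \<in> carrier (X (Suc n)). e n x = \<zero>\<^bsub>X n\<^esub>}"
  obtains P :: "nat \<Rightarrow> ('a, 'u) module" and d \<epsilon> where "projective_resolution K N P d \<epsilon>"
    and "\<And>n. carrier (X n) = {\<zero>\<^bsub>X n\<^esub>} \<Longrightarrow> carrier (P n) = {\<zero>\<^bsub>P n\<^esub>}"
proof -
  have "\<exists>f :: 'x \<Rightarrow> 'u. inj_on f (carrier (X n))" for n
    using size[of n] by (auto simp: lepoll_def)
  then obtain f :: "nat \<Rightarrow> 'x \<Rightarrow> 'u" where f: "\<And>n. inj_on (f n) (carrier (X n))" by metis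
  define P where "P n = transport_module (f n) (X n)" for n
  define g where "g n = inv_into (carrier (X n)) (f n)" for n
  have P: "carrier (P n) = f n ` carrier (X n)" "\<zero>\<^bsub>P n\<^esub> = f n \<zero>\<^bsub>X n\<^esub>" for n
    by (simp_all add: P_def transport_module_simps f)
  have gf: "g n (f n x) = x" if "x \<in> carrier (X n)" for n x
    using f that by (simp add: g_def)
  have f_hom: "f n \<in> left_module_hom K (X n) (P n)" for n
    unfolding P_def by (rule transport_module_hom[OF f])
  have g_hom: "g n \<in> left_module_hom K (P n) (X n)" for n
    unfolding P_def g_def by (rule inv_transport_module_hom[OF X f])
  define d where "d n = (\<lambda>x. f n (e n (g (Suc n) x)))" for n
  define \<epsilon> where "\<epsilon> = (\<lambda>x. \<eta> (g 0 x))"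
  have d: "d n ` carrier (P (Suc n)) = f n ` e n ` carrier (X (Suc n))" for n
    by (force simp: d_def P gf image_iff)
  have zero: "f n x = f n \<zero>\<^bsub>X n\<^esub> \<longleftrightarrow> x = \<zero>\<^bsub>X n\<^esub>" if "x \<in> carrier (X n)" for n x
  proof -
    interpret X: left_module K "X n" by (rule X)
    show ?thesis using f that by (auto simp: inj_on_def)
  qed
  show ?thesis
  proof (rule that)
    show "projective_resolution K N P d \<epsilon>"
      unfolding projective_resolution_def
    proof (intro conjI allI)
      show "projective K (P n)" for n
        unfolding P_def using X f lift by (rule projective_transport)
      show "d n \<in> left_module_hom K (P (Suc n)) (P n)" for n
        unfolding d_def by (rule lin_hom_comp[OF lin_hom_comp[OF g_hom e] f_hom])
      show "\<epsilon> \<in> left_module_hom K (P 0) N"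
        unfolding \<epsilon>_def by (rule lin_hom_comp[OF g_hom \<eta>])
      show "\<epsilon> ` carrier (P 0) = carrier N"
        using surj by (force simp: \<epsilon>_def P gf image_iff)
      show "d 0 ` carrier (P 1) = {x \<in> carrier (P 0). \<epsilon> x = \<zero>\<^bsub>N\<^esub>}"
        unfolding One_nat_def d exact0 by (auto simp: \<epsilon>_def P gf)
      show "d (Suc n) ` carrier (P (Suc (Suc n))) = {x \<in> carrier (P (Suc n)). d n x = \<zero>\<^bsub>P n\<^esub>}" for n
        unfolding d exact using lin_homD(1)[OF e] by (auto simp: d_def P gf zero)
    qed
    show "carrier (P n) = {\<zero>\<^bsub>P n\<^esub>}" if "carrier (X n) = {\<zero>\<^bsub>X n\<^esub>}" for n
      using that by (simp add: P)
  qed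
qed

lemma left_module_kernel:
  assumes M: "left_module K M" and N: "left_module K N" and g: "g \<in> left_module_hom K M N"
  shows "left_module K (M\<lparr>carrier := {x \<in> carrier M. g x = \<zero>\<^bsub>N\<^esub>}\<rparr>)"
proof -
  interpret M: left_module K M by fact
  interpret N: left_module K N by fact
  note g' = lin_homD[OF g] lin_hom_zero[OF M N g]
  have neg: "g (\<ominus>\<^bsub>M\<^esub> x) = \<ominus>\<^bsub>N\<^esub> g x" if "x \<in> carrier M" for x
    using comm_group_hom_inv[OF M.M.a_comm_group N.M.a_comm_group lin_hom_add_monoid[OF g], of x] that
    by (simp add: a_inv_def)
  have "\<exists>y\<in>{x \<in> carrier M. g x = \<zero>\<^bsub>N\<^esub>}. y \<oplus>\<^bsub>M\<^esub> x = \<zero>\<^bsub>M\<^esub>"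
    if "x \<in> carrier M" "g x = \<zero>\<^bsub>N\<^esub>" for x
    using that by (intro bexI[where x = "\<ominus>\<^bsub>M\<^esub> x"]) (auto simp: M.M.l_neg neg)
  then have "abelian_group (M\<lparr>carrier := {x \<in> carrier M. g x = \<zero>\<^bsub>N\<^esub>}\<rparr>)"
    by (intro abelian_groupI) (auto simp: g' M.M.a_ac)
  then show ?thesis
    by (intro left_module.intro left_module_axioms.intro M.R.ring_axioms)
      (auto simp: g' M.smult_l_distr M.smult_r_distr M.smult_assoc)
qed

text \<open>Cover \<open>M\<close> by a projective module, then cover the kernel, and so on.\<close>

lemma projective_resolution_exists:
  fixes K :: "('a, 'k) ring_scheme" and M :: "('a, 'm) module"
  assumes inf: "infinite (UNIV :: 'u set)" and cK: "carrier K \<lesssim> (UNIV :: 'u set)"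
    and M: "left_module K M" and cM: "carrier M \<lesssim> (UNIV :: 'u set)"
  obtains P :: "nat \<Rightarrow> ('a, 'u) module" and d \<epsilon> where "projective_resolution K M P d \<epsilon>"
proof -
  obtain f :: "'m \<Rightarrow> 'u" where f: "inj_on f (carrier M)" using cM by (rule lepoll_ex_inj)
  let ?M = "transport_module f M"
  \<comment> \<open>The recursion runs over triples of a module \<open>N\<close> and a projective cover \<open>\<pi> : F \<rightarrow> N\<close>; the next
    module is the kernel of \<open>\<pi>\<close>.\<close>
  define cover where "cover N F \<pi> \<longleftrightarrow> left_module K N \<and> projective K F \<and> \<pi> \<in> left_module_hom K F N \<and>
      \<pi> ` carrier F = carrier N" for N F :: "('a, 'u) module" and \<pi>
  have cover_ex: "\<exists>F \<pi>. cover N F \<pi>" if "left_module K N" for N :: "('a, 'u) module"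
    using projective_cover[OF inf cK that] that unfolding cover_def by metis
  define ker where "ker F N \<pi> = F\<lparr>carrier := {x \<in> carrier F. \<pi> x = \<zero>\<^bsub>N\<^esub>}\<rparr>"
    for N F :: "('a, 'u) module" and \<pi> :: "'u \<Rightarrow> 'u"
  define good where "good n x \<longleftrightarrow> cover (fst x) (fst (snd x)) (snd (snd x)) \<and> (n = 0 \<longrightarrow> fst x = ?M)"
    for n :: nat and x
  define step where "step x y \<longleftrightarrow> fst y = ker (fst (snd x)) (fst x) (snd (snd x))"
    for x y :: "('a, 'u) module \<times> ('a, 'u) module \<times> ('u \<Rightarrow> 'u)"
  have "\<exists>s. \<forall>n. good n (s n) \<and> step (s n) (s (Suc n))"
  proof (rule dependent_nat_choice)
    show "\<exists>x. good 0 x"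
      using cover_ex[OF left_module_transport[OF M f]] by (auto simp: good_def)
    fix x n assume x: "good n x"
    have "left_module K (ker (fst (snd x)) (fst x) (snd (snd x)))"
      unfolding ker_def using x by (intro left_module_kernel) (auto simp: good_def cover_def projective_def)
    from cover_ex[OF this] show "\<exists>y. good (Suc n) y \<and> step x y"
      by (auto simp: good_def step_def)
  qed
  then obtain s where s: "\<And>n. good n (s n)" "\<And>n. step (s n) (s (Suc n))" by blast
  define N F \<pi> where "N n = fst (s n)" and "F n = fst (snd (s n))" and "\<pi> n = snd (snd (s n))" for n
  have cov: "cover (N n) (F n) (\<pi> n)" and N_0: "N 0 = ?M"
    and N_Suc: "N (Suc n) = ker (F n) (N n) (\<pi> n)" for n
    using s(1)[of n] s(1)[of 0] s(2)[of n] by (simp_all add: N_def F_def \<pi>_def good_def step_def)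
  have \<pi>_hom: "\<pi> n \<in> left_module_hom K (F n) (N n)" and \<pi>_surj: "\<pi> n ` carrier (F n) = carrier (N n)"
    and proj: "projective K (F n)" for n
    using cov[of n] by (simp_all add: cover_def)
  have N_carrier: "carrier (N (Suc n)) = {x \<in> carrier (F n). \<pi> n x = \<zero>\<^bsub>N n\<^esub>}"
    and N_zero: "\<zero>\<^bsub>N (Suc n)\<^esub> = \<zero>\<^bsub>F n\<^esub>" for n
    by (simp_all add: N_Suc ker_def)
  have incl: "(\<lambda>x. x) \<in> left_module_hom K (N (Suc n)) (F n)" for n
    by (rule lin_homI) (simp_all add: N_Suc ker_def)
  have "projective_resolution K ?M F (\<lambda>n. \<pi> (Suc n)) (\<pi> 0)"
    unfolding projective_resolution_def
    using proj lin_hom_comp[OF \<pi>_hom incl] \<pi>_hom[of 0] \<pi>_surj N_carrier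
    by (simp add: N_0 N_zero)
  moreover have "bij_betw (inv_into (carrier M) f) (carrier ?M) (carrier M)"
    using f by (simp add: transport_module_simps(1)[OF f] bij_betw_inv_into inj_on_imp_bij_betw)
  ultimately show ?thesis
    using that projective_resolution_iso_target[OF _ left_module_transport[OF M f] M
        inv_transport_module_hom[OF M f]] by blast
qed


section \<open>Base change of projective resolutions\<close>

context stably_flat_epi
begin

abbreviation "extend_map B B' g \<equiv> bimap R SR B SR B' (\<lambda>x. x) g"

definition extend_scalars :: "('a, 'q) module \<Rightarrow> ('b, ('b \<times> 'q \<Rightarrow>\<^sub>0 int) set) module" where
  "extend_scalars B = tensor_module R SR B (\<lambda>s. bimap R SR B SR B (\<lambda>x. s \<otimes>\<^bsub>S\<^esub> x) (\<lambda>y. y))"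

lemma left_module_extend_scalars: "left_module R B \<Longrightarrow> left_module S (extend_scalars B)"
  unfolding extend_scalars_def
  by (rule left_module_tensor_left[OF pairS S SR_smult_hom]) (auto simp: S.l_distr S.m_assoc)

lemma extend_scalars_carrier [simp]: "carrier (extend_scalars B) = carrier (tensor R SR B)"
  and extend_scalars_zero [simp]: "\<zero>\<^bsub>extend_scalars B\<^esub> = \<one>\<^bsub>tensor R SR B\<^esub>"
  and extend_scalars_add [simp]: "x \<oplus>\<^bsub>extend_scalars B\<^esub> y = x \<otimes>\<^bsub>tensor R SR B\<^esub> y"
  by (simp_all add: extend_scalars_def)

lemma hom_extend_scalars:
  "hom (add_monoid (extend_scalars B)) G = hom (tensor R SR B) G"
  "hom G (add_monoid (extend_scalars B)) = hom G (tensor R SR B)"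
  by (simp_all add: hom_def)

lemma
  assumes "left_module R B" "s \<in> carrier S"
  shows extend_scalars_smult_hom: "(\<lambda>t. s \<odot>\<^bsub>extend_scalars B\<^esub> t) \<in> hom (tensor R SR B) (tensor R SR B)"
    and extend_scalars_smult_pure: "\<lbrakk>x \<in> carrier S; y \<in> carrier B\<rbrakk> \<Longrightarrow>
      s \<odot>\<^bsub>extend_scalars B\<^esub> pure_tensor R SR B x y = pure_tensor R SR B (s \<otimes>\<^bsub>S\<^esub> x) y"
  using bimap_hom[OF pairS pairS SR_smult_hom lin_hom_id, of B s]
    bimap_pure[OF pairS pairS SR_smult_hom lin_hom_id, of B s x y] assms
  by (simp_all add: extend_scalars_def)

lemma extend_scalars_homI:
  assumes B: "left_module R B" and N: "left_module S N"
    and f: "f \<in> hom (tensor R SR B) (add_monoid N)"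
    and pure: "\<And>s x y. \<lbrakk>s \<in> carrier S; x \<in> carrier S; y \<in> carrier B\<rbrakk> \<Longrightarrow>
      f (pure_tensor R SR B (s \<otimes>\<^bsub>S\<^esub> x) y) = s \<odot>\<^bsub>N\<^esub> f (pure_tensor R SR B x y)"
  shows "f \<in> left_module_hom S (extend_scalars B) N"
proof (rule lin_homI)
  interpret T: tensor_pair R SR B by (rule pairS[OF B])
  interpret N: left_module S N by fact
  fix s t assume s: "s \<in> carrier S" and "t \<in> carrier (extend_scalars B)"
  then have t: "t \<in> carrier (tensor R SR B)" by simp
  show "f (s \<odot>\<^bsub>extend_scalars B\<^esub> t) = s \<odot>\<^bsub>N\<^esub> f t"
  proof (rule T.tensor_hom_eqI[OF hom_comp[OF extend_scalars_smult_hom[OF B s] f]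
        hom_comp[OF f N.smult_lin_hom_self[OF s]] t])
    fix x y assume "x \<in> carrier SR" "y \<in> carrier B"
    then show "f (s \<odot>\<^bsub>extend_scalars B\<^esub> pure_tensor R SR B x y) = s \<odot>\<^bsub>N\<^esub> f (pure_tensor R SR B x y)"
      using s by (simp add: extend_scalars_smult_pure[OF B s] pure)
  qed
qed (use hom_in_carrier[OF f] hom_mult[OF f] in simp_all)

lemma extend_scalars_map_hom:
  assumes B: "left_module R B" "left_module R B'" and g: "g \<in> left_module_hom R B B'"
  shows "extend_map B B' g \<in> left_module_hom S (extend_scalars B) (extend_scalars B')"
proof (rule extend_scalars_homI[OF B(1) left_module_extend_scalars[OF B(2)]])
  note b = bimap_hom[OF pairS[OF B(1)] pairS[OF B(2)] lin_hom_id g]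
    bimap_pure[OF pairS[OF B(1)] pairS[OF B(2)] lin_hom_id g]
  show "extend_map B B' g \<in> hom (tensor R SR B) (add_monoid (extend_scalars B'))" using b(1) by (simp only: hom_extend_scalars)
  fix s x y assume "s \<in> carrier S" "x \<in> carrier S" "y \<in> carrier B"
  then show "extend_map B B' g (pure_tensor R SR B (s \<otimes>\<^bsub>S\<^esub> x) y) =
      s \<odot>\<^bsub>extend_scalars B'\<^esub> extend_map B B' g (pure_tensor R SR B x y)"
    using lin_homD(1)[OF g] by (simp add: b(2) extend_scalars_smult_pure[OF B(2)])
qed

text \<open>Extension of scalars is left adjoint to restriction: a map of \<open>S\<close>-modules from \<open>S \<otimes>\<^sub>R Q\<close> is
  determined by a map of \<open>R\<close>-modules from \<open>Q\<close>, which lifts because \<open>Q\<close> is projective.\<close>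

lemma extend_scalars_lift:
  fixes Q :: "('a, 'u) module" and L N :: "('b, 'u) module"
  assumes Q: "projective R Q" and L: "left_module S L" and N: "left_module S N"
    and g: "g \<in> left_module_hom S L N" and k: "k \<in> left_module_hom S (extend_scalars Q) N"
    and surj: "g ` carrier L = carrier N"
  shows "\<exists>h\<in>left_module_hom S (extend_scalars Q) L. \<forall>x\<in>carrier (extend_scalars Q). g (h x) = k x"
proof -
  interpret L: left_module S L by fact
  interpret N: left_module S N by fact
  have mQ: "left_module R Q" using Q by (simp add: projective_def)
  interpret T: tensor_pair R SR Q by (rule pairS[OF mQ])
  let ?p = "pure_tensor R SR Q"
  note k' = lin_homD[OF k, simplified] and g' = lin_homD[OF g]
  have k0: "(\<lambda>y. k (?p \<one>\<^bsub>S\<^esub> y)) \<in> left_module_hom R Q (res N)"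
  proof (rule lin_homI)
    fix r y assume *: "r \<in> carrier R" "y \<in> carrier Q"
    have "?p \<one>\<^bsub>S\<^esub> (r \<odot>\<^bsub>Q\<^esub> y) = ?p (\<phi> r) y"
      using * T.pure_tensor_balance[of r "\<one>\<^bsub>S\<^esub>" y] by simp
    also have "\<dots> = \<phi> r \<odot>\<^bsub>extend_scalars Q\<^esub> ?p \<one>\<^bsub>S\<^esub> y"
      using * by (simp add: extend_scalars_smult_pure[OF mQ])
    finally show "k (?p \<one>\<^bsub>S\<^esub> (r \<odot>\<^bsub>Q\<^esub> y)) =
        r \<odot>\<^bsub>res N\<^esub> k (?p \<one>\<^bsub>S\<^esub> y)"
      using * by (simp add: k')
  qed (simp_all add: k' T.pure_tensor_add_right)
  have g0: "g \<in> left_module_hom R (res L) (res N)"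
    using g' by (intro lin_homI) simp_all
  have "(\<lambda>y. k (?p \<one>\<^bsub>S\<^esub> y)) ` carrier Q \<subseteq> g ` carrier (res L)"
    using surj k'(1) by auto
  from projective_lift[OF inf cR Q left_module_restrict[OF L] left_module_restrict[OF N] g0 k0 this]
  obtain h0 where h0: "h0 \<in> left_module_hom R Q (res L)"
    and gh0: "\<And>y. y \<in> carrier Q \<Longrightarrow> g (h0 y) = k (?p \<one>\<^bsub>S\<^esub> y)" by blast
  note h0' = lin_homD[OF h0, simplified]
  have bal: "balanced R SR Q (add_monoid L) (\<lambda>s y. s \<odot>\<^bsub>L\<^esub> h0 y)"
    by (rule balancedI) (simp_all add: h0' L.smult_l_distr L.smult_r_distr L.smult_assoc)
  define h where "h = tensor_lift R SR Q (add_monoid L) (\<lambda>s y. s \<odot>\<^bsub>L\<^esub> h0 y)"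
  note h = T.tensor_lift_hom[OF L.M.a_comm_group bal, folded h_def]
    T.tensor_lift_pure[OF L.M.a_comm_group bal, folded h_def]
  have "g (h t) = k t" if t: "t \<in> carrier (tensor R SR Q)" for t
  proof (rule T.tensor_hom_eqI[OF hom_comp[OF h(1) lin_hom_add_monoid[OF g]] _ t])
    show "k \<in> hom (tensor R SR Q) (add_monoid N)"
      using lin_hom_add_monoid[OF k] by (simp only: hom_extend_scalars)
    fix s y assume "s \<in> carrier SR" and y: "y \<in> carrier Q"
    then have s: "s \<in> carrier S" by simp
    have "g (h (?p s y)) = s \<odot>\<^bsub>N\<^esub> k (?p \<one>\<^bsub>S\<^esub> y)"
      using s y by (simp add: h(2) g' h0' gh0)
    also have "\<dots> = k (s \<odot>\<^bsub>extend_scalars Q\<^esub> ?p \<one>\<^bsub>S\<^esub> y)"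
      using s y by (simp add: k')
    also have "\<dots> = k (?p s y)"
      using s y by (simp add: extend_scalars_smult_pure[OF mQ])
    finally show "g (h (?p s y)) = k (?p s y)" .
  qed
  moreover have "h \<in> left_module_hom S (extend_scalars Q) L"
    by (rule extend_scalars_homI[OF mQ L h(1)]) (simp add: h(2) h0' L.smult_assoc)
  ultimately show ?thesis by (intro bexI[of _ h]) simp_all
qed

lemma swap_module:
  assumes M: "left_module S M" and s: "s \<in> carrier S" and m: "m \<in> carrier M"
  shows "pure_tensor R SR (res M) s m = pure_tensor R SR (res M) \<one>\<^bsub>S\<^esub> (s \<odot>\<^bsub>M\<^esub> m)"
proof -
  interpret M: left_module S M by fact
  note b = bimap_pure[OF pairS[OF left_module_SL] pairS[OF left_module_restrict[OF M]] lin_hom_id orbit_hom[OF M m]]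
  show ?thesis
    using b[of s "\<one>\<^bsub>S\<^esub>"] b[of "\<one>\<^bsub>S\<^esub>" s] swap[OF s] s m by simp
qed

text \<open>By the previous lemma \<open>m \<mapsto> 1 \<otimes> m\<close> is inverse to the multiplication map \<open>S \<otimes>\<^sub>R M \<rightarrow> M\<close>.\<close>

lemma base_change_iso:
  assumes M: "left_module S M"
  obtains \<sigma> where "\<sigma> \<in> left_module_hom S (extend_scalars (res M)) M"
    and "bij_betw \<sigma> (carrier (extend_scalars (res M))) (carrier M)"
proof -
  interpret M: left_module S M by fact
  let ?M = "res M"
  note resM = left_module_restrict[OF M]
  interpret T: tensor_pair R SR ?M by (rule pairS[OF resM])
  have bal: "balanced R SR ?M (add_monoid M) (\<lambda>s m. s \<odot>\<^bsub>M\<^esub> m)"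
    by (rule balancedI) (simp_all add: M.smult_l_distr M.smult_r_distr M.smult_assoc)
  define \<sigma> where "\<sigma> = tensor_lift R SR ?M (add_monoid M) (\<lambda>s m. s \<odot>\<^bsub>M\<^esub> m)"
  note \<sigma> = T.tensor_lift_hom[OF M.M.a_comm_group bal, folded \<sigma>_def]
    T.tensor_lift_pure[OF M.M.a_comm_group bal, folded \<sigma>_def]
  have \<sigma>_hom: "\<sigma> \<in> left_module_hom S (extend_scalars ?M) M"
    by (rule extend_scalars_homI[OF resM M \<sigma>(1)]) (simp add: \<sigma>(2) M.smult_assoc)
  have one: "(\<lambda>m. pure_tensor R SR ?M \<one>\<^bsub>S\<^esub> m) \<in> hom (add_monoid M) (tensor R SR ?M)"
    using T.pure_tensor_hom_right[of "\<one>\<^bsub>S\<^esub>"] by (simp add: hom_def)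
  have inv: "pure_tensor R SR ?M \<one>\<^bsub>S\<^esub> (\<sigma> t) = t" if t: "t \<in> carrier (tensor R SR ?M)" for t
    by (rule T.tensor_hom_eqI[OF hom_comp[OF \<sigma>(1) one] hom_ident t]) (simp add: \<sigma>(2) swap_module[OF M, symmetric])
  have "bij_betw \<sigma> (carrier (extend_scalars ?M)) (carrier M)"
    by (rule bij_betwI[where g = "\<lambda>m. pure_tensor R SR ?M \<one>\<^bsub>S\<^esub> m"])
      (use inv \<sigma>(2)[of "\<one>\<^bsub>S\<^esub>"] lin_homD(1)[OF \<sigma>_hom] in auto)
  with \<sigma>_hom show ?thesis by (rule that)
qed

text \<open>The groups \<open>Tor\<^sub>i(S, M)\<close> may be computed from a resolution \<open>Q\<close> of \<open>M\<close> as well as from the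
  resolution \<open>P\<close> of \<open>S\<close>; so exactness of the \<open>P n \<otimes>\<^sub>R M\<close> passes to the \<open>S \<otimes>\<^sub>R Q n\<close>. In the double
  complex of the \<open>P i \<otimes>\<^sub>R B j\<close>, with \<open>B\<close> the resolution \<open>Q\<close> augmented by \<open>M\<close>, the rows are
  exact because \<open>P i\<close> is projective, and the columns, augmented by \<open>S \<otimes>\<^sub>R B j\<close>, are exact
  because \<open>Q\<close> is projective, or by \<open>acyclic_module\<close> and right exactness for the column of \<open>M\<close>.\<close>

lemma base_change_exact:
  fixes M :: "('b, 'u) module" and Q :: "nat \<Rightarrow> ('a, 'u) module"
  assumes M: "left_module S M" and resQ: "projective_resolution R (res M) Q e \<eta>"
  shows "extend_map (Q 0) (res M) \<eta> ` carrier (tensor R SR (Q 0)) =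
      carrier (tensor R SR (res M))"
    and "extend_map (Q (Suc 0)) (Q 0) (e 0) ` carrier (tensor R SR (Q (Suc 0))) =
      {t \<in> carrier (tensor R SR (Q 0)).
        extend_map (Q 0) (res M) \<eta> t = \<one>\<^bsub>tensor R SR (res M)\<^esub>}"
    and "\<And>n. extend_map (Q (Suc (Suc n))) (Q (Suc n)) (e (Suc n)) ` carrier (tensor R SR (Q (Suc (Suc n)))) =
      {t \<in> carrier (tensor R SR (Q (Suc n))). extend_map (Q (Suc n)) (Q n) (e n) t = \<one>\<^bsub>tensor R SR (Q n)\<^esub>}"
proof -
  let ?M = "res M"
  define B where "B j = (case j of 0 \<Rightarrow> ?M | Suc k \<Rightarrow> Q k)" for j
  define \<beta> where "\<beta> j = (case j of 0 \<Rightarrow> \<eta> | Suc k \<Rightarrow> e k)" for j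
  have projQ: "projective R (Q n)" for n using resQ by (simp add: projective_resolution_def)
  have B: "left_module R (B j)" for j
    using projQ left_module_restrict[OF M] by (cases j) (simp_all add: B_def projective_def)
  have \<beta>: "\<beta> j \<in> left_module_hom R (B (Suc j)) (B j)" for j
    using resQ by (cases j) (simp_all add: B_def \<beta>_def projective_resolution_def)
  have \<beta>_surj: "\<beta> 0 ` carrier (B (Suc 0)) = carrier (B 0)"
    using resQ by (simp add: B_def \<beta>_def projective_resolution_def)
  have \<beta>_exact: "\<beta> (Suc j) ` carrier (B (Suc (Suc j))) = {y \<in> carrier (B (Suc j)). \<beta> j y = \<zero>\<^bsub>B j\<^esub>}" for j
    using resQ by (cases j) (simp_all add: B_def \<beta>_def projective_resolution_def)
  note pP = pair[OF B] and pS = pairS[OF B]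
  note cgP = tensor_pair.comm_group_T[OF pP] and cgS = tensor_pair.comm_group_T[OF pS]
  note idr = lin_hom_id and idB = lin_hom_id[of R]
  define G where "G i j = tensor R (P i) (B j)" for i j
  define D where "D j = tensor R SR (B j)" for j
  define h where "h i j = bimap R (P i) (B (Suc j)) (P i) (B j) (\<lambda>x. x) (\<beta> j)" for i j
  define hD where "hD j = extend_map (B (Suc j)) (B j) (\<beta> j)" for j
  define v where "v i j = bimap R (P (Suc i)) (B j) (P i) (B j) (d i) (\<lambda>y. y)" for i j
  define vD where "vD j = bimap R (P 0) (B j) SR (B j) \<epsilon> (\<lambda>y. y)" for j
  have h_hom: "h i j \<in> hom (G i (Suc j)) (G i j)" for i j
    unfolding h_def G_def by (rule bimap_hom[OF pP pP idr \<beta>])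
  have hD_hom: "hD j \<in> hom (D (Suc j)) (D j)" for j
    unfolding hD_def D_def by (rule bimap_hom[OF pS pS idr \<beta>])
  have v_hom: "v i j \<in> hom (G (Suc i) j) (G i j)" for i j
    unfolding v_def G_def by (rule bimap_hom[OF pP pP d_hom idr])
  have vD_hom: "vD j \<in> hom (G 0 j) (D j)" for j
    unfolding vD_def G_def D_def by (rule bimap_hom[OF pP pS \<epsilon>_hom idr])
  have hD_complex: "hD j (hD (Suc j) x) = \<one>\<^bsub>D j\<^esub>" if x: "x \<in> carrier (D (Suc (Suc j)))" for j x
  proof -
    have "hD j (hD (Suc j) x) = extend_map (B (Suc (Suc j))) (B j) (\<lambda>y. \<beta> j (\<beta> (Suc j) y)) x"
      using x unfolding hD_def D_def by (intro bimap_comp[OF pS pS pS idr idr \<beta> \<beta>])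
    also have "\<dots> = \<one>\<^bsub>D j\<^esub>"
      using x \<beta>_exact[of j] unfolding D_def
      by (intro bimap_zero[OF pS pS idr lin_hom_comp[OF \<beta> \<beta>]]) auto
    finally show ?thesis .
  qed
  have acyclic: "acyclic_at D hD (\<lambda>j. carrier (D j)) j" for j
  proof (rule double_complex[where G = G and h = h and v = v and vD = vD])
    show "v i j (h (Suc i) j x) = h i j (v i (Suc j) x)" if "x \<in> carrier (G (Suc i) (Suc j))" for i j x
      using that unfolding v_def h_def G_def
      by (simp add: bimap_comp[OF pP pP pP idr d_hom \<beta> idr] bimap_comp[OF pP pP pP d_hom idr idr \<beta>])
    show "vD j (h 0 j x) = hD j (vD (Suc j) x)" if "x \<in> carrier (G 0 (Suc j))" for j x
      using that unfolding vD_def h_def hD_def G_def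
      by (simp add: bimap_comp[OF pP pP pS idr \<epsilon>_hom \<beta> idr] bimap_comp[OF pP pS pS \<epsilon>_hom idr idr \<beta>])
    show "h i j (h i (Suc j) x) = \<one>\<^bsub>G i j\<^esub>" if x: "x \<in> carrier (G i (Suc (Suc j)))" for i j x
    proof -
      have "h i j (h i (Suc j) x) = bimap R (P i) (B (Suc (Suc j))) (P i) (B j) (\<lambda>x. x) (\<lambda>y. \<beta> j (\<beta> (Suc j) y)) x"
        using x unfolding h_def G_def by (intro bimap_comp[OF pP pP pP idr idr \<beta> \<beta>])
      also have "\<dots> = \<one>\<^bsub>G i j\<^esub>"
        using x \<beta>_exact[of j] unfolding G_def
        by (intro bimap_zero[OF pP pP idr lin_hom_comp[OF \<beta> \<beta>]]) auto
      finally show ?thesis .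
    qed
    show "vD j ` carrier (G 0 j) = carrier (D j)" for j
      using hom_in_carrier[OF vD_hom]
        bimap_surj[OF pP pS \<epsilon>_hom idr, of j] \<epsilon>_surj unfolding vD_def G_def D_def by auto
    show "v (Suc i) j ` carrier (G (Suc (Suc i)) j) = {x \<in> carrier (G (Suc i) j). v i j x = \<one>\<^bsub>G i j\<^esub>}" for i j
    proof
      have "v i j (v (Suc i) j x) = \<one>\<^bsub>G i j\<^esub>" if x: "x \<in> carrier (G (Suc (Suc i)) j)" for x
      proof -
        have "v i j (v (Suc i) j x) = bimap R (P (Suc (Suc i))) (B j) (P i) (B j) (\<lambda>x. d i (d (Suc i) x)) (\<lambda>y. y) x"
          using x unfolding v_def G_def by (intro bimap_comp[OF pP pP pP d_hom d_hom idr idr])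
        also have "\<dots> = \<one>\<^bsub>G i j\<^esub>"
          using x unfolding G_def
          by (intro bimap_zero[OF pP pP lin_hom_comp[OF d_hom d_hom] idr]) (auto simp: d_d)
        finally show ?thesis .
      qed
      then show "v (Suc i) j ` carrier (G (Suc (Suc i)) j) \<subseteq> {x \<in> carrier (G (Suc i) j). v i j x = \<one>\<^bsub>G i j\<^esub>}"
        using hom_in_carrier[OF v_hom] by auto
      have "x \<in> v (Suc i) j ` carrier (G (Suc (Suc i)) j)"
        if x: "x \<in> carrier (G (Suc i) j)" and x0: "v i j x = \<one>\<^bsub>G i j\<^esub>" for x
      proof (cases j)
        case 0
        then show ?thesis
          using acyclic_module[OF M, of x i] x x0 by (simp add: G_def v_def B_def)
      next
        case (Suc k)
        have "y \<in> d (Suc i) ` carrier (P (Suc (Suc i)))" if "y \<in> carrier (P (Suc i))" "d i y = \<zero>\<^bsub>P i\<^esub>" for y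
          using that d_Suc by blast
        then have "\<exists>u\<in>carrier (tensor R (P (Suc (Suc i))) (Q k)).
            bimap R (P (Suc (Suc i))) (Q k) (P (Suc i)) (Q k) (d (Suc i)) (\<lambda>y. y) u = x"
          by (rule projective_tensor_exact_right[OF inf cR projQ left_module_P left_module_P left_module_P d_hom d_hom])
            (use x x0 Suc in \<open>simp_all add: G_def v_def B_def\<close>)
        then show ?thesis
          using Suc by (auto simp: G_def v_def B_def)
      qed
      then show "{x \<in> carrier (G (Suc i) j). v i j x = \<one>\<^bsub>G i j\<^esub>} \<subseteq> v (Suc i) j ` carrier (G (Suc (Suc i)) j)"
        by blast
    qed
    show "v 0 j ` carrier (G (Suc 0) j) = {x \<in> carrier (G 0 j). vD j x = \<one>\<^bsub>D j\<^esub>}" for j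
    proof
      have "vD j (v 0 j x) = \<one>\<^bsub>D j\<^esub>" if x: "x \<in> carrier (G (Suc 0) j)" for x
      proof -
        have "vD j (v 0 j x) = bimap R (P (Suc 0)) (B j) SR (B j) (\<lambda>x. \<epsilon> (d 0 x)) (\<lambda>y. y) x"
          using x unfolding v_def vD_def G_def by (intro bimap_comp[OF pP pP pS d_hom \<epsilon>_hom idr idr])
        also have "\<dots> = \<one>\<^bsub>D j\<^esub>"
          using x unfolding G_def D_def
          by (intro bimap_zero[OF pP pS lin_hom_comp[OF d_hom \<epsilon>_hom] idr]) (auto simp: \<epsilon>_d)
        finally show ?thesis .
      qed
      then show "v 0 j ` carrier (G (Suc 0) j) \<subseteq> {x \<in> carrier (G 0 j). vD j x = \<one>\<^bsub>D j\<^esub>}"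
        using hom_in_carrier[OF v_hom] by auto
      have "x \<in> v 0 j ` carrier (G (Suc 0) j)"
        if x: "x \<in> carrier (G 0 j)" and x0: "vD j x = \<one>\<^bsub>D j\<^esub>" for x
        using x x0 unfolding v_def vD_def G_def D_def
        by (intro tensor_right_exact[OF left_module_P left_module_P left_module_SR B d_hom \<epsilon>_hom])
          (use \<epsilon>_surj d_0 in auto)
      then show "{x \<in> carrier (G 0 j). vD j x = \<one>\<^bsub>D j\<^esub>} \<subseteq> v 0 j ` carrier (G (Suc 0) j)"
        by blast
    qed
    show "acyclic_at (G i) (h i) (\<lambda>j. carrier (G i j)) j" for i j
    proof (cases j)
      case 0
      have "x \<in> h i 0 ` carrier (G i (Suc 0))" if "x \<in> carrier (G i 0)" for x
        using that \<beta>_surj unfolding h_def G_def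
        by (intro bimap_surj[OF pP pP idr \<beta>]) auto
      then show ?thesis using 0 by (auto simp: acyclic_at_def image_iff Bex_def)
    next
      case (Suc k)
      have "y \<in> \<beta> (Suc k) ` carrier (B (Suc (Suc k)))" if "y \<in> carrier (B (Suc k))" "\<beta> k y = \<zero>\<^bsub>B k\<^esub>" for y
        using that \<beta>_exact by blast
      from projective_tensor_exact[OF inf cR proj_P B B B \<beta> \<beta> this]
      have "\<exists>y\<in>carrier (G i (Suc (Suc k))). h i (Suc k) y = x"
        if "x \<in> carrier (G i (Suc k))" "h i k x = \<one>\<^bsub>G i k\<^esub>" for x
        using that unfolding h_def G_def by blast
      then show ?thesis using Suc by (auto simp: acyclic_at_def)
    qed
  qed (simp_all add: h_hom hD_hom v_hom vD_hom, simp_all add: G_def D_def cgP cgS)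
  have exact: "hD (Suc j) ` carrier (D (Suc (Suc j))) = {t \<in> carrier (D (Suc j)). hD j t = \<one>\<^bsub>D j\<^esub>}" for j
  proof
    show "hD (Suc j) ` carrier (D (Suc (Suc j))) \<subseteq> {t \<in> carrier (D (Suc j)). hD j t = \<one>\<^bsub>D j\<^esub>}"
      using hom_in_carrier[OF hD_hom] hD_complex by auto
    show "{t \<in> carrier (D (Suc j)). hD j t = \<one>\<^bsub>D j\<^esub>} \<subseteq> hD (Suc j) ` carrier (D (Suc (Suc j)))"
      using acyclic[of "Suc j"] by (auto simp: acyclic_at_def image_iff Bex_def)
  qed
  have surj: "hD 0 ` carrier (D (Suc 0)) = carrier (D 0)"
    using acyclic[of 0] hom_in_carrier[OF hD_hom] by (auto simp: acyclic_at_def image_iff Bex_def)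
  show "extend_map (Q 0) ?M \<eta> ` carrier (tensor R SR (Q 0)) = carrier (tensor R SR ?M)"
    using surj by (simp add: hD_def D_def B_def \<beta>_def)
  show "extend_map (Q (Suc 0)) (Q 0) (e 0) ` carrier (tensor R SR (Q (Suc 0))) =
      {t \<in> carrier (tensor R SR (Q 0)). extend_map (Q 0) ?M \<eta> t = \<one>\<^bsub>tensor R SR ?M\<^esub>}"
    using exact[of 0] by (simp add: hD_def D_def B_def \<beta>_def)
  show "extend_map (Q (Suc (Suc n))) (Q (Suc n)) (e (Suc n)) ` carrier (tensor R SR (Q (Suc (Suc n)))) =
      {t \<in> carrier (tensor R SR (Q (Suc n))). extend_map (Q (Suc n)) (Q n) (e n) t = \<one>\<^bsub>tensor R SR (Q n)\<^esub>}" for n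
    using exact[of "Suc n"] by (simp add: hD_def D_def B_def \<beta>_def)
qed

section \<open>Global dimension\<close>

text \<open>Extending the scalars of a projective resolution \<open>Q\<close> of \<open>M\<close> over \<open>R\<close> gives a projective resolution
  of \<open>S \<otimes>\<^sub>R M = M\<close> over \<open>S\<close> that is no longer than \<open>Q\<close>.\<close>

lemma projective_dimension_restrict_scalars:
  fixes M :: "('b, 'u) module"
  assumes M: "left_module S M"
  shows "projective_dimension S M \<le> projective_dimension R (res M)"
proof -
  let ?M = "res M"
  obtain \<sigma> where \<sigma>: "\<sigma> \<in> left_module_hom S (extend_scalars ?M) M" "bij_betw \<sigma> (carrier (extend_scalars ?M)) (carrier M)"
    using base_change_iso[OF M] .
  note resM = left_module_restrict[OF M]
  have "\<exists>(P :: nat \<Rightarrow> ('b, 'u) module) d \<epsilon>. projective_resolution S M P d \<epsilon> \<and> (\<forall>k>n. carrier (P k) = {\<zero>\<^bsub>P k\<^esub>})"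
    if res: "projective_resolution R ?M Q e \<eta>" and zero: "\<And>k. k > n \<Longrightarrow> carrier (Q k) = {\<zero>\<^bsub>Q k\<^esub>}"
    for Q :: "nat \<Rightarrow> ('a, 'u) module" and e \<eta> n
  proof -
    have projQ: "projective R (Q n)" and e: "e n \<in> left_module_hom R (Q (Suc n)) (Q n)" for n
      using res by (simp_all add: projective_resolution_def)
    have \<eta>: "\<eta> \<in> left_module_hom R (Q 0) ?M" using res by (simp add: projective_resolution_def)
    have mQ: "left_module R (Q n)" for n using projQ by (simp add: projective_def)
    note exact = base_change_exact[OF M res]
    have size: "carrier (extend_scalars (Q k)) \<lesssim> (UNIV :: 'u set)" for k
      using tensor_lepoll[OF pairS[OF mQ] inf] cS by (simp add: subset_imp_lepoll)
    obtain P' :: "nat \<Rightarrow> ('b, 'u) module" and d' \<epsilon>' where P': "projective_resolution S (extend_scalars ?M) P' d' \<epsilon>'"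
      and zero': "\<And>k. carrier (extend_scalars (Q k)) = {\<zero>\<^bsub>extend_scalars (Q k)\<^esub>} \<Longrightarrow> carrier (P' k) = {\<zero>\<^bsub>P' k\<^esub>}"
      by (rule transport_projective_resolution[where X = "\<lambda>n. extend_scalars (Q n)" and K = S and N = "extend_scalars ?M",
            OF left_module_extend_scalars[OF mQ] extend_scalars_lift[OF projQ] size extend_scalars_map_hom[OF mQ mQ e] extend_scalars_map_hom[OF mQ resM \<eta>]])
        (simp_all add: exact)
    have "carrier (extend_scalars (Q k)) = {\<zero>\<^bsub>extend_scalars (Q k)\<^esub>}" if "k > n" for k
    proof -
      interpret T: tensor_pair R SR "Q k" by (rule pairS[OF mQ])
      have "t = \<one>\<^bsub>tensor R SR (Q k)\<^esub>" if "t \<in> carrier (tensor R SR (Q k))" for t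
        using that zero[OF \<open>k > n\<close>] by (induction rule: T.tensor_induct) simp_all
      then show ?thesis by auto
    qed
    with zero' projective_resolution_iso_target[OF P' left_module_extend_scalars[OF resM] M \<sigma>]
    show ?thesis by blast
  qed
  then show ?thesis
    unfolding projective_dimension_def by (intro Inf_superset_mono) blast
qed

lemma left_global_dimension_le:
  "left_global_dimension TYPE('u) S \<le> left_global_dimension TYPE('u) R"
  unfolding left_global_dimension_def
proof (rule SUP_least)
  fix M :: "('b, 'u) module" assume "M \<in> {M. left_module S M}"
  then have M: "left_module S M" by simp
  have "projective_dimension S M \<le> projective_dimension R (res M)"
    by (rule projective_dimension_restrict_scalars[OF M])
  also have "\<dots> \<le> (SUP M \<in> {M :: ('a, 'u) module. left_module R M}. projective_dimension R M)"
    using left_module_restrict[OF M] by (intro SUP_upper) simp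
  finally show "projective_dimension S M \<le> (SUP M \<in> {M :: ('a, 'u) module. left_module R M}. projective_dimension R M)" .
qed

text \<open>The hypotheses are symmetric. The case \<open>M = S\<close> of the preceding results says that the \<open>S \<otimes>\<^sub>R Q n\<close>
  form an exact complex in positive degrees for a resolution \<open>Q\<close> of the left module \<open>S\<close>; after
  exchanging the factors this is stable flatness over the opposite rings.\<close>

lemma opposite_stably_flat_epi:
  obtains Q :: "nat \<Rightarrow> ('a, 'u) module" and e \<eta> where "stably_flat_epi (opposite R) (opposite S) \<phi> Q e \<eta>"
proof -
  obtain Q :: "nat \<Rightarrow> ('a, 'u) module" and e \<eta> where res: "projective_resolution R SL Q e \<eta>"
    using projective_resolution_exists[OF inf cR left_module_SL] cS by auto
  obtain f :: "'b \<Rightarrow> 'u" where f: "inj_on f (carrier S)" using cS by (rule lepoll_ex_inj)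
  let ?M = "transport_module f (regular_module S)"
  have f': "inj_on f (carrier (regular_module S))" using f by simp
  have M: "left_module S ?M"
    by (rule left_module_transport[OF left_module_regular[OF S] f'])
  have "f \<in> left_module_hom R SL (res ?M)"
    using lin_homD[OF transport_module_hom[OF f', of S]] by (intro lin_homI) simp_all
  moreover have "bij_betw f (carrier SL) (carrier (res ?M))"
    using f by (simp add: bij_betw_def transport_module_simps(1)[OF f'])
  ultimately have res': "projective_resolution R (res ?M) Q e (\<lambda>x. f (\<eta> x))"
    by (rule projective_resolution_iso_target[OF res left_module_SL left_module_restrict[OF M]])
  note exact = base_change_exact(3)[OF M res']
  have mQ: "left_module R (Q n)" and e: "e n \<in> left_module_hom R (Q (Suc n)) (Q n)" for n
    using res by (simp_all add: projective_resolution_def projective_def)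
  note pS = pairS[OF mQ] and pS' = tensor_pair_opposite[OF pairS[OF mQ]]
  have e': "e n \<in> left_module_hom (opposite (opposite R)) (Q (Suc n)) (Q n)" for n using e by simp
  note idr = lin_hom_id
  have "stably_flat_epi (opposite R) (opposite S) \<phi> Q e \<eta>"
  proof (intro stably_flat_epi.intro stably_flat_epi_axioms.intro ring_map.intro)
    show "ring (opposite R)" "ring (opposite S)" "\<phi> \<in> ring_hom (opposite R) (opposite S)"
      by (intro ring_opposite R S ring_hom_opposite \<phi>)+
    show "infinite (UNIV :: 'u set)" "carrier (opposite R) \<lesssim> (UNIV :: 'u set)" "carrier (opposite S) \<lesssim> (UNIV :: 'u set)"
      using inf cR cS by simp_all
    show "projective_resolution (opposite (opposite R)) (res (regular_module (opposite (opposite S)))) Q e \<eta>"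
      using res by simp
    fix s assume "s \<in> carrier (opposite S)"
    then have s: "s \<in> carrier S" by simp
    show "pure_tensor (opposite R) (res (regular_module (opposite (opposite S)))) SR s \<one>\<^bsub>opposite S\<^esub> =
        pure_tensor (opposite R) (res (regular_module (opposite (opposite S)))) SR \<one>\<^bsub>opposite S\<^esub> s"
      using flip_pure[OF pairS[OF left_module_SL], of s "\<one>\<^bsub>S\<^esub>"] flip_pure[OF pairS[OF left_module_SL], of "\<one>\<^bsub>S\<^esub>" s] swap[OF s] s
      by simp
  next
    fix n t
    assume t: "t \<in> carrier (tensor (opposite R) (Q (Suc n)) SR)"
      and t0: "bimap (opposite R) (Q (Suc n)) SR (Q n) SR (e n) (\<lambda>y. y) t = \<one>\<^bsub>tensor (opposite R) (Q n) SR\<^esub>"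
    let ?u = "flip (opposite R) (Q (Suc n)) SR t"
    have u: "?u \<in> carrier (tensor R SR (Q (Suc n)))" using flip_closed[OF pS' t] by simp
    have "extend_map (Q (Suc n)) (Q n) (e n) ?u = \<one>\<^bsub>tensor R SR (Q n)\<^esub>"
      using flip_bimap[OF pS' pS' e' idr t] t0 flip_one[OF pS', of n] by simp
    with u have "?u \<in> {t \<in> carrier (tensor R SR (Q (Suc n))). extend_map (Q (Suc n)) (Q n) (e n) t = \<one>\<^bsub>tensor R SR (Q n)\<^esub>}"
      by simp
    then obtain w where w: "?u = extend_map (Q (Suc (Suc n))) (Q (Suc n)) (e (Suc n)) w"
      "w \<in> carrier (tensor R SR (Q (Suc (Suc n))))"
      unfolding exact[of n, symmetric] by (rule imageE)
    have "bimap (opposite R) (Q (Suc (Suc n))) SR (Q (Suc n)) SR (e (Suc n)) (\<lambda>y. y) (flip R SR (Q (Suc (Suc n))) w) = t"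
      using flip_bimap[OF pS pS idr e w(2)] w(1) flip_flip[OF pS' t] by simp
    then show "t \<in> bimap (opposite R) (Q (Suc (Suc n))) SR (Q (Suc n)) SR (e (Suc n)) (\<lambda>y. y) `
        carrier (tensor (opposite R) (Q (Suc (Suc n))) SR)"
      using flip_closed[OF pS w(2)] by (intro image_eqI) auto
  qed
  then show ?thesis by (rule that)
qed

end

lemma trivial_homology_exact:
  assumes "trivial_group (homology C \<delta> (Suc i))" and "comm_group (C (Suc i))"
    and \<delta>: "\<delta> (Suc i) \<in> hom (C (Suc (Suc i))) (C (Suc i))" "comm_group (C (Suc (Suc i)))"
    and t: "t \<in> carrier (C (Suc i))" "\<delta> i t = \<one>\<^bsub>C i\<^esub>"
  shows "t \<in> \<delta> (Suc i) ` carrier (C (Suc (Suc i)))"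
proof -
  interpret C: comm_group "C (Suc i)" by fact
  let ?H = "\<delta> (Suc i) ` carrier (C (Suc (Suc i)))"
  have H: "subgroup ?H (C (Suc i))"
    by (rule group_hom.img_is_subgroup)
      (intro group_hom.intro group_hom_axioms.intro \<delta> comm_group.axioms(2) assms(2))
  have "carrier (homology C \<delta> (Suc i)) = (\<lambda>x. ?H #>\<^bsub>C (Suc i)\<^esub> x) ` {x \<in> carrier (C (Suc i)). \<delta> i x = \<one>\<^bsub>C i\<^esub>}"
    by (simp add: homology_def carrier_FactGroup cycles_def kernel_def r_coset_def)
  with t have "?H #>\<^bsub>C (Suc i)\<^esub> t \<in> carrier (homology C \<delta> (Suc i))" by simp
  moreover have "carrier (homology C \<delta> (Suc i)) = {?H}"
    using assms(1) by (simp add: trivial_group_def homology_def)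
  ultimately have "?H #>\<^bsub>C (Suc i)\<^esub> t = ?H" by simp
  then show ?thesis by (rule C.coset_join1[OF _ t(1) H])
qed

theorem lemma1p4:
  fixes R :: "'a ring" and S :: "'b ring" and \<phi> :: "'a \<Rightarrow> 'b"
  assumes "ring R" and "ring S"
    and "infinite (UNIV :: 'u set)"
    and "carrier R \<lesssim> (UNIV :: 'u set)"
    and "carrier S \<lesssim> (UNIV :: 'u set)"
    and "ring_epi TYPE('u) R S \<phi>"
    and "stably_flat TYPE('u) R S \<phi>"
  shows "left_global_dimension TYPE('u) S \<le> left_global_dimension TYPE('u) R \<and>
         right_global_dimension TYPE('u) S \<le> right_global_dimension TYPE('u) R"
proof -
  have \<phi>: "\<phi> \<in> ring_hom R S" using assms(6) by (simp add: ring_epi_def)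
  interpret ring_map R S \<phi> by (rule ring_map.intro[OF assms(1,2) \<phi>])
  define resolves where "resolves = (\<lambda>(P :: nat \<Rightarrow> ('a, 'u) module, d, \<epsilon>). projective_resolution (opposite R) SR P d \<epsilon>)"
  obtain P d \<epsilon> where Pd: "(P, d, \<epsilon>) = (SOME x. resolves x)" by (metis prod_cases3)
  \<comment> \<open>\<open>Tor\<close> is computed from an actual resolution only because one exists in the universe.\<close>
  have "\<exists>x. resolves x"
    using projective_resolution_exists[of "opposite R" SR] assms(3-5) left_module_SR
    unfolding resolves_def by (metis (no_types, lifting) carrier_opposite carrier_regular_module carrier_restrict_scalars case_prod_conv)
  then have "resolves (P, d, \<epsilon>)" unfolding Pd by (rule someI_ex)
  then have Pres: "projective_resolution (opposite R) SR P d \<epsilon>" by (simp add: resolves_def)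
  have Tor: "Tor TYPE('u) R SR SL i = homology (\<lambda>n. tensor R (P n) SL) (\<lambda>n. tensor_map R (P n) SL (d n)) i" for i
    unfolding Tor_def resolves_def[symmetric] Pd[symmetric] by simp
  have mP: "left_module (opposite R) (P n)" and d: "d n \<in> left_module_hom (opposite R) (P (Suc n)) (P n)" for n
    using Pres by (simp_all add: projective_resolution_def projective_def)
  note pair = tensor_pairI[OF mP left_module_SL]
  interpret stably_flat_epi R S \<phi> P d \<epsilon>
  proof
    show "pure_tensor R SR SL s \<one>\<^bsub>S\<^esub> = pure_tensor R SR SL \<one>\<^bsub>S\<^esub> s" if "s \<in> carrier S" for s
      by (rule ring_epi_tensor_swap[OF assms(6,3,5) that])
    fix n t assume t: "t \<in> carrier (tensor R (P (Suc n)) SL)"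
      and t0: "bimap R (P (Suc n)) SL (P n) SL (d n) (\<lambda>y. y) t = \<one>\<^bsub>tensor R (P n) SL\<^esub>"
    have "trivial_group (Tor TYPE('u) R SR SL (Suc n))"
      using assms(7) by (simp add: stably_flat_def)
    then have "t \<in> tensor_map R (P (Suc n)) SL (d (Suc n)) ` carrier (tensor R (P (Suc (Suc n))) SL)"
      unfolding Tor
      by (rule trivial_homology_exact)
        (use t t0 in \<open>simp_all add: tensor_map_eq_bimap[OF pair pair d] tensor_map_hom[OF pair pair d]
          tensor_pair.comm_group_T[OF pair]\<close>)
    then show "t \<in> bimap R (P (Suc (Suc n))) SL (P (Suc n)) SL (d (Suc n)) (\<lambda>y. y) ` carrier (tensor R (P (Suc (Suc n))) SL)"
      using tensor_map_eq_bimap[OF pair pair d] by auto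
  qed (use assms Pres in simp_all)
  obtain Q :: "nat \<Rightarrow> ('a, 'u) module" and e \<eta> where "stably_flat_epi (opposite R) (opposite S) \<phi> Q e \<eta>"
    by (rule opposite_stably_flat_epi)
  then interpret op: stably_flat_epi "opposite R" "opposite S" \<phi> Q e \<eta> .
  show ?thesis
    unfolding right_global_dimension_def
    using left_global_dimension_le op.left_global_dimension_le by blast
qed

end
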